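(* Let $T>0$, $\theta\in(0,1)$, $\delta>0$, $\varepsilon\in(0,1)$. Let $X=\{X(t),t\in\mathbb{R}\}$ be a separable, mean-square continuous, strictly sub-Gaussian random process which satisfies condition RC, and let $Y(t)=\exp\{X(t)\}$. Assume that $X$ admits the expansion (E) in which the random variables $\xi_{0k},\eta_{jl}$ are independent strictly sub-Gaussian random variables. Let $\phi,\psi$ be the scaling function and wavelet used in (E), and assume additionally: (a) $\hat\phi$ is absolutely continuous on every interval; for each fixed $t$, $u(t,y)$ is absolutely continuous in $y$; the derivatives $u'_y(t,y)$, $\hat\phi'(y)$, $\hat\psi'(y)$ exist; $|\hat\psi'(y)|\le C<\infty$; $|u(t,y)|\le |t|\,u_1(y)$ and $|u'_y(t,y)|\le |t|\,u_2(y)$ for some functions $u_1,u_2\ge 0$ with $\int_{\mathbb{R}}u_1(y)|y|dy<\infty$, $\int_{\mathbb{R}}u_1(y)dy<\infty$, $\int_{\mathbb{R}}u_1(y)|\hat\phi'(y)|dy<\infty$, $\int_{\mathbb{R}}u_1(y)|\hat\phi(y)|dy<\infty$, $\int_{\mathbb{R}}u_2(y)|y|dy<\infty$, $\int_{\mathbb{R}}u_2(y)|\hat\phi(y)|dy<\infty$; and for all $t\in[0,T]$ and all $j=0,1,\dots$: $\lim_{|y|\to\infty}u(t,y)\overline{\hat\psi(y/2^j)}=0$ and $\lim_{|y|\to\infty}u(t,y)\hat\phi(y)=0$. (b) With $S(y)=\overline{\hat\psi(y)}$ and $S_\phi(y)=\overline{\hat\phi(y)}$: $|S'(y)|\le M<\infty$,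 and there exist functions $v,w\ge0$ such that for all $t_1,t_2\in[0,T]$ and $y\in\mathbb{R}$, $|u'_y(t_1,y)-u'_y(t_2,y)|\le |t_2-t_1|\,v(y)$, $|u(t_1,y)-u(t_2,y)|\le|t_2-t_1|\,w(y)$, with $\int|y|v(y)dy$, $\int v(y)|S_\phi(y)|dy$, $\int w(y)|S'_\phi(y)|dy$, $\int w(y)dy$, $\int w(y)|y|dy$, $\int w(y)|S_\phi(y)|dy$ all finite. Define $E_2=\frac{1}{\sqrt{2\pi}}\left(\int u_1|\hat\phi'|dy+\int u_2|\hat\phi|dy\right)$, $F_1=\frac{C}{\sqrt{2\pi}}\int u_1(y)|y|dy$, $F_2=\frac{C}{\sqrt{2\pi}}\int (u_1(y)+|y|u_2(y))dy$, $A^{(1)}=\frac{1}{\sqrt{2\pi}}\left(\int v|S_\phi|dy+\int w|S'_\phi|dy\right)$, $B^{(0)}=\frac{M}{\sqrt{2\pi}}\int w(y)|y|dy$, $B^{(1)}=\frac{M}{\sqrt{2\pi}}\int(w(y)+|y|v(y))dy$, and $\hat\varepsilon=\delta\sqrt{\varepsilon}$, $A(\theta)=\int_{1/(2\theta)}^\infty\frac{\sqrt{v+1}}{v^2}dv$, $\tau_1=\frac{e^{1/2}\hat\varepsilon}{2^{7/4}(64+\hat\varepsilon^2)^{1/4}}$, $\tau_2=(32\ln(1+\hat\varepsilon^2/60))^{1/2}$, $\tau_3=\sqrt{\ln(1+\hat\varepsilon^3/8)}/\sqrt2$, $\tau_*=\min\{\tau_1,\tau_2,\tau_3\}$, $Q=\frac{e^{1/2}\hat\varepsilon\,\theta(1-\theta)}{2^{9/4}A(\theta)T(1+\hat\varepsilon^3/8)}$,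 $N_0^*=1+\frac{8(A^{(1)})^2}{Q^2}$, $N^*=\max\{1+\log_8\frac{4(B^{(0)})^2}{7Q^2},\,3+\log_2\frac{4(B^{(1)})^2}{Q^2}\}$, $M^*=1+16\frac{(B^{(1)})^2}{Q^2}$, $N_0^{**}=\frac{6}{\tau_*^2}E_2^2T^2+1$, $N^{**}=\max\{1+\log_2\frac{72F_2^2T^2}{5\tau_*^2},\,1+\log_8\frac{18F_1^2T^2}{7\tau_*^2}\}$, $M^{**}=1+\frac{12}{\tau_*^2}F_2^2T^2$. Let $N_0,N,M_0,\dots,M_{N-1}$ be positive integers with $N_0>\max\{N_0^*,N_0^{**}\}$, $N>\max\{N^*,N^{**}\}$, $M_j>\max\{M^*,M^{**}\}$ for $j=0,\dots,N-1$, let $\hat X$ and $\hat Y=\exp\{\hat X\}$ be the corresponding models, and suppose $\sup_{t\in[0,T]}\mathsf{E}(X(t)-\hat X(t))^2>0$. Then $$\mathrm{P}\Big\{\sup_{t\in[0,T]}|Y(t)/\hat Y(t)-1|>\delta\Big\}\le\varepsilon .$$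
   Context: A real random variable $\xi$ is sub-Gaussian if there is $a\ge0$ with $\mathsf{E}\exp\{\lambda\xi\}\le\exp\{\lambda^2a^2/2\}$ for all $\lambda\in\mathbb{R}$; $\tau(\xi)$ is the infimum of such $a$. It is strictly sub-Gaussian if $\tau(\xi)=(\mathsf{E}\xi^2)^{1/2}$. A process $\{X(t),t\in\mathbf{T}\}$ is strictly sub-Gaussian if for any finite or countable set of $\xi_i\in\{X(t)\}$ and reals $\lambda_i$, $\tau^2(\sum\lambda_i\xi_i)=\mathsf{E}(\sum\lambda_i\xi_i)^2$. $\phi$ is the scaling function of a multiresolution analysis of $L_2(\mathbb{R})$ with $\{\phi(\cdot-k),k\in\mathbb{Z}\}$ orthonormal, $\psi$ the corresponding wavelet; $\phi_{0k}(x)=\phi(x-k)$, $\psi_{jl}(x)=2^{j/2}\psi(2^jx-l)$; $\hat f$ denotes the Fourier transform. Standing setting: $X$ is a centered process with $\mathsf{E}|X(t)|^2<\infty$, and there is a Borel function $u(t,\lambda)$ with $\int_{\mathbb{R}}|u(t,\lambda)|^2d\lambda<\infty$ for all $t$ and $R(t,s)=\mathsf{E}X(t)\overline{X(s)}=\int_{\mathbb{R}}u(t,\lambda)\overline{u(s,\lambda)}d\lambda$. Set $a_{0k}(t)=\frac1{\sqrt{2\pi}}\int u(t,y)\overline{\hat\phi(y)}e^{iyk}dy$ and $b_{jl}(t)=\frac1{\sqrt{2\pi}}\int u(t,y)2^{-j/2}e^{iyl/2^j}\overline{\hat\psi(y/2^j)}dy$. Expansion (E): $X(t)=\sum_{k\in\mathbb{Z}}\xi_{0k}a_{0k}(t)+\sum_{j=0}^\infty\sum_{l\in\mathbb{Z}}\eta_{jl}b_{jl}(t)$,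 converging in $L_2(\Omega)$ for every $t$, where $\xi_{0k},\eta_{jl}$ are centered with $\mathsf{E}\xi_{0k}\overline{\xi_{0l}}=\delta_{kl}$, $\mathsf{E}\eta_{mk}\overline{\eta_{nl}}=\delta_{mn}\delta_{kl}$, $\mathsf{E}\xi_{0k}\overline{\eta_{nl}}=0$. Condition RC: $X$ is as in the standing setting, $u(t,\cdot)\in L_1(\mathbb{R})\cap L_2(\mathbb{R})$ for each $t$, and the inverse Fourier transform of $u(t,x)$ in $x$ is real (so $a_{0k},b_{jl}$ are real). Models: $\hat X(t)=\sum_{k=-(N_0-1)}^{N_0-1}\xi_{0k}a_{0k}(t)+\sum_{j=0}^{N-1}\sum_{l=-(M_j-1)}^{M_j-1}\eta_{jl}b_{jl}(t)$ and $\hat Y(t)=\exp\{\hat X(t)\}$. *)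

theory Defs
  imports "HOL-Probability.Probability"
begin

definition abs_cont_on :: "real \<Rightarrow> real \<Rightarrow> (real \<Rightarrow> complex) \<Rightarrow> bool" where
  "abs_cont_on a b f \<longleftrightarrow>
     (\<forall>e>0. \<exists>d>0. \<forall>n::nat. \<forall>x y :: nat \<Rightarrow> real.
        (\<forall>i<n. a \<le> x i \<and> x i \<le> y i \<and> y i \<le> b) \<and>
        (\<forall>i<n. \<forall>k<n. i \<noteq> k \<longrightarrow> y i \<le> x k \<or> y k \<le> x i) \<and>
        (\<Sum>i<n. y i - x i) < d
        \<longrightarrow> (\<Sum>i<n. cmod (f (y i) - f (x i))) < e)"

definition abs_cont_every_interval :: "(real \<Rightarrow> complex) \<Rightarrow> bool" where
  "abs_cont_every_interval f \<longleftrightarrow> (\<forall>a b. abs_cont_on a b f)"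

definition L2fun :: "(real \<Rightarrow> complex) \<Rightarrow> bool" where
  "L2fun f \<longleftrightarrow> f \<in> borel_measurable lborel \<and> integrable lborel (\<lambda>x. (cmod (f x))\<^sup>2)"

definition l2norm :: "(real \<Rightarrow> complex) \<Rightarrow> real" where
  "l2norm f = sqrt (LINT x|lborel. (cmod (f x))\<^sup>2)"

definition l2inner :: "(real \<Rightarrow> complex) \<Rightarrow> (real \<Rightarrow> complex) \<Rightarrow> complex" where
  "l2inner f g = (LINT x|lborel. f x * cnj (g x))"

definition fourier_L1 :: "(real \<Rightarrow> complex) \<Rightarrow> real \<Rightarrow> complex" where
  "fourier_L1 f y = (LINT x|lborel. f x * exp (- \<i> * complex_of_real (y * x)))"

text \<open>\<open>F\<close> is (a version of) the Plancherel Fourier transform of \<open>f \<in> L2\<close>: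
  the L2-limit of the Fourier transforms of the truncations \<open>f \<cdot> 1_{[-n,n]}\<close>.\<close>
definition is_fourier :: "(real \<Rightarrow> complex) \<Rightarrow> (real \<Rightarrow> complex) \<Rightarrow> bool" where
  "is_fourier f F \<longleftrightarrow> L2fun f \<and> L2fun F \<and>
     (\<lambda>n::nat. l2norm (\<lambda>y. F y - fourier_L1 (\<lambda>x. indicator {- real n..real n} x * f x) y))
        \<longlonglongrightarrow> 0"

definition fin_span :: "(real \<Rightarrow> complex) set \<Rightarrow> (real \<Rightarrow> complex) set" where
  "fin_span S = {f. \<exists>G c. finite G \<and> G \<subseteq> S \<and> f = (\<lambda>x. \<Sum>g\<in>G. c g * g x)}"

definition closed_span :: "(real \<Rightarrow> complex) set \<Rightarrow> (real \<Rightarrow> complex) set" where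
  "closed_span S = {f. L2fun f \<and> (\<exists>s. (\<forall>n::nat. s n \<in> fin_span S) \<and>
                        (\<lambda>n. l2norm (\<lambda>x. s n x - f x)) \<longlonglongrightarrow> 0)}"

definition orthonormal_fam :: "('i \<Rightarrow> real \<Rightarrow> complex) \<Rightarrow> 'i set \<Rightarrow> bool" where
  "orthonormal_fam e I \<longleftrightarrow> (\<forall>i\<in>I. L2fun (e i)) \<and>
     (\<forall>i\<in>I. \<forall>j\<in>I. l2inner (e i) (e j) = (if i = j then 1 else 0))"

definition MRA_V :: "(real \<Rightarrow> complex) \<Rightarrow> int \<Rightarrow> (real \<Rightarrow> complex) set" where
  "MRA_V \<phi> j = {f. L2fun f \<and>
      (\<lambda>x. f (x / 2 powr real_of_int j)) \<in> closed_span {(\<lambda>x. \<phi> (x - real_of_int k)) | k. True}}"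

definition is_MRA_scaling :: "(real \<Rightarrow> complex) \<Rightarrow> bool" where
  "is_MRA_scaling \<phi> \<longleftrightarrow>
     orthonormal_fam (\<lambda>k x. \<phi> (x - real_of_int k)) (UNIV :: int set) \<and>
     (\<forall>j. MRA_V \<phi> j \<subseteq> MRA_V \<phi> (j + 1)) \<and>
     closed_span (\<Union>j. MRA_V \<phi> j) = {f. L2fun f} \<and>
     (\<Inter>j. MRA_V \<phi> j) \<subseteq> {f. AE x in lborel. f x = 0}"

text \<open>\<open>\<psi>\<close> is a wavelet corresponding to \<open>\<phi>\<close>: its integer translates form an orthonormal
  basis of \<open>W_0 = V_1 \<ominus> V_0\<close>.\<close>
definition is_MRA_wavelet :: "(real \<Rightarrow> complex) \<Rightarrow> (real \<Rightarrow> complex) \<Rightarrow> bool" where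
  "is_MRA_wavelet \<phi> \<psi> \<longleftrightarrow>
     orthonormal_fam (\<lambda>l x. \<psi> (x - real_of_int l)) (UNIV :: int set) \<and>
     (\<forall>l::int. (\<lambda>x. \<psi> (x - real_of_int l)) \<in> MRA_V \<phi> 1) \<and>
     (\<forall>l::int. \<forall>f\<in>MRA_V \<phi> 0. l2inner (\<lambda>x. \<psi> (x - real_of_int l)) f = 0) \<and>
     MRA_V \<phi> 1 \<subseteq> closed_span (MRA_V \<phi> 0 \<union> {(\<lambda>x. \<psi> (x - real_of_int l)) | l. True})"

definition subG_bound :: "'w measure \<Rightarrow> ('w \<Rightarrow> real) \<Rightarrow> real \<Rightarrow> bool" where
  "subG_bound M \<xi> a \<longleftrightarrow> a \<ge> 0 \<and> (\<forall>lam::real. integrable M (\<lambda>w. exp (lam * \<xi> w)) \<and>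
       (\<integral>w. exp (lam * \<xi> w) \<partial>M) \<le> exp (lam\<^sup>2 * a\<^sup>2 / 2))"

definition sub_gaussian :: "'w measure \<Rightarrow> ('w \<Rightarrow> real) \<Rightarrow> bool" where
  "sub_gaussian M \<xi> \<longleftrightarrow> \<xi> \<in> borel_measurable M \<and> (\<exists>a. subG_bound M \<xi> a)"

definition subG_tau :: "'w measure \<Rightarrow> ('w \<Rightarrow> real) \<Rightarrow> real" where
  "subG_tau M \<xi> = Inf {a. subG_bound M \<xi> a}"

definition strictly_sub_gaussian :: "'w measure \<Rightarrow> ('w \<Rightarrow> real) \<Rightarrow> bool" where
  "strictly_sub_gaussian M \<xi> \<longleftrightarrow> sub_gaussian M \<xi> \<and>
     subG_tau M \<xi> = sqrt (\<integral>w. (\<xi> w)\<^sup>2 \<partial>M)"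

text \<open>Strictly sub-Gaussian process: every finite or countable linear combination
  \<open>\<Sum>\<lambda>_i X(t_i)\<close> (countable ones converging in mean square; finite ones are the case
  \<open>\<lambda>_i = 0\<close> eventually) satisfies \<open>\<tau>^2 = E(\<cdot>)^2\<close>.\<close>
definition strictly_sub_gaussian_process :: "'w measure \<Rightarrow> (real \<Rightarrow> 'w \<Rightarrow> real) \<Rightarrow> bool" where
  "strictly_sub_gaussian_process M X \<longleftrightarrow>
     (\<forall>(s::nat \<Rightarrow> real) (lam::nat \<Rightarrow> real) \<zeta>.
        \<zeta> \<in> borel_measurable M \<and> integrable M (\<lambda>w. (\<zeta> w)\<^sup>2) \<and>
        (\<lambda>n. \<integral>w. (\<zeta> w - (\<Sum>i<n. lam i * X (s i) w))\<^sup>2 \<partial>M) \<longlonglongrightarrow> 0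
        \<longrightarrow> sub_gaussian M \<zeta> \<and> (subG_tau M \<zeta>)\<^sup>2 = (\<integral>w. (\<zeta> w)\<^sup>2 \<partial>M))"

definition separable_process :: "'w measure \<Rightarrow> (real \<Rightarrow> 'w \<Rightarrow> real) \<Rightarrow> bool" where
  "separable_process M X \<longleftrightarrow> (\<exists>D N. countable D \<and> closure D = UNIV \<and> N \<in> null_sets M \<and>
     (\<forall>w\<in>space M - N. \<forall>t. \<exists>s::nat \<Rightarrow> real. (\<forall>n. s n \<in> D) \<and> s \<longlonglongrightarrow> t \<and>
          (\<lambda>n. X (s n) w) \<longlonglongrightarrow> X t w))"

definition ms_continuous :: "'w measure \<Rightarrow> (real \<Rightarrow> 'w \<Rightarrow> real) \<Rightarrow> bool" where
  "ms_continuous M X \<longleftrightarrow> (\<forall>t. ((\<lambda>s. \<integral>w. (X s w - X t w)\<^sup>2 \<partial>M) \<longlongrightarrow> 0) (at t))"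

definition standing_setting :: "'w measure \<Rightarrow> (real \<Rightarrow> 'w \<Rightarrow> real) \<Rightarrow> (real \<Rightarrow> real \<Rightarrow> complex) \<Rightarrow> bool" where
  "standing_setting M X u \<longleftrightarrow>
     (\<forall>t. X t \<in> borel_measurable M \<and> integrable M (\<lambda>w. (X t w)\<^sup>2) \<and> (\<integral>w. X t w \<partial>M) = 0) \<and>
     (\<lambda>(t, y). u t y) \<in> borel_measurable borel \<and>
     (\<forall>t. integrable lborel (\<lambda>y. (cmod (u t y))\<^sup>2)) \<and>
     (\<forall>t s. complex_of_real (\<integral>w. X t w * X s w \<partial>M) = (LINT y|lborel. u t y * cnj (u s y)))"

definition condition_RC :: "'w measure \<Rightarrow> (real \<Rightarrow> 'w \<Rightarrow> real) \<Rightarrow> (real \<Rightarrow> real \<Rightarrow> complex) \<Rightarrow> bool" where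
  "condition_RC M X u \<longleftrightarrow> standing_setting M X u \<and>
     (\<forall>t. integrable lborel (u t) \<and> L2fun (u t)) \<and>
     (\<forall>t x. Im (LINT y|lborel. u t y * exp (\<i> * complex_of_real (x * y))) = 0)"

text \<open>\<open>a_{0k}(t)\<close>, with \<open>\<Phi> = \<hat>\<phi>\<close>.\<close>
definition coef_a :: "(real \<Rightarrow> real \<Rightarrow> complex) \<Rightarrow> (real \<Rightarrow> complex) \<Rightarrow> int \<Rightarrow> real \<Rightarrow> complex" where
  "coef_a u \<Phi> k t = (1 / sqrt (2 * pi)) *
     (LINT y|lborel. u t y * cnj (\<Phi> y) * exp (\<i> * complex_of_real (y * real_of_int k)))"

text \<open>\<open>b_{jl}(t)\<close>, with \<open>\<Psi> = \<hat>\<psi>\<close>.\<close>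
definition coef_b :: "(real \<Rightarrow> real \<Rightarrow> complex) \<Rightarrow> (real \<Rightarrow> complex) \<Rightarrow> nat \<Rightarrow> int \<Rightarrow> real \<Rightarrow> complex" where
  "coef_b u \<Psi> j l t = (1 / sqrt (2 * pi)) *
     (LINT y|lborel. u t y * complex_of_real (2 powr (- real j / 2)) *
        exp (\<i> * complex_of_real (y * real_of_int l / 2 ^ j)) * cnj (\<Psi> (y / 2 ^ j)))"

text \<open>Truncated expansion: \<open>k\<close> over \<open>|k| \<le> N0-1\<close>, \<open>j < N\<close>, \<open>l\<close> over \<open>|l| \<le> Mj j - 1\<close>.
  (By RC the coefficients are real; we take real parts.)\<close>
definition model_X :: "(real \<Rightarrow> real \<Rightarrow> complex) \<Rightarrow> (real \<Rightarrow> complex) \<Rightarrow> (real \<Rightarrow> complex) \<Rightarrow>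
    (int \<Rightarrow> 'w \<Rightarrow> real) \<Rightarrow> (nat \<Rightarrow> int \<Rightarrow> 'w \<Rightarrow> real) \<Rightarrow> nat \<Rightarrow> nat \<Rightarrow> (nat \<Rightarrow> nat) \<Rightarrow>
    real \<Rightarrow> 'w \<Rightarrow> real" where
  "model_X u \<Phi> \<Psi> \<xi> \<eta> N0 N Mj t w =
     (\<Sum>k\<in>{- (int N0 - 1)..int N0 - 1}. \<xi> k w * Re (coef_a u \<Phi> k t)) +
     (\<Sum>j<N. \<Sum>l\<in>{- (int (Mj j) - 1)..int (Mj j) - 1}. \<eta> j l w * Re (coef_b u \<Psi> j l t))"

text \<open>Expansion (E), convergence in \<open>L_2(\<Omega>)\<close> for every t, along the exhausting
  truncations \<open>N0 = N = M_j = n \<rightarrow> \<infinity>\<close> (equivalent to unconditional convergence of the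
  orthogonal series, given the orthonormality conditions).\<close>
definition expansion_E :: "'w measure \<Rightarrow> (real \<Rightarrow> 'w \<Rightarrow> real) \<Rightarrow> (real \<Rightarrow> real \<Rightarrow> complex) \<Rightarrow>
    (real \<Rightarrow> complex) \<Rightarrow> (real \<Rightarrow> complex) \<Rightarrow> (int \<Rightarrow> 'w \<Rightarrow> real) \<Rightarrow> (nat \<Rightarrow> int \<Rightarrow> 'w \<Rightarrow> real) \<Rightarrow> bool" where
  "expansion_E M X u \<Phi> \<Psi> \<xi> \<eta> \<longleftrightarrow>
     (\<forall>k. \<xi> k \<in> borel_measurable M \<and> integrable M (\<lambda>w. (\<xi> k w)\<^sup>2) \<and> (\<integral>w. \<xi> k w \<partial>M) = 0) \<and>
     (\<forall>j l. \<eta> j l \<in> borel_measurable M \<and> integrable M (\<lambda>w. (\<eta> j l w)\<^sup>2) \<and> (\<integral>w. \<eta> j l w \<partial>M) = 0) \<and>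
     (\<forall>k k'. (\<integral>w. \<xi> k w * \<xi> k' w \<partial>M) = (if k = k' then 1 else 0)) \<and>
     (\<forall>m k n l. (\<integral>w. \<eta> m k w * \<eta> n l w \<partial>M) = (if m = n \<and> k = l then 1 else 0)) \<and>
     (\<forall>k n l. (\<integral>w. \<xi> k w * \<eta> n l w \<partial>M) = 0) \<and>
     (\<forall>t. (\<lambda>n. \<integral>w. (X t w - model_X u \<Phi> \<Psi> \<xi> \<eta> n n (\<lambda>_. n) t w)\<^sup>2 \<partial>M) \<longlonglongrightarrow> 0)"

end

(* The hypotheses give |u(t,y)| <= |t| u1(y), so X(0) = 0 almost surely and the error Z = X - Xh
   vanishes at 0. Its increments are L2 limits of linear combinations of independent strictly
   sub-Gaussian variables, hence sub-Gaussian with their standard deviation as parameter, and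
   integration by parts bounds that deviation by Q |t - s|. Dyadic chaining, applied to the convex
   function exp(2y) + exp(-2y) - 2 >= (exp|y| - 1)^2, then bounds the second moment of
   sup (exp|Z| - 1) by 96 (Q T)^2 <= e^2, and Markov's inequality finishes the proof.
   The decay of the wavelet coefficients needs Re Psi(0) = 0. Instead of deriving it from the
   multiresolution analysis we read it off from Bessel's inequality for the expansion (E). *)
theory Submission
  imports Defs "HOL-Real_Asymp.Real_Asymp"
begin

text \<open>The convex function of the chaining step vanishes to second order at 0, so the
  \<open>2 ^ n\<close> increments over steps of length \<open>T / 2 ^ n\<close> add up to a summable
  amount and the maximum over a level can be replaced by a plain sum. Its expectation involves only
  two exponential moments, which is what sub-Gaussianity controls. Splitting the error over the
  levels with weights proportional to \<open>(3 / 4) ^ n\<close> produces the constant 96 = 32 * 3.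
  On the wavelet side the obstacle is the translate l = 0: integration by parts gives nothing there,
  and smallness for large levels has to come from the behaviour of \<open>\<Psi>\<close> near 0.
  Only the real part of \<open>\<Psi> 0\<close> matters, because the inverse Fourier transform of u
  is real. Chaining sees countably many times only. Separability carries X to all the others; the
  model follows because its coefficients are Lipschitz in t.\<close>

section \<open>Decay of Fourier transforms\<close>

text \<open>The derivatives are given only pointwise, without continuity; as limits of difference
  quotients with steps \<open>1 / (n + 1)\<close> they are measurable and can enter
  integrals.\<close>

lemma borel_measurable_vector_derivative:
  fixes f f' :: "real \<Rightarrow> complex"
  assumes "\<And>y. (f has_vector_derivative f' y) (at y)"
  shows "f' \<in> borel_measurable borel"
proof (rule borel_measurable_LIMSEQ_metric)
  have [measurable]: "f \<in> borel_measurable borel"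
    using assms by (intro borel_measurable_continuous_onI continuous_at_imp_continuous_on)
      (auto intro: has_vector_derivative_continuous)
  show "(\<lambda>y. real (Suc n) *\<^sub>R (f (y + 1 / real (Suc n)) - f y)) \<in> borel_measurable borel" for n
    by measurable
  fix y
  have "((\<lambda>h. (f (y + h) - f y) /\<^sub>R h) \<longlongrightarrow> f' y) (at 0)"
  proof -
    have "((\<lambda>h. norm (f (y + h) - f y - h *\<^sub>R f' y) / norm h) \<longlongrightarrow> 0) (at 0)"
      using assms[of y] unfolding has_vector_derivative_def has_derivative_at by simp
    moreover have "norm (f (y + h) - f y - h *\<^sub>R f' y) / norm h
        = norm ((f (y + h) - f y) /\<^sub>R h - f' y)" if "h \<noteq> 0" for h
    proof -
      have "(f (y + h) - f y) /\<^sub>R h - f' y = (f (y + h) - f y - h *\<^sub>R f' y) /\<^sub>R h"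
        using that by (simp add: scaleR_diff_right)
      then show ?thesis by (simp add: divide_inverse mult.commute)
    qed
    ultimately have "((\<lambda>h. norm ((f (y + h) - f y) /\<^sub>R h - f' y)) \<longlongrightarrow> 0) (at 0)"
      by (auto intro: Lim_transform_eventually simp: eventually_at_filter)
    then show ?thesis using tendsto_norm_zero_iff LIM_zero_iff by blast
  qed
  moreover have "filterlim (\<lambda>n. 1 / real (Suc n)) (at 0) sequentially"
    by (intro filterlim_atI LIMSEQ_Suc lim_1_over_n) auto
  ultimately have "(\<lambda>n. (f (y + 1 / real (Suc n)) - f y) /\<^sub>R (1 / real (Suc n))) \<longlonglongrightarrow> f' y"
    by (rule filterlim_compose)
  then show "(\<lambda>n. real (Suc n) *\<^sub>R (f (y + 1 / real (Suc n)) - f y)) \<longlonglongrightarrow> f' y"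
    by (simp add: divide_inverse)
qed

text \<open>A nonzero limit would keep \<open>cmod (h y)\<close> above \<open>cmod L / 2\<close> on
  a half-line, which has infinite measure.\<close>

lemma integrable_tendsto_at_top_imp_0:
  fixes h :: "real \<Rightarrow> complex"
  assumes h: "integrable lborel h" and L: "(h \<longlongrightarrow> L) at_top"
  shows "L = 0"
proof (rule ccontr)
  assume "L \<noteq> 0"
  with L have "eventually (\<lambda>y. cmod (h y) > cmod L / 2) at_top"
    by (intro order_tendstoD(1)[OF tendsto_norm]) auto
  then obtain B where B: "\<And>y. y \<ge> B \<Longrightarrow> cmod (h y) > cmod L / 2"
    by (auto simp: eventually_at_top_linorder)
  have "integrable lborel (\<lambda>y. cmod L / 2 * indicator {B..} y :: real)"
    by (rule Bochner_Integration.integrable_bound[OF h])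
       (use less_imp_le[OF B] in \<open>auto split: split_indicator\<close>)
  with \<open>L \<noteq> 0\<close> have "integrable lborel (indicator {B..} :: real \<Rightarrow> real)"
    by (subst (asm) integrable_mult_left_iff) auto
  then have fin: "emeasure lborel {B..} < \<infinity>"
    by (simp add: integrable_indicator_iff)
  have "of_nat n \<le> emeasure lborel {B..}" for n :: nat
  proof -
    have "emeasure lborel {B..B + real n} \<le> emeasure lborel {B..}"
      by (intro emeasure_mono) auto
    then show ?thesis by (simp add: ennreal_of_nat_eq_real_of_nat)
  qed
  with fin show False
    using ennreal_Ex_less_of_nat[of "emeasure lborel {B..}"] by (auto simp flip: not_le)
qed

lemma integral_Icc_vector_derivative:
  fixes h h' :: "real \<Rightarrow> complex"
  assumes d: "\<And>y. (h has_vector_derivative h' y) (at y)" and h': "integrable lborel h'"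
    and "a \<le> b"
  shows "(LINT y:{a..b}|lborel. h' y) = h b - h a"
proof -
  have "(h' has_integral h b - h a) {a..b}"
    by (rule fundamental_theorem_of_calculus[OF \<open>a \<le> b\<close> has_vector_derivative_at_within[OF d]])
  moreover have "set_integrable lborel {a..b} h'"
    unfolding set_integrable_def using h' by (intro integrable_mult_indicator) auto
  ultimately show ?thesis
    by (simp add: set_borel_integral_eq_integral(2) integral_unique)
qed

text \<open>The integral of \<open>h'\<close> over \<open>{0..b}\<close> is \<open>h b - h 0\<close>
  and converges, so \<open>h\<close> has some limit; integrability of \<open>h\<close> leaves only 0
  for it.\<close>

lemma tendsto_0_if_derivative_integrable:
  fixes h h' :: "real \<Rightarrow> complex"
  assumes d: "\<And>y. (h has_vector_derivative h' y) (at y)"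
    and h: "integrable lborel h" and h': "integrable lborel h'"
  shows "(h \<longlongrightarrow> 0) at_top"
proof -
  have "set_integrable lborel {0..} h'"
    unfolding set_integrable_def using h' by (intro integrable_mult_indicator) auto
  then have "((\<lambda>b. LINT y:{0..b}|lborel. h' y) \<longlongrightarrow> (LINT y:{0..}|lborel. h' y)) at_top"
    by (intro tendsto_set_lebesgue_integral_at_top) auto
  moreover have "eventually (\<lambda>b. (LINT y:{0..b}|lborel. h' y) = h b - h 0) at_top"
    using eventually_ge_at_top[of 0]
    by eventually_elim (rule integral_Icc_vector_derivative[OF d h'])
  ultimately have "((\<lambda>b. h b - h 0) \<longlongrightarrow> (LINT y:{0..}|lborel. h' y)) at_top"
    by (rule Lim_transform_eventually)
  from tendsto_add[OF this tendsto_const[of "h 0"]]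
  have "(h \<longlongrightarrow> (LINT y:{0..}|lborel. h' y) + h 0) at_top" by simp
  with integrable_tendsto_at_top_imp_0[OF h this] show ?thesis by simp
qed

text \<open>Over \<open>{-n..n}\<close> the integral is \<open>h n - h (-n)\<close>, and both ends
  tend to 0, the left one after a reflection.\<close>

lemma integral_vector_derivative_eq_0:
  fixes h h' :: "real \<Rightarrow> complex"
  assumes d: "\<And>y. (h has_vector_derivative h' y) (at y)"
    and h: "integrable lborel h" and h': "integrable lborel h'"
  shows "(LINT y|lborel. h' y) = 0"
proof -
  have n: "filterlim real at_top sequentially" by (rule filterlim_real_sequentially)
  have 1: "(\<lambda>n. h (real n)) \<longlonglongrightarrow> 0"
    using tendsto_0_if_derivative_integrable[OF assms] n by (rule filterlim_compose)
  have "((\<lambda>y. h (- y)) \<longlongrightarrow> 0) at_top"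
  proof (rule tendsto_0_if_derivative_integrable)
    show "((\<lambda>y. h (- y)) has_vector_derivative - h' (- y)) (at y)" for y
    proof -
      have "(uminus has_vector_derivative (-1::real)) (at y)"
        by (auto intro!: derivative_eq_intros)
      from vector_diff_chain_at[OF this d] show ?thesis by (simp add: o_def)
    qed
    show "integrable lborel (\<lambda>y. h (- y))" "integrable lborel (\<lambda>y. - h' (- y))"
      using lborel_integrable_real_affine[OF h, of "-1" 0]
        lborel_integrable_real_affine[OF h', of "-1" 0] by auto
  qed
  from filterlim_compose[OF this n] have 2: "(\<lambda>n. h (- real n)) \<longlonglongrightarrow> 0" .
  have "(\<lambda>n. LINT y|lborel. indicator {- real n..real n} y *\<^sub>R h' y) \<longlonglongrightarrow> (LINT y|lborel. h' y)"
  proof (rule integral_dominated_convergence[where w="\<lambda>y. cmod (h' y)"])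
    show "AE y in lborel. (\<lambda>n. indicator {- real n..real n} y *\<^sub>R h' y) \<longlonglongrightarrow> h' y"
    proof (intro AE_I2 tendsto_eventually)
      fix y
      have "eventually (\<lambda>n. real n \<ge> \<bar>y\<bar>) sequentially"
        using n by (auto simp: filterlim_at_top)
      then show "eventually (\<lambda>n. indicator {- real n..real n} y *\<^sub>R h' y = h' y) sequentially"
        by eventually_elim (auto simp: indicator_def)
    qed
  qed (use h' in \<open>auto split: split_indicator\<close>)
  moreover have "(LINT y|lborel. indicator {- real n..real n} y *\<^sub>R h' y) = h (real n) - h (- real n)" for n
    using integral_Icc_vector_derivative[OF d h', of "- real n" "real n"]
    by (simp add: set_lebesgue_integral_def)
  ultimately have "(\<lambda>n. h (real n) - h (- real n)) \<longlonglongrightarrow> (LINT y|lborel. h' y)" by simp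
  from LIMSEQ_unique[OF this tendsto_diff[OF 1 2]] show ?thesis by simp
qed

text \<open>Integration by parts without boundary terms: the derivative of \<open>h\<close> times
  the exponential is integrable with integral 0, which trades the factor \<open>k\<close> for a
  derivative on \<open>h\<close>.\<close>

lemma fourier_coefficient_decay:
  fixes h h' :: "real \<Rightarrow> complex"
  assumes d: "\<And>y. (h has_vector_derivative h' y) (at y)"
    and h: "integrable lborel h" and h': "integrable lborel h'"
  shows "\<bar>k\<bar> * cmod (LINT y|lborel. h y * exp (\<i> * complex_of_real (y * k)))
           \<le> (LINT y|lborel. cmod (h' y))"
proof -
  let ?e = "\<lambda>y. exp (\<i> * complex_of_real (y * k))"
  have [measurable]: "h \<in> borel_measurable borel" "h' \<in> borel_measurable borel"
    using h h' by auto
  have i1: "integrable lborel (\<lambda>y. h y * ?e y)"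
    by (rule Bochner_Integration.integrable_bound[OF h]) (auto simp: norm_mult)
  have i2: "integrable lborel (\<lambda>y. h' y * ?e y)"
    by (rule Bochner_Integration.integrable_bound[OF h']) (auto simp: norm_mult)
  have "(LINT y|lborel. h' y * ?e y + \<i> * complex_of_real k * (h y * ?e y)) = 0"
  proof (rule integral_vector_derivative_eq_0)
    show "((\<lambda>y. h y * ?e y) has_vector_derivative
        (h' y * ?e y + \<i> * complex_of_real k * (h y * ?e y))) (at y)" for y
    proof -
      have "(?e has_vector_derivative (\<i> * complex_of_real k) * ?e y) (at y)"
        unfolding of_real_mult
        by (rule has_vector_derivative_real_field[where f="\<lambda>z. exp (\<i> * (z * complex_of_real k))"])
          (auto intro!: derivative_eq_intros)
      from has_vector_derivative_mult[OF d this] show ?thesis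
        by (simp add: algebra_simps)
    qed
  qed (use i1 i2 in auto)
  then have "(LINT y|lborel. h' y * ?e y) = - (\<i> * complex_of_real k * (LINT y|lborel. h y * ?e y))"
    using i1 i2 by (simp add: eq_neg_iff_add_eq_0)
  then have "\<bar>k\<bar> * cmod (LINT y|lborel. h y * ?e y) = cmod (LINT y|lborel. h' y * ?e y)"
    by (simp add: norm_mult)
  also have "\<dots> \<le> (LINT y|lborel. cmod (h' y * ?e y))"
    by (rule integral_norm_bound)
  also have "(\<lambda>y. cmod (h' y * ?e y)) = (\<lambda>y. cmod (h' y))"
    by (auto simp: norm_mult)
  finally show ?thesis .
qed

section \<open>Sub-Gaussian random variables\<close>

text \<open>The infimum that defines \<open>subG_tau\<close> is attained: admissible constants come
  arbitrarily close to it, and the exponential bound is continuous in the constant.\<close>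

lemma strictly_sub_gaussian_imp_subG_bound:
  assumes "strictly_sub_gaussian M \<xi>"
  shows "subG_bound M \<xi> (sqrt (\<integral>w. (\<xi> w)\<^sup>2 \<partial>M))"
proof -
  let ?\<tau> = "sqrt (\<integral>w. (\<xi> w)\<^sup>2 \<partial>M)"
  let ?S = "{a. subG_bound M \<xi> a}"
  from assms obtain a0 where a0: "a0 \<in> ?S" and Inf: "Inf ?S = ?\<tau>"
    by (auto simp: strictly_sub_gaussian_def sub_gaussian_def subG_tau_def)
  have near: "\<exists>a\<in>?S. a < ?\<tau> + e" if "e > 0" for e
    using cInf_lessD[of ?S "?\<tau> + e"] a0 Inf that by auto
  show ?thesis
    unfolding subG_bound_def
  proof (intro conjI allI)
    show "?\<tau> \<ge> 0" by simp
    fix lam :: real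
    show "integrable M (\<lambda>w. exp (lam * \<xi> w))"
      using a0 by (simp add: subG_bound_def)
    have "(\<integral>w. exp (lam * \<xi> w) \<partial>M) \<le> exp (lam\<^sup>2 * (?\<tau> + 1 / real (Suc n))\<^sup>2 / 2)" for n
    proof -
      obtain a where a: "subG_bound M \<xi> a" "a < ?\<tau> + 1 / real (Suc n)"
        using near[of "1 / real (Suc n)"] by auto
      then have "(\<integral>w. exp (lam * \<xi> w) \<partial>M) \<le> exp (lam\<^sup>2 * a\<^sup>2 / 2)"
        by (simp add: subG_bound_def)
      also have "\<dots> \<le> exp (lam\<^sup>2 * (?\<tau> + 1 / real (Suc n))\<^sup>2 / 2)"
        using a by (auto simp: subG_bound_def intro!: divide_right_mono mult_left_mono power_mono)
      finally show ?thesis .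
    qed
    moreover have "(\<lambda>n. exp (lam\<^sup>2 * (?\<tau> + 1 / real (Suc n))\<^sup>2 / 2))
        \<longlonglongrightarrow> exp (lam\<^sup>2 * (?\<tau> + 0)\<^sup>2 / 2)"
      by (intro tendsto_intros LIMSEQ_Suc lim_1_over_n) auto
    ultimately show "(\<integral>w. exp (lam * \<xi> w) \<partial>M) \<le> exp (lam\<^sup>2 * ?\<tau>\<^sup>2 / 2)"
      by (intro LIMSEQ_le_const) auto
  qed
qed

text \<open>Exponential moments of independent variables multiply, hence the squares of the
  parameters add.\<close>

lemma (in prob_space) subG_bound_sum_indep:
  fixes \<zeta> :: "'i \<Rightarrow> 'a \<Rightarrow> real"
  assumes indep: "indep_vars (\<lambda>_. borel) \<zeta> UNIV" and F: "finite F"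
    and sg: "\<And>i. subG_bound M (\<zeta> i) 1"
  shows "subG_bound M (\<lambda>w. \<Sum>i\<in>F. \<zeta> i w * c i) (sqrt (\<Sum>i\<in>F. (c i)\<^sup>2))"
  unfolding subG_bound_def
proof (intro conjI allI)
  show "sqrt (\<Sum>i\<in>F. (c i)\<^sup>2) \<ge> 0" by (simp add: sum_nonneg)
  fix lam :: real
  have eq: "exp (lam * (\<Sum>i\<in>F. \<zeta> i w * c i)) = (\<Prod>i\<in>F. exp ((lam * c i) * \<zeta> i w))" for w
    using F by (simp add: sum_distrib_left exp_sum mult_ac)
  have ind: "indep_vars (\<lambda>_. borel) (\<lambda>i w. exp ((lam * c i) * \<zeta> i w)) F"
    using indep_vars_subset[OF indep subset_UNIV[of F]]
    by (rule indep_vars_compose2) measurable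
  have int: "integrable M (\<lambda>w. exp ((lam * c i) * \<zeta> i w))" for i
    using sg[of i] unfolding subG_bound_def by blast
  show "integrable M (\<lambda>w. exp (lam * (\<Sum>i\<in>F. \<zeta> i w * c i)))"
    unfolding eq by (rule indep_vars_integrable[OF F ind int])
  have "(\<integral>w. exp (lam * (\<Sum>i\<in>F. \<zeta> i w * c i)) \<partial>M)
      = (\<Prod>i\<in>F. \<integral>w. exp ((lam * c i) * \<zeta> i w) \<partial>M)"
    unfolding eq by (rule indep_vars_lebesgue_integral[OF F ind int])
  also have "\<dots> \<le> (\<Prod>i\<in>F. exp ((lam * c i)\<^sup>2 / 2))"
  proof (intro prod_mono conjI)
    fix i
    show "(\<integral>w. exp ((lam * c i) * \<zeta> i w) \<partial>M) \<le> exp ((lam * c i)\<^sup>2 / 2)"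
      using sg[of i] unfolding subG_bound_def by (metis mult.right_neutral one_power2)
  qed simp
  also have "\<dots> = exp (lam\<^sup>2 * (\<Sum>i\<in>F. (c i)\<^sup>2) / 2)"
    using F by (simp add: sum_distrib_left exp_sum power_mult_distrib sum_divide_distrib)
  finally show "(\<integral>w. exp (lam * (\<Sum>i\<in>F. \<zeta> i w * c i)) \<partial>M)
      \<le> exp (lam\<^sup>2 * (sqrt (\<Sum>i\<in>F. (c i)\<^sup>2))\<^sup>2 / 2)"
    by (simp add: sum_nonneg)
qed

lemma subG_bound_mono:
  assumes "subG_bound M \<xi> a" "a \<le> b"
  shows "subG_bound M \<xi> b"
  unfolding subG_bound_def
proof (intro conjI allI)
  show "b \<ge> 0" using assms by (auto simp: subG_bound_def)
  fix lam :: real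
  show "integrable M (\<lambda>w. exp (lam * \<xi> w))"
    using assms by (simp add: subG_bound_def)
  have "(\<integral>w. exp (lam * \<xi> w) \<partial>M) \<le> exp (lam\<^sup>2 * a\<^sup>2 / 2)"
    using assms by (simp add: subG_bound_def)
  also have "\<dots> \<le> exp (lam\<^sup>2 * b\<^sup>2 / 2)"
    using assms by (auto simp: subG_bound_def intro!: divide_right_mono mult_left_mono power_mono)
  finally show "(\<integral>w. exp (lam * \<xi> w) \<partial>M) \<le> exp (lam\<^sup>2 * b\<^sup>2 / 2)" .
qed

text \<open>A subsequence converges almost surely, and Fatou's lemma carries the bound on
  exponential moments to the limit. The threshold \<open>n0\<close> is there for truncated series,
  which are controlled only once they contain the whole model.\<close>

lemma subG_bound_L2_limit:
  fixes Y :: "nat \<Rightarrow> 'w \<Rightarrow> real"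
  assumes [measurable]: "\<And>n. Y n \<in> borel_measurable M" "Z \<in> borel_measurable M"
    and int: "\<And>n. integrable M (\<lambda>w. (Z w - Y n w)\<^sup>2)"
    and lim: "(\<lambda>n. \<integral>w. (Z w - Y n w)\<^sup>2 \<partial>M) \<longlonglongrightarrow> 0"
    and sg: "\<And>n. n \<ge> n0 \<Longrightarrow> subG_bound M (Y n) a"
  shows "subG_bound M Z a"
proof -
  obtain r :: "nat \<Rightarrow> nat" where r: "strict_mono r"
    and ae: "AE w in M. (\<lambda>n. (Z w - Y (r n) w)\<^sup>2) \<longlonglongrightarrow> 0"
    using tendsto_L1_AE_subseq[where u="\<lambda>n w. (Z w - Y n w)\<^sup>2", OF int] lim by auto
  have ae': "AE w in M. (\<lambda>n. Y (r n) w) \<longlonglongrightarrow> Z w"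
    using ae
  proof eventually_elim
    case (elim w)
    from tendsto_real_sqrt[OF elim] have "(\<lambda>n. \<bar>Z w - Y (r n) w\<bar>) \<longlonglongrightarrow> 0" by simp
    then have "(\<lambda>n. Z w - Y (r n) w) \<longlonglongrightarrow> 0" by (rule tendsto_rabs_zero_cancel)
    from tendsto_diff[OF tendsto_const[of "Z w"] this] show ?case by simp
  qed
  have nn: "(\<integral>\<^sup>+w. ennreal (exp (lam * Z w)) \<partial>M) \<le> ennreal (exp (lam\<^sup>2 * a\<^sup>2 / 2))" for lam
  proof -
    have "(\<integral>\<^sup>+w. ennreal (exp (lam * Z w)) \<partial>M)
        = (\<integral>\<^sup>+w. liminf (\<lambda>n. ennreal (exp (lam * Y (r n) w))) \<partial>M)"
    proof (rule nn_integral_cong_AE)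
      show "AE w in M. ennreal (exp (lam * Z w)) = liminf (\<lambda>n. ennreal (exp (lam * Y (r n) w)))"
        using ae'
      proof eventually_elim
        case (elim w)
        then have "(\<lambda>n. ennreal (exp (lam * Y (r n) w))) \<longlonglongrightarrow> ennreal (exp (lam * Z w))"
          by (intro tendsto_intros tendsto_ennrealI)
        then show ?case
          by (intro lim_imp_Liminf[symmetric]) auto
      qed
    qed
    also have "\<dots> \<le> liminf (\<lambda>n. \<integral>\<^sup>+w. ennreal (exp (lam * Y (r n) w)) \<partial>M)"
      by (rule nn_integral_liminf) measurable
    also have "\<dots> \<le> ennreal (exp (lam\<^sup>2 * a\<^sup>2 / 2))"
    proof (rule Liminf_le)
      show "\<forall>\<^sub>F n in sequentially. (\<integral>\<^sup>+w. ennreal (exp (lam * Y (r n) w)) \<partial>M)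
          \<le> ennreal (exp (lam\<^sup>2 * a\<^sup>2 / 2))"
        using eventually_ge_at_top[of n0]
      proof eventually_elim
        case (elim n)
        then have "r n \<ge> n0" using seq_suble[OF r, of n] by linarith
        from sg[OF this] show ?case
          by (subst nn_integral_eq_integral) (auto simp: subG_bound_def)
      qed
    qed simp
    finally show ?thesis .
  qed
  show ?thesis
    unfolding subG_bound_def
  proof (intro conjI allI)
    show "a \<ge> 0" using sg[of n0] by (simp add: subG_bound_def)
    fix lam :: real
    show i: "integrable M (\<lambda>w. exp (lam * Z w))"
      using nn[of lam] by (intro integrableI_bounded) (auto intro: le_less_trans)
    show "(\<integral>w. exp (lam * Z w) \<partial>M) \<le> exp (lam\<^sup>2 * a\<^sup>2 / 2)"
      using nn[of lam] by (subst (asm) nn_integral_eq_integral[OF i]) auto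
  qed
qed

section \<open>Dyadic chaining\<close>

text \<open>This is four times the square of sinh. The exponential form reduces its expectation to
  moment generating functions and its convexity to that of \<open>exp\<close>.\<close>

definition sinh_sq :: "real \<Rightarrow> real" where
  "sinh_sq y = exp (2 * y) + exp (- 2 * y) - 2"

lemma sinh_sq_eq: "sinh_sq y = (exp y - exp (- y))\<^sup>2"
  by (simp add: sinh_sq_def power2_diff flip: exp_double exp_minus_inverse)
    (simp add: exp_minus_inverse)

lemma sinh_sq_0 [simp]: "sinh_sq 0 = 0"
  by (simp add: sinh_sq_def)

lemma sinh_sq_nonneg [simp]: "sinh_sq y \<ge> 0"
  by (simp add: sinh_sq_eq)

lemma borel_measurable_sinh_sq [measurable]: "sinh_sq \<in> borel_measurable borel"
  unfolding sinh_sq_def by measurable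

lemma sinh_sq_ge: "(exp \<bar>y\<bar> - 1)\<^sup>2 \<le> sinh_sq y"
proof -
  have "sinh_sq y = (exp \<bar>y\<bar> - exp (- \<bar>y\<bar>))\<^sup>2"
    by (simp add: sinh_sq_eq abs_if power2_commute)
  also have "\<dots> \<ge> (exp \<bar>y\<bar> - 1)\<^sup>2"
    by (intro power_mono) auto
  finally show ?thesis .
qed

lemma sinh_sq_ge_square: "y\<^sup>2 \<le> sinh_sq y"
proof -
  have "\<bar>y\<bar>\<^sup>2 \<le> (exp \<bar>y\<bar> - 1)\<^sup>2"
    using exp_ge_add_one_self[of "\<bar>y\<bar>"] by (intro power_mono) linarith+
  with sinh_sq_ge[of y] show ?thesis by simp
qed

text \<open>Jensen's inequality: the sum is the mean of the points \<open>y m / w m\<close> with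
  weights \<open>w m\<close>, the missing mass being placed at 0, where \<open>sinh_sq\<close>
  vanishes.\<close>

lemma sinh_sq_sum_le:
  fixes w y :: "nat \<Rightarrow> real"
  assumes w: "\<And>m. w m > 0" and w1: "(\<Sum>m<n. w m) \<le> 1"
  shows "sinh_sq (\<Sum>m<n. y m) \<le> (\<Sum>m<n. w m * sinh_sq (y m / w m))"
proof -
  \<comment> \<open>The extra index \<open>n\<close> carries the missing mass. At the point 0 the
    exponential is 1, so it contributes a constant that later combines with the \<open>- 2\<close>
    in \<open>sinh_sq\<close>.\<close>
  let ?w = "\<lambda>m. if m < n then w m else 1 - (\<Sum>m<n. w m)"
  let ?y = "\<lambda>m. if m < n then y m / w m else 0"
  have conv: "exp (a * (\<Sum>m<n. y m)) \<le> (\<Sum>m<n. w m * exp (a * (y m / w m))) + (1 - (\<Sum>m<n. w m))" for a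
  proof -
    have "exp (\<Sum>m\<in>{..<Suc n}. ?w m *\<^sub>R (a * ?y m)) \<le> (\<Sum>m\<in>{..<Suc n}. ?w m * exp (a * ?y m))"
      using w w1 by (intro convex_on_sum[OF _ _ exp_convex]) (auto simp: less_imp_le)
    also have "(\<Sum>m\<in>{..<Suc n}. ?w m *\<^sub>R (a * ?y m)) = a * (\<Sum>m<n. y m)"
      using w by (simp add: sum_distrib_left mult_ac less_imp_neq[THEN not_sym])
    finally show ?thesis by simp
  qed
  have "sinh_sq (\<Sum>m<n. y m) \<le> (\<Sum>m<n. w m * exp (2 * (y m / w m))) + (1 - (\<Sum>m<n. w m))
      + ((\<Sum>m<n. w m * exp (- 2 * (y m / w m))) + (1 - (\<Sum>m<n. w m))) - 2"
    unfolding sinh_sq_def by (intro diff_right_mono add_mono conv)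
  also have "\<dots> = (\<Sum>m<n. w m * sinh_sq (y m / w m))"
    by (simp add: sinh_sq_def algebra_simps sum.distrib sum_subtractf sum_distrib_left)
  finally show ?thesis .
qed

lemma integral_sinh_sq_le:
  assumes "prob_space M" and sg: "subG_bound M Y a" 
  shows "integrable M (\<lambda>\<omega>. sinh_sq (c * Y \<omega>))"
    and "(\<integral>\<omega>. sinh_sq (c * Y \<omega>) \<partial>M) \<le> 2 * (exp (2 * c\<^sup>2 * a\<^sup>2) - 1)"
proof -
  interpret prob_space M by fact
  have i: "integrable M (\<lambda>\<omega>. exp ((2 * c) * Y \<omega>))" "integrable M (\<lambda>\<omega>. exp ((- 2 * c) * Y \<omega>))"
    using sg unfolding subG_bound_def by blast+
  have le: "(\<integral>\<omega>. exp ((2 * c) * Y \<omega>) \<partial>M) \<le> exp ((2 * c)\<^sup>2 * a\<^sup>2 / 2)"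
     "(\<integral>\<omega>. exp ((- 2 * c) * Y \<omega>) \<partial>M) \<le> exp ((- 2 * c)\<^sup>2 * a\<^sup>2 / 2)"
    using sg unfolding subG_bound_def by blast+
  have eq: "sinh_sq (c * Y \<omega>) = exp ((2 * c) * Y \<omega>) + exp ((- 2 * c) * Y \<omega>) - 2" for \<omega>
    by (simp add: sinh_sq_def mult.assoc)
  show "integrable M (\<lambda>\<omega>. sinh_sq (c * Y \<omega>))"
    unfolding eq by (intro Bochner_Integration.integrable_diff Bochner_Integration.integrable_add i) auto
  have "(\<integral>\<omega>. sinh_sq (c * Y \<omega>) \<partial>M)
      = (\<integral>\<omega>. exp ((2 * c) * Y \<omega>) \<partial>M) + (\<integral>\<omega>. exp ((- 2 * c) * Y \<omega>) \<partial>M) - 2"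
    unfolding eq using i by (simp add: prob_space)
  with le show "(\<integral>\<omega>. sinh_sq (c * Y \<omega>) \<partial>M) \<le> 2 * (exp (2 * c\<^sup>2 * a\<^sup>2) - 1)"
    by (simp add: power_mult_distrib mult_ac)
qed

text \<open>The point \<open>T * k n / 2 ^ n\<close> is the left neighbour of \<open>s\<close> in
  the grid of level n. At the next level it stays or moves right by one step of the finer grid, so a
  chain of such points uses only increments between adjacent grid points.\<close>

lemma dyadic_index:
  fixes T s :: real
  assumes T: "T > 0" and s: "s \<in> {0..T}"
  defines "k \<equiv> \<lambda>n::nat. nat \<lfloor>2 ^ n * s / T\<rfloor>"
  shows "k n \<le> 2 ^ n" "T * k n / 2 ^ n \<in> {0..T}" "\<bar>s - T * k n / 2 ^ n\<bar> \<le> T / 2 ^ n"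
    "k (Suc n) = 2 * k n \<or> k (Suc n) = 2 * k n + 1"
proof -
  have fl: "real (k n) = of_int \<lfloor>2 ^ n * s / T\<rfloor>" for n
    using T s by (simp add: k_def)
  have le: "real (k n) \<le> 2 ^ n * s / T" and gt: "2 ^ n * s / T < real (k n) + 1" for n
    unfolding fl by linarith+
  have "2 ^ n * s / T \<le> 2 ^ n" for n
    using T s by (simp add: field_simps)
  with le have "real (k n) \<le> 2 ^ n" for n by (rule order_trans)
  then have kn: "k n \<le> 2 ^ n" for n by (metis of_nat_le_iff of_nat_numeral of_nat_power)
  then show "k n \<le> 2 ^ n" .
  have l: "T * k n / 2 ^ n \<le> s" and g: "s < T * k n / 2 ^ n + T / 2 ^ n"
    using le[of n] gt[of n] T by (auto simp: field_simps)
  then show "\<bar>s - T * k n / 2 ^ n\<bar> \<le> T / 2 ^ n" by linarith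
  show "T * k n / 2 ^ n \<in> {0..T}"
    using l s T by auto
  have "real (k (Suc n)) < 2 * (real (k n) + 1)" "2 * real (k n) < real (k (Suc n)) + 1"
    using le[of n] gt[of n] le[of "Suc n"] gt[of "Suc n"] by auto
  then have "real (k (Suc n)) < real (2 * (k n + 1))" "real (2 * k n) < real (k (Suc n) + 1)"
    by simp_all
  then have "k (Suc n) < 2 * (k n + 1)" "2 * k n < k (Suc n) + 1"
    by (simp_all only: of_nat_less_iff)
  then show "k (Suc n) = 2 * k n \<or> k (Suc n) = 2 * k n + 1"
    by (metis add.commute less_antisym less_Suc_eq linorder_neqE_nat mult_2 mult_Suc_right not_less_eq plus_1_eq_Suc add_2_eq_Suc Suc_eq_plus1)
qed

text \<open>A single random variable, the sum \<open>G\<close> of all rescaled increments over all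
  levels, dominates \<open>sinh_sq\<close> of \<open>Z - Z 0\<close> at every dyadic approximation
  at once. Its mean is at most \<open>96 * (q * T)\<^sup>2\<close>, and off the event where it
  reaches \<open>\<delta>\<^sup>2\<close> the bound passes to the points of \<open>D\<close> by
  almost sure convergence.\<close>

lemma chaining:
  fixes Z :: "real \<Rightarrow> 'w \<Rightarrow> real"
  assumes P: "prob_space M" and T: "T > 0" and q: "q \<ge> 0" and \<delta>: "\<delta> > 0"
    and meas: "\<And>t. t \<in> {0..T} \<Longrightarrow> Z t \<in> borel_measurable M"
    and sg: "\<And>s t. s \<in> {0..T} \<Longrightarrow> t \<in> {0..T} \<Longrightarrow>
               subG_bound M (\<lambda>\<omega>. Z t \<omega> - Z s \<omega>) (q * \<bar>t - s\<bar>)"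
    and small: "32 * (q * T)\<^sup>2 \<le> 1"
    and D: "countable D" "D \<subseteq> {0..T}"
  shows "\<exists>A\<in>sets M. measure M A \<le> 96 * (q * T)\<^sup>2 / \<delta>\<^sup>2 \<and>
           (\<forall>\<omega>\<in>space M - A. \<forall>s\<in>D. exp \<bar>Z s \<omega> - Z 0 \<omega>\<bar> - 1 \<le> \<delta>)"
proof -
  interpret prob_space M by fact
  \<comment> \<open>Weights of total mass 1. A ratio r between 1/2 and 1 makes the level sums
    geometric with ratio \<open>1 / (2 * r)\<close>; here this is 2/3, and 3/4 is close to the best
    choice \<open>1 / sqrt 2\<close>.\<close>
  define w :: "nat \<Rightarrow> real" where "w n = (1 / 4) * (3 / 4) ^ n" for n
  have w_pos: "w n > 0" for n by (simp add: w_def)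
  have w_sum: "(\<Sum>m<n. w m) \<le> 1" for n
  proof -
    have "(\<Sum>m<n. w m) = 1 - (3 / 4) ^ n"
      by (induction n) (auto simp: w_def)
    then show ?thesis by simp
  qed
  define pt :: "nat \<Rightarrow> nat \<Rightarrow> real" where "pt n i = T * real i / 2 ^ n" for n i
  have pt_in: "pt n i \<in> {0..T}" if "i \<le> 2 ^ n" for n i
  proof -
    have "real i \<le> 2 ^ n" using that by (metis of_nat_le_iff of_nat_numeral of_nat_power)
    then have "T * real i \<le> T * 2 ^ n" using T by (intro mult_left_mono) auto
    then show ?thesis using T by (simp add: pt_def field_simps)
  qed
  define \<Delta> where "\<Delta> n i \<omega> = Z (pt n (Suc i)) \<omega> - Z (pt n i) \<omega>" for n i \<omega>
  have meas\<Delta>: "\<Delta> n i \<in> borel_measurable M" if "i < 2 ^ n" for n i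
    unfolding \<Delta>_def using that by (intro borel_measurable_diff meas pt_in) auto
  \<comment> \<open>All adjacent pairs of the level are summed: whichever pair the chain of a given
    \<open>s\<close> passes through, its term is at most \<open>L n\<close>.\<close>
  define L where "L n \<omega> = (\<Sum>i<2 ^ n. w n * sinh_sq (\<Delta> n i \<omega> / w n))" for n \<omega>
  have L_nonneg: "L n \<omega> \<ge> 0" for n \<omega>
    unfolding L_def using w_pos by (auto intro!: sum_nonneg simp: less_imp_le)
  have L_meas [measurable]: "L n \<in> borel_measurable M" for n
    unfolding L_def using meas\<Delta> by (auto intro!: borel_measurable_sum)
  have L_int: "(\<integral>\<^sup>+\<omega>. ennreal (L n \<omega>) \<partial>M) \<le> ennreal (32 * (q * T)\<^sup>2 * (2 / 3) ^ n)" for n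
  proof -
    have sg\<Delta>: "subG_bound M (\<Delta> n i) (q * (T / 2 ^ n))" if "i < 2 ^ n" for i
    proof -
      have "\<bar>pt n (Suc i) - pt n i\<bar> = T / 2 ^ n"
        using T by (simp add: pt_def field_simps)
      then show ?thesis
        unfolding \<Delta>_def using sg[OF pt_in pt_in, of i n "Suc i" n] that by simp
    qed
    \<comment> \<open>Twice the squared sub-Gaussian parameter of the increment divided by
      \<open>w n\<close>. The assumption \<open>small\<close> keeps it at most 1, which allows
      \<open>exp x - 1\<close> to be bounded linearly by \<open>2 * x\<close>.\<close>
    define x where "x = 32 * (q * T)\<^sup>2 * (4 / 9) ^ n"
    have xeq: "2 * (1 / w n)\<^sup>2 * (q * (T / 2 ^ n))\<^sup>2 = x"
    proof -
      have "((3::real) / 4) ^ n * 2 ^ n = (3 / 2) ^ n" by (simp flip: power_mult_distrib)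
      then have "1 / w n * (q * (T / 2 ^ n)) = 4 * (q * T) / (3 / 2) ^ n"
        by (simp add: w_def field_simps)
      then have "(1 / w n)\<^sup>2 * (q * (T / 2 ^ n))\<^sup>2 = 16 * (q * T)\<^sup>2 / ((3 / 2) ^ n)\<^sup>2"
        by (simp flip: power_mult_distrib) (simp add: power_divide power_mult_distrib)
      also have "(((3::real) / 2) ^ n)\<^sup>2 = (9 / 4) ^ n"
        by (simp add: power2_eq_square flip: power_mult_distrib)
      also have "16 * (q * T)\<^sup>2 / (9 / 4) ^ n = 16 * (q * T)\<^sup>2 * (4 / 9) ^ n"
        by (simp add: power_divide)
      finally show ?thesis by (simp add: x_def)
    qed
    have x1: "0 \<le> x" "x \<le> 1"
    proof -
      have "x \<le> 1 * 1"
        unfolding x_def using small by (intro mult_mono) (auto simp: power_le_one)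
      then show "x \<le> 1" by simp
    qed (simp add: x_def)
    have "x\<^sup>2 \<le> x"
      using mult_left_le[OF x1(2,1)] by (simp only: power2_eq_square)
    then have ex: "exp x - 1 \<le> 2 * x" using exp_bound[OF x1] by linarith
    have int: "integrable M (\<lambda>\<omega>. sinh_sq (\<Delta> n i \<omega> / w n))"
      and le: "(\<integral>\<omega>. sinh_sq (\<Delta> n i \<omega> / w n) \<partial>M) \<le> 4 * x" if "i < 2 ^ n" for i
    proof -
      show "integrable M (\<lambda>\<omega>. sinh_sq (\<Delta> n i \<omega> / w n))"
        using integral_sinh_sq_le(1)[OF P sg\<Delta>[OF that], of "1 / w n"] by simp
      have "(\<integral>\<omega>. sinh_sq (\<Delta> n i \<omega> / w n) \<partial>M)
          \<le> 2 * (exp (2 * (1 / w n)\<^sup>2 * (q * (T / 2 ^ n))\<^sup>2) - 1)"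
        using integral_sinh_sq_le(2)[OF P sg\<Delta>[OF that], of "1 / w n"] by simp
      also have "\<dots> \<le> 4 * x"
        unfolding xeq using ex by simp
      finally show "(\<integral>\<omega>. sinh_sq (\<Delta> n i \<omega> / w n) \<partial>M) \<le> 4 * x" .
    qed
    have intL: "integrable M (L n)"
      unfolding L_def using int by auto
    have "(\<integral>\<omega>. L n \<omega> \<partial>M) = (\<Sum>i<2 ^ n. w n * (\<integral>\<omega>. sinh_sq (\<Delta> n i \<omega> / w n) \<partial>M))"
      unfolding L_def using int by (subst Bochner_Integration.integral_sum) auto
    also have "\<dots> \<le> (\<Sum>i<(2::nat) ^ n. w n * (4 * x))"
      using le w_pos[of n] by (intro sum_mono mult_left_mono) auto
    also have "\<dots> = 32 * (q * T)\<^sup>2 * (2 ^ n * (3 / 4) ^ n * (4 / 9) ^ n)"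
      by (simp add: w_def x_def)
    also have "2 ^ n * (3 / 4) ^ n * (4 / 9) ^ n = ((2::real) / 3) ^ n"
      by (simp flip: power_mult_distrib)
    finally have "(\<integral>\<omega>. L n \<omega> \<partial>M) \<le> 32 * (q * T)\<^sup>2 * (2 / 3) ^ n" .
    then show ?thesis
      by (subst nn_integral_eq_integral[OF intL]) (auto simp: L_nonneg)
  qed
  define G where "G \<omega> = (\<Sum>n. ennreal (L n \<omega>))" for \<omega>
  have [measurable]: "G \<in> borel_measurable M" unfolding G_def by measurable
  have G_int: "(\<integral>\<^sup>+\<omega>. G \<omega> \<partial>M) \<le> ennreal (96 * (q * T)\<^sup>2)"
  proof -
    have "(\<integral>\<^sup>+\<omega>. G \<omega> \<partial>M) = (\<Sum>n. \<integral>\<^sup>+\<omega>. ennreal (L n \<omega>) \<partial>M)"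
      unfolding G_def by (rule nn_integral_suminf) measurable
    also have "\<dots> \<le> (\<Sum>n. ennreal (32 * (q * T)\<^sup>2 * (2 / 3) ^ n))"
      by (intro suminf_le L_int) auto
    also have "\<dots> = ennreal (96 * (q * T)\<^sup>2)"
    proof (rule suminf_ennreal_eq)
      have "(\<lambda>n. 32 * (q * T)\<^sup>2 * (2 / 3) ^ n) sums (32 * (q * T)\<^sup>2 * (1 / (1 - 2 / 3)))"
        by (intro sums_mult geometric_sums) auto
      then show "(\<lambda>n. 32 * (q * T)\<^sup>2 * (2 / 3) ^ n) sums (96 * (q * T)\<^sup>2)" by simp
    qed simp
    finally show ?thesis .
  qed
  \<comment> \<open>Markov's inequality at height \<open>\<delta>\<^sup>2\<close>, because
    \<open>sinh_sq\<close> dominates the square of the quantity that is to stay below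
    \<open>\<delta>\<close>.\<close>
  define A1 where "A1 = {\<omega>\<in>space M. 1 \<le> ennreal (1 / \<delta>\<^sup>2) * G \<omega>}"
  have A1 [measurable]: "A1 \<in> sets M" unfolding A1_def by measurable
  have "emeasure M A1 \<le> ennreal (1 / \<delta>\<^sup>2) * (\<integral>\<^sup>+\<omega>. G \<omega> * indicator (space M) \<omega> \<partial>M)"
    unfolding A1_def by (rule nn_integral_Markov_inequality) auto
  also have "(\<integral>\<^sup>+\<omega>. G \<omega> * indicator (space M) \<omega> \<partial>M) = (\<integral>\<^sup>+\<omega>. G \<omega> \<partial>M)"
    by (intro nn_integral_cong) auto
  also have "ennreal (1 / \<delta>\<^sup>2) * (\<integral>\<^sup>+\<omega>. G \<omega> \<partial>M) \<le> ennreal (1 / \<delta>\<^sup>2) * ennreal (96 * (q * T)\<^sup>2)"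
    by (intro mult_left_mono G_int) auto
  also have "\<dots> = ennreal (96 * (q * T)\<^sup>2 / \<delta>\<^sup>2)"
    by (subst ennreal_mult[symmetric]) auto
  finally have mA1: "measure M A1 \<le> 96 * (q * T)\<^sup>2 / \<delta>\<^sup>2"
    by (simp add: emeasure_eq_measure)
  have off: "(\<Sum>m<n. L m \<omega>) < \<delta>\<^sup>2" if "\<omega> \<in> space M - A1" for n \<omega>
  proof -
    have "ennreal (\<Sum>m<n. L m \<omega>) \<le> G \<omega>"
    proof -
      have "ennreal (\<Sum>m<n. L m \<omega>) = (\<Sum>m<n. ennreal (L m \<omega>))"
        by (rule sum_ennreal[symmetric]) (rule L_nonneg)
      also have "\<dots> \<le> (\<Sum>n. ennreal (L n \<omega>))"
        by (rule sum_le_suminf) auto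
      finally show ?thesis unfolding G_def .
    qed
    then have "ennreal (1 / \<delta>\<^sup>2) * ennreal (\<Sum>m<n. L m \<omega>) \<le> ennreal (1 / \<delta>\<^sup>2) * G \<omega>"
      by (rule mult_left_mono) auto
    also have "\<dots> < 1" using that by (auto simp: A1_def not_le)
    finally have "ennreal (1 / \<delta>\<^sup>2 * (\<Sum>m<n. L m \<omega>)) < 1"
      by (subst ennreal_mult) (auto simp: L_nonneg sum_nonneg)
    then have "1 / \<delta>\<^sup>2 * (\<Sum>m<n. L m \<omega>) < 1"
      by simp
    then show ?thesis using \<delta> by (simp add: field_simps)
  qed
  define k where "k s n = nat \<lfloor>2 ^ n * s / T\<rfloor>" for s n
  note kp = dyadic_index[OF T, folded k_def]
  have chain: "sinh_sq (Z (pt n (k s n)) \<omega> - Z 0 \<omega>) < \<delta>\<^sup>2"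
    if s: "s \<in> {0..T}" and \<omega>: "\<omega> \<in> space M - A1" for s \<omega> n
  proof -
    \<comment> \<open>The links of the chain that starts at 0. The grid of level 0 is
      \<open>{0, T}\<close>, so the link with index 0 is trivial unless
      \<open>s = T\<close>.\<close>
    define y where "y m = Z (pt m (k s m)) \<omega> - (case m of 0 \<Rightarrow> Z 0 \<omega> | Suc m \<Rightarrow> Z (pt m (k s m)) \<omega>)" for m
    have tele: "(\<Sum>m<Suc n. y m) = Z (pt n (k s n)) \<omega> - Z 0 \<omega>"
      by (induction n) (simp_all add: y_def)
    have step: "w m * sinh_sq (y m / w m) \<le> L m \<omega>" for m
    proof -
      have "y m = 0 \<or> (\<exists>i<2 ^ m. y m = \<Delta> m i \<omega>)"
      proof (cases m)
        case 0
        have "k s 0 \<le> 1" using kp(1)[OF s, of 0] by simp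
        then consider "k s 0 = 0" | "k s 0 = 1" by linarith
        then show ?thesis using 0 by cases (auto simp: y_def \<Delta>_def pt_def)
      next
        case (Suc l)
        have same: "pt l (k s l) = pt (Suc l) (2 * k s l)" by (simp add: pt_def)
        from kp(4)[OF s, of l] show ?thesis
        proof
          assume "k s (Suc l) = 2 * k s l"
          then show ?thesis using Suc same by (simp add: y_def)
        next
          assume *: "k s (Suc l) = 2 * k s l + 1"
          have "k s (Suc l) \<le> 2 ^ Suc l" by (rule kp(1)[OF s])
          with * have "2 * k s l < 2 ^ m" unfolding Suc by simp
          moreover have "y m = \<Delta> m (2 * k s l) \<omega>"
            using * Suc same by (simp add: y_def \<Delta>_def)
          ultimately show ?thesis by blast
        qed
      qed
      then show ?thesis
      proof
        assume "\<exists>i<2 ^ m. y m = \<Delta> m i \<omega>"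
        then obtain i where i: "i < 2 ^ m" "y m = \<Delta> m i \<omega>" by blast
        have "w m * sinh_sq (\<Delta> m i \<omega> / w m) \<le> L m \<omega>"
          unfolding L_def using i(1) w_pos[of m]
          by (intro member_le_sum[where f="\<lambda>i. w m * sinh_sq (\<Delta> m i \<omega> / w m)"]) auto
        with i show ?thesis by simp
      qed (simp add: L_nonneg)
    qed
    have "sinh_sq (\<Sum>m<Suc n. y m) \<le> (\<Sum>m<Suc n. w m * sinh_sq (y m / w m))"
      by (rule sinh_sq_sum_le[OF w_pos w_sum])
    also have "\<dots> \<le> (\<Sum>m<Suc n. L m \<omega>)" by (intro sum_mono step)
    also have "\<dots> < \<delta>\<^sup>2" by (rule off[OF \<omega>])
    finally show ?thesis unfolding tele .
  qed
  \<comment> \<open>The mean of \<open>sinh_sq\<close> of the approximation error tends to 0, which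
    gives an almost surely convergent subsequence. Both the subsequence and the null set depend on
    \<open>s\<close>, hence the restriction to a countable \<open>D\<close>.\<close>
  have conv: "\<exists>r. strict_mono r \<and> (AE \<omega> in M. (\<lambda>n. Z (pt (r n) (k s (r n))) \<omega>) \<longlonglongrightarrow> Z s \<omega>)"
    if s: "s \<in> {0..T}" for s
  proof -
    let ?u = "\<lambda>n \<omega>. sinh_sq (Z s \<omega> - Z (pt n (k s n)) \<omega>)"
    have in_T: "pt n (k s n) \<in> {0..T}" for n using kp(2)[OF s] by (simp add: pt_def)
    have dist: "\<bar>s - pt n (k s n)\<bar> \<le> T / 2 ^ n" for n
      using kp(3)[OF s] by (simp add: pt_def)
    have int: "integrable M (?u n)" for n
      using integral_sinh_sq_le(1)[OF P sg[OF in_T s], of 1] by simp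
    have "(\<lambda>n. \<integral>\<omega>. norm (?u n \<omega>) \<partial>M) \<longlonglongrightarrow> 0"
    proof (rule tendsto_sandwich)
      show "\<forall>\<^sub>F n in sequentially. 0 \<le> (\<integral>\<omega>. norm (?u n \<omega>) \<partial>M)" by simp
      show "\<forall>\<^sub>F n in sequentially. (\<integral>\<omega>. norm (?u n \<omega>) \<partial>M)
          \<le> 2 * (exp (2 * (q * (T * (1 / 2) ^ n))\<^sup>2) - 1)"
      proof (rule always_eventually, rule allI)
        fix n
        have "(\<integral>\<omega>. norm (?u n \<omega>) \<partial>M) \<le> 2 * (exp (2 * (q * \<bar>s - pt n (k s n)\<bar>)\<^sup>2) - 1)"
          using integral_sinh_sq_le(2)[OF P sg[OF in_T s], of 1 n] by simp
        also have "\<dots> \<le> 2 * (exp (2 * (q * (T * (1 / 2) ^ n))\<^sup>2) - 1)"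
        proof -
          have "q * \<bar>s - pt n (k s n)\<bar> \<le> q * (T * (1 / 2) ^ n)"
            using dist[of n] q by (intro mult_left_mono) (simp_all add: power_one_over)
          then have "(q * \<bar>s - pt n (k s n)\<bar>)\<^sup>2 \<le> (q * (T * (1 / 2) ^ n))\<^sup>2"
            using q by (intro power_mono) auto
          then show ?thesis by simp
        qed
        finally show "(\<integral>\<omega>. norm (?u n \<omega>) \<partial>M) \<le> 2 * (exp (2 * (q * (T * (1 / 2) ^ n))\<^sup>2) - 1)" .
      qed
      have "(\<lambda>n. 2 * (exp (2 * (q * (T * (1 / 2) ^ n))\<^sup>2) - 1))
          \<longlonglongrightarrow> 2 * (exp (2 * (q * (T * 0))\<^sup>2) - 1)"
        by (intro tendsto_intros LIMSEQ_realpow_zero) auto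
      then show "(\<lambda>n. 2 * (exp (2 * (q * (T * (1 / 2) ^ n))\<^sup>2) - 1)) \<longlonglongrightarrow> 0" by simp
    qed simp
    from tendsto_L1_AE_subseq[where u="?u", OF int this] obtain r where r: "strict_mono r"
      and ae: "AE \<omega> in M. (\<lambda>n. ?u (r n) \<omega>) \<longlonglongrightarrow> 0" by blast
    from ae have "AE \<omega> in M. (\<lambda>n. Z (pt (r n) (k s (r n))) \<omega>) \<longlonglongrightarrow> Z s \<omega>"
    proof eventually_elim
      case (elim \<omega>)
      have "(\<lambda>n. (Z s \<omega> - Z (pt (r n) (k s (r n))) \<omega>)\<^sup>2) \<longlonglongrightarrow> 0"
        by (rule tendsto_sandwich[OF _ _ tendsto_const elim]) (auto simp: sinh_sq_ge_square)
      from tendsto_real_sqrt[OF this]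
      have "(\<lambda>n. Z s \<omega> - Z (pt (r n) (k s (r n))) \<omega>) \<longlonglongrightarrow> 0"
        by (simp add: tendsto_rabs_zero_iff)
      from tendsto_diff[OF tendsto_const[of "Z s \<omega>"] this] show ?case by simp
    qed
    with r show ?thesis by blast
  qed
  have "AE \<omega> in M. \<forall>s\<in>D. \<omega> \<notin> A1 \<longrightarrow> exp \<bar>Z s \<omega> - Z 0 \<omega>\<bar> - 1 \<le> \<delta>"
  proof (subst AE_ball_countable[OF D(1)], rule ballI)
    fix s assume "s \<in> D"
    with D have s: "s \<in> {0..T}" by blast
    from conv[OF s] obtain r where
      ae: "AE \<omega> in M. (\<lambda>n. Z (pt (r n) (k s (r n))) \<omega>) \<longlonglongrightarrow> Z s \<omega>" by blast
    from ae AE_space show "AE \<omega> in M. \<omega> \<notin> A1 \<longrightarrow> exp \<bar>Z s \<omega> - Z 0 \<omega>\<bar> - 1 \<le> \<delta>"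
    proof (eventually_elim, intro impI)
      fix \<omega> assume lim: "(\<lambda>n. Z (pt (r n) (k s (r n))) \<omega>) \<longlonglongrightarrow> Z s \<omega>"
        and \<omega>: "\<omega> \<in> space M" "\<omega> \<notin> A1"
      have le: "exp \<bar>Z (pt n (k s n)) \<omega> - Z 0 \<omega>\<bar> - 1 \<le> \<delta>" for n
      proof -
        have "(exp \<bar>Z (pt n (k s n)) \<omega> - Z 0 \<omega>\<bar> - 1)\<^sup>2 \<le> \<delta>\<^sup>2"
          using sinh_sq_ge chain[OF s, of \<omega> n] \<omega> by (metis DiffI less_imp_le order_trans)
        then show ?thesis using \<delta> by (rule power2_le_imp_le[OF _ less_imp_le])
      qed
      have "(\<lambda>n. exp \<bar>Z (pt (r n) (k s (r n))) \<omega> - Z 0 \<omega>\<bar> - 1)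
          \<longlonglongrightarrow> exp \<bar>Z s \<omega> - Z 0 \<omega>\<bar> - 1"
        by (intro tendsto_intros lim)
      then show "exp \<bar>Z s \<omega> - Z 0 \<omega>\<bar> - 1 \<le> \<delta>"
        by (rule LIMSEQ_le_const2) (use le in blast)
    qed
  qed
  then obtain N where N: "N \<in> null_sets M"
    "{\<omega>\<in>space M. \<not> (\<forall>s\<in>D. \<omega> \<notin> A1 \<longrightarrow> exp \<bar>Z s \<omega> - Z 0 \<omega>\<bar> - 1 \<le> \<delta>)} \<subseteq> N"
    by (auto simp: eventually_ae_filter)
  show ?thesis
  proof (intro bexI[of _ "A1 \<union> N"] conjI ballI)
    show "measure M (A1 \<union> N) \<le> 96 * (q * T)\<^sup>2 / \<delta>\<^sup>2"
      using mA1 N(1) A1 by (simp add: measure_Un_null_set)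
    show "A1 \<union> N \<in> sets M" using N(1) by auto
    fix \<omega> s assume "\<omega> \<in> space M - (A1 \<union> N)" "s \<in> D"
    with N(2) show "exp \<bar>Z s \<omega> - Z 0 \<omega>\<bar> - 1 \<le> \<delta>" by blast
  qed
qed

section \<open>Tail sums over the index set of the expansion\<close>

text \<open>Telescoping with \<open>1 / i\<^sup>2 \<le> 1 / (i - 1) - 1 / i\<close>. The shift by
  one is the origin of the summand 1 in the thresholds for \<open>N0\<close> and
  \<open>Mj\<close>.\<close>

lemma sum_inverse_squares_nat_le:
  assumes "finite A" "A \<subseteq> {m..}" "m \<ge> 2"
  shows "(\<Sum>i\<in>A. 1 / (real i)\<^sup>2) \<le> 1 / (real m - 1)"
proof -
  have tele: "(\<Sum>i\<in>{m..<m + k}. 1 / (real i)\<^sup>2) \<le> 1 / (real m - 1) - 1 / (real (m + k) - 1)" for k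
  proof (induction k)
    case (Suc k)
    have pos: "real (m + k) - 1 > 0" "real (m + k) > 0" using \<open>m \<ge> 2\<close> by linarith+
    have "1 / (real (m + k))\<^sup>2 \<le> 1 / ((real (m + k) - 1) * real (m + k))"
      using pos unfolding power2_eq_square by (intro divide_left_mono mult_right_mono) auto
    also have "\<dots> = 1 / (real (m + k) - 1) - 1 / real (m + k)"
      using pos by (simp add: field_simps)
    finally show ?case using Suc by simp
  qed simp
  obtain k where k: "A \<subseteq> {m..<m + k}"
  proof
    show "A \<subseteq> {m..<m + (Suc (Max A))}"
    proof
      fix x assume x: "x \<in> A"
      have "x \<le> Max A" using assms(1) x by (rule Max_ge)
      moreover have "m \<le> x" using assms(2) x by auto
      ultimately show "x \<in> {m..<m + (Suc (Max A))}" by simp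
    qed
  qed
  have "(\<Sum>i\<in>A. 1 / (real i)\<^sup>2) \<le> (\<Sum>i\<in>{m..<m + k}. 1 / (real i)\<^sup>2)"
    by (intro sum_mono2 k) auto
  also have "\<dots> \<le> 1 / (real m - 1) - 1 / (real (m + k) - 1)" by (rule tele)
  also have "\<dots> \<le> 1 / (real m - 1)" using \<open>m \<ge> 2\<close> by simp
  finally show ?thesis .
qed

text \<open>Each absolute value occurs at most once among the nonnegative indices and at most once
  among the negative ones, which doubles the one-sided bound.\<close>

lemma sum_inverse_squares_int_le:
  assumes A: "finite A" "\<And>k::int. k \<in> A \<Longrightarrow> \<bar>k\<bar> \<ge> int m" and m: "m \<ge> 2"
  shows "(\<Sum>k\<in>A. 1 / (real_of_int k)\<^sup>2) \<le> 2 / (real m - 1)"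
proof -
  have half: "(\<Sum>k\<in>B. 1 / (real_of_int k)\<^sup>2) \<le> 1 / (real m - 1)"
    if B: "B \<subseteq> A" and inj: "inj_on (\<lambda>k. nat \<bar>k\<bar>) B" for B
  proof -
    have "(\<Sum>k\<in>B. 1 / (real_of_int k)\<^sup>2) = (\<Sum>i\<in>(\<lambda>k. nat \<bar>k\<bar>) ` B. 1 / (real i)\<^sup>2)"
      by (simp add: sum.reindex[OF inj])
    also have "\<dots> \<le> 1 / (real m - 1)"
      using A B m by (intro sum_inverse_squares_nat_le) (auto dest: finite_subset, fastforce)
    finally show ?thesis .
  qed
  have "(\<Sum>k\<in>A. 1 / (real_of_int k)\<^sup>2)
      = (\<Sum>k\<in>{k\<in>A. k \<ge> 0}. 1 / (real_of_int k)\<^sup>2) + (\<Sum>k\<in>{k\<in>A. k < 0}. 1 / (real_of_int k)\<^sup>2)"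
    using A(1) by (subst sum.union_disjoint[symmetric]) (auto intro!: sum.cong)
  also have "\<dots> \<le> 1 / (real m - 1) + 1 / (real m - 1)"
    by (intro add_mono half) (auto simp: inj_on_def)
  finally show ?thesis by simp
qed

text \<open>The indices -1 and 1 give at most 2, and those of absolute value at least 2 give at most
  2 more.\<close>

lemma sum_inverse_squares_nonzero_le:
  assumes "finite A"
  shows "(\<Sum>k\<in>A - {0}. 1 / (real_of_int k)\<^sup>2) \<le> 4"
proof -
  have "(\<Sum>k\<in>A - {0}. 1 / (real_of_int k)\<^sup>2)
      \<le> (\<Sum>k\<in>(A - {- 1, 0, 1}) \<union> {- 1, 1}. 1 / (real_of_int k)\<^sup>2)"
    using assms by (intro sum_mono2) auto
  also have "\<dots> = (\<Sum>k\<in>A - {- 1, 0, 1}. 1 / (real_of_int k)\<^sup>2) + 2"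
    using assms by (subst sum.union_disjoint) auto
  also have "(\<Sum>k\<in>A - {- 1, 0, 1}. 1 / (real_of_int k)\<^sup>2) \<le> 2 / (real 2 - 1)"
    using assms by (intro sum_inverse_squares_int_le) auto
  finally show ?thesis by simp
qed

lemma weighted_squares_le:
  fixes d :: "int \<Rightarrow> real"
  assumes d: "\<And>k. \<bar>real_of_int k\<bar> * \<bar>d k\<bar> \<le> a" and 0: "0 \<notin> A"
    and S: "(\<Sum>k\<in>A. 1 / (real_of_int k)\<^sup>2) \<le> S"
  shows "(\<Sum>k\<in>A. (d k)\<^sup>2) \<le> a\<^sup>2 * S"
proof -
  have "(\<Sum>k\<in>A. (d k)\<^sup>2) \<le> (\<Sum>k\<in>A. a\<^sup>2 * (1 / (real_of_int k)\<^sup>2))"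
  proof (rule sum_mono)
    fix k assume "k \<in> A"
    with 0 have k: "(real_of_int k)\<^sup>2 > 0" by auto
    have "(\<bar>real_of_int k\<bar> * \<bar>d k\<bar>)\<^sup>2 \<le> a\<^sup>2" by (intro power_mono d) auto
    then show "(d k)\<^sup>2 \<le> a\<^sup>2 * (1 / (real_of_int k)\<^sup>2)"
      using k by (simp add: power_mult_distrib field_simps)
  qed
  also have "\<dots> \<le> a\<^sup>2 * S"
    using S by (simp only: sum_distrib_left[symmetric]) (intro mult_left_mono, auto)
  finally show ?thesis .
qed

lemma sum_geometric_tail_le:
  fixes r :: real
  assumes "0 \<le> r" "r < 1" "finite A" "A \<subseteq> {N..}"
  shows "(\<Sum>j\<in>A. r ^ j) \<le> r ^ N / (1 - r)"
proof -
  have s: "summable (\<lambda>j. r ^ (j + N))"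
    using assms by (auto simp: power_add intro!: summable_mult2 summable_geometric)
  have inj: "inj_on (\<lambda>j. j - N) A" using assms(4) by (intro inj_on_diff_nat) auto
  have "(\<Sum>j\<in>A. r ^ j) = (\<Sum>i\<in>(\<lambda>j. j - N) ` A. r ^ (i + N))"
    unfolding sum.reindex[OF inj] using assms(4) by (intro sum.cong) auto
  also have "\<dots> \<le> (\<Sum>i. r ^ (i + N))"
    using assms by (intro sum_le_suminf s) auto
  also have "\<dots> = r ^ N / (1 - r)"
    unfolding power_add using assms
    by (subst suminf_mult2[symmetric]) (auto simp: suminf_geometric intro!: summable_geometric)
  finally show ?thesis .
qed

text \<open>A single index type for both series, \<open>Inl\<close> for scaling terms and
  \<open>Inr\<close> for wavelet terms, makes the remainder of a truncation a set difference and
  independence a statement about one family.\<close>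

definition model_index :: "nat \<Rightarrow> nat \<Rightarrow> (nat \<Rightarrow> nat) \<Rightarrow> (int + nat \<times> int) set" where
  "model_index N0 N Mj = Inl ` {- (int N0 - 1)..int N0 - 1}
     \<union> Inr ` (SIGMA j:{..<N}. {- (int (Mj j) - 1)..int (Mj j) - 1})"

lemma finite_model_index [simp]: "finite (model_index N0 N Mj)"
  by (simp add: model_index_def)

lemma sum_model_index:
  "(\<Sum>i\<in>model_index N0 N Mj. f i)
    = (\<Sum>k\<in>{- (int N0 - 1)..int N0 - 1}. f (Inl k))
      + (\<Sum>j<N. \<Sum>l\<in>{- (int (Mj j) - 1)..int (Mj j) - 1}. f (Inr (j, l)))"
  unfolding model_index_def
  by (subst sum.union_disjoint) (auto simp: sum.reindex sum.Sigma)

lemma two_powr_half_squared: "(2 powr (- real j / 2))\<^sup>2 = ((1::real) / 2) ^ j"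
proof -
  have "(2 powr (- real j / 2))\<^sup>2 = (2::real) powr (- real j / 2 + - real j / 2)"
    unfolding power2_eq_square by (rule powr_add[symmetric])
  also have "- real j / 2 + - real j / 2 = - real j" by simp
  also have "2 powr (- real j) = ((1::real) / 2) ^ j"
    by (subst powr_minus) (simp add: powr_realpow power_one_over inverse_eq_divide)
  finally show ?thesis .
qed

text \<open>The budget \<open>q\<^sup>2\<close> is spent in quarters: scaling terms with large
  translate, levels below \<open>N\<close> with large translate, and for the levels from
  \<open>N\<close> on the translate 0 and the nonzero translates. The four numerical hypotheses are
  what these quarters require after summation.\<close>

lemma tail_squares_le:
  fixes da :: "int \<Rightarrow> real" and db :: "nat \<Rightarrow> int \<Rightarrow> real" and \<alpha> \<beta>0 \<beta>1 q :: real
  assumes da: "\<And>k. \<bar>real_of_int k\<bar> * \<bar>da k\<bar> \<le> \<alpha>"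
    and db1: "\<And>j l. \<bar>real_of_int l\<bar> * \<bar>db j l\<bar> \<le> 2 powr (- real j / 2) * \<beta>1"
    and db0: "\<And>j l. \<bar>db j l\<bar> \<le> 2 powr (- real j / 2) * \<beta>0 / 2 ^ j"
    and N0: "N0 \<ge> 2" "8 * \<alpha>\<^sup>2 \<le> q\<^sup>2 * (real N0 - 1)"
    and Mj: "\<And>j. j < N \<Longrightarrow> Mj j \<ge> 2 \<and> 16 * \<beta>1\<^sup>2 \<le> q\<^sup>2 * (real (Mj j) - 1)"
    and N: "32 * \<beta>0\<^sup>2 \<le> 7 * q\<^sup>2 * 8 ^ N" "32 * \<beta>1\<^sup>2 \<le> q\<^sup>2 * 2 ^ N"
    and F: "finite F" "F \<inter> model_index N0 N Mj = {}"
  shows "(\<Sum>i\<in>F. (case i of Inl k \<Rightarrow> da k | Inr (j, l) \<Rightarrow> db j l)\<^sup>2) \<le> q\<^sup>2"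
proof -
  define Fa where "Fa = Inl -` F"
  define J where "J = fst ` (Inr -` F)"
  define Fb where "Fb j = {l. Inr (j, l) \<in> F}" for j
  have fin_b: "finite (Inr -` F :: (nat \<times> int) set)"
    using F(1) by (intro finite_vimageI) auto
  have fin: "finite Fa" "finite J" "finite (Fb j)" for j
  proof -
    show "finite Fa" "finite J" using F(1) fin_b by (auto simp: Fa_def J_def intro: finite_vimageI)
    have "Fb j = (\<lambda>l. (j, l)) -` (Inr -` F)" by (auto simp: Fb_def)
    then show "finite (Fb j)" using fin_b by (auto intro!: finite_vimageI simp: inj_on_def)
  qed
  have F_eq: "F = Inl ` Fa \<union> Inr ` (SIGMA j:J. Fb j)"
  proof (intro equalityI subsetI)
    fix i assume "i \<in> F"
    then show "i \<in> Inl ` Fa \<union> Inr ` (SIGMA j:J. Fb j)"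
      by (cases i) (force simp: Fa_def Fb_def J_def)+
  qed (auto simp: Fa_def Fb_def)
  have split: "(\<Sum>i\<in>F. (case i of Inl k \<Rightarrow> da k | Inr (j, l) \<Rightarrow> db j l)\<^sup>2)
      = (\<Sum>k\<in>Fa. (da k)\<^sup>2) + (\<Sum>j\<in>J. \<Sum>l\<in>Fb j. (db j l)\<^sup>2)"
    unfolding F_eq using fin
    by (subst sum.union_disjoint) (auto simp: sum.reindex sum.Sigma split_def)
  have Fa_large: "\<bar>k\<bar> \<ge> int N0" if "k \<in> Fa" for k
  proof -
    have "Inl k \<notin> model_index N0 N Mj" using that F(2) by (auto simp: Fa_def)
    then have "k \<notin> {- (int N0 - 1)..int N0 - 1}" by (auto simp: model_index_def)
    then show ?thesis by auto
  qed
  have Fb_large: "\<bar>l\<bar> \<ge> int (Mj j)" if "l \<in> Fb j" "j < N" for j l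
  proof -
    have "Inr (j, l) \<notin> model_index N0 N Mj" using that F(2) by (auto simp: Fb_def)
    then have "l \<notin> {- (int (Mj j) - 1)..int (Mj j) - 1}" using that by (auto simp: model_index_def)
    then show ?thesis by auto
  qed
  have "(\<Sum>k\<in>Fa. (da k)\<^sup>2) \<le> \<alpha>\<^sup>2 * (2 / (real N0 - 1))"
    using Fa_large N0(1) fin
    by (intro weighted_squares_le[OF da] sum_inverse_squares_int_le) fastforce+
  also have "\<dots> \<le> q\<^sup>2 / 4" using N0 by (simp add: field_simps)
  finally have part_a: "(\<Sum>k\<in>Fa. (da k)\<^sup>2) \<le> q\<^sup>2 / 4" .
  have low: "(\<Sum>l\<in>Fb j. (db j l)\<^sup>2) \<le> q\<^sup>2 / 8 * (1 / 2) ^ j" if j: "j < N" for j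
  proof -
    have "(\<Sum>l\<in>Fb j. (db j l)\<^sup>2) \<le> (2 powr (- real j / 2) * \<beta>1)\<^sup>2 * (2 / (real (Mj j) - 1))"
      using Fb_large[OF _ j] Mj[OF j] fin
      by (intro weighted_squares_le[OF db1] sum_inverse_squares_int_le) fastforce+
    also have "\<dots> = (\<beta>1\<^sup>2 * (2 / (real (Mj j) - 1))) * (1 / 2) ^ j"
      unfolding power_mult_distrib two_powr_half_squared by (simp add: mult_ac)
    also have "\<dots> \<le> q\<^sup>2 / 8 * (1 / 2) ^ j"
      using Mj[OF j] by (intro mult_right_mono) (auto simp: field_simps)
    finally show ?thesis .
  qed
  \<comment> \<open>At \<open>l = 0\<close> the bound with factor \<open>l\<close> is void, so
    \<open>db0\<close> is used there; squaring it gives the ratio 1/8, against 1/2 for the other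
    translates.\<close>
  have high: "(\<Sum>l\<in>Fb j. (db j l)\<^sup>2) \<le> \<beta>0\<^sup>2 * (1 / 8) ^ j + 4 * \<beta>1\<^sup>2 * (1 / 2) ^ j" for j
  proof -
    have "(\<Sum>l\<in>Fb j. (db j l)\<^sup>2) \<le> (\<Sum>l\<in>insert 0 (Fb j - {0}). (db j l)\<^sup>2)"
      using fin by (intro sum_mono2) auto
    also have "\<dots> = (db j 0)\<^sup>2 + (\<Sum>l\<in>Fb j - {0}. (db j l)\<^sup>2)"
      using fin by (subst sum.insert) auto
    also have "\<dots> \<le> \<beta>0\<^sup>2 * (1 / 8) ^ j + (2 powr (- real j / 2) * \<beta>1)\<^sup>2 * 4"
    proof (intro add_mono weighted_squares_le[OF db1] sum_inverse_squares_nonzero_le fin)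
      have "\<bar>db j 0\<bar>\<^sup>2 \<le> (2 powr (- real j / 2) * \<beta>0 / 2 ^ j)\<^sup>2"
        by (intro power_mono db0) auto
      also have "\<dots> = \<beta>0\<^sup>2 * ((1 / 2) ^ j * ((1 / 2) ^ j)\<^sup>2)"
        unfolding power_divide power_mult_distrib two_powr_half_squared by (simp add: mult_ac)
      also have "((1::real) / 2) ^ j * ((1 / 2) ^ j)\<^sup>2 = (1 / 8) ^ j"
        by (simp add: power2_eq_square flip: power_mult_distrib)
      finally show "(db j 0)\<^sup>2 \<le> \<beta>0\<^sup>2 * (1 / 8) ^ j" by simp
    qed auto
    finally show ?thesis unfolding power_mult_distrib two_powr_half_squared by (simp add: mult_ac)
  qed
  have "(\<Sum>j\<in>J. \<Sum>l\<in>Fb j. (db j l)\<^sup>2)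
      = (\<Sum>j\<in>J \<inter> {..<N}. \<Sum>l\<in>Fb j. (db j l)\<^sup>2) + (\<Sum>j\<in>J - {..<N}. \<Sum>l\<in>Fb j. (db j l)\<^sup>2)"
    by (rule sum.Int_Diff[OF fin(2)])
  also have "\<dots> \<le> (\<Sum>j\<in>J \<inter> {..<N}. q\<^sup>2 / 8 * (1 / 2) ^ j)
      + (\<Sum>j\<in>J - {..<N}. \<beta>0\<^sup>2 * (1 / 8) ^ j + 4 * \<beta>1\<^sup>2 * (1 / 2) ^ j)"
    by (intro add_mono sum_mono low high) auto
  also have "\<dots> = q\<^sup>2 / 8 * (\<Sum>j\<in>J \<inter> {..<N}. (1 / 2) ^ j)
      + (\<beta>0\<^sup>2 * (\<Sum>j\<in>J - {..<N}. (1 / 8) ^ j) + 4 * \<beta>1\<^sup>2 * (\<Sum>j\<in>J - {..<N}. (1 / 2) ^ j))"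
    by (simp only: sum.distrib sum_distrib_left)
  also have "\<dots> \<le> q\<^sup>2 / 8 * ((1 / 2) ^ 0 / (1 - 1 / 2))
      + (\<beta>0\<^sup>2 * ((1 / 8) ^ N / (1 - 1 / 8)) + 4 * \<beta>1\<^sup>2 * ((1 / 2) ^ N / (1 - 1 / 2)))"
    using fin by (intro add_mono mult_left_mono sum_geometric_tail_le) auto
  also have "\<dots> \<le> q\<^sup>2 / 4 + (q\<^sup>2 / 4 + q\<^sup>2 / 4)"
  proof (intro add_mono)
    show "\<beta>0\<^sup>2 * ((1 / 8) ^ N / (1 - 1 / 8)) \<le> q\<^sup>2 / 4"
      using N(1) by (simp add: power_divide field_simps)
    show "4 * \<beta>1\<^sup>2 * ((1 / 2) ^ N / (1 - 1 / 2)) \<le> q\<^sup>2 / 4"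
      using N(2) by (simp add: power_divide field_simps)
  qed simp
  finally show ?thesis using part_a unfolding split by simp
qed

section \<open>Wavelet coefficients\<close>

lemma cmod_exp_i_diff_le:
  "cmod (exp (\<i> * complex_of_real a) - exp (\<i> * complex_of_real b)) \<le> \<bar>a - b\<bar>"
proof -
  have "exp (\<i> * complex_of_real a) - exp (\<i> * complex_of_real b)
      = exp (\<i> * complex_of_real b) * (exp (\<i> * complex_of_real (a - b)) - 1)"
    by (simp add: right_diff_distrib flip: exp_add)
  then have "cmod (exp (\<i> * complex_of_real a) - exp (\<i> * complex_of_real b))
      = cmod (exp (\<i> * complex_of_real (a - b)) - 1)"
    by (simp add: norm_mult)
  also have "\<dots> \<le> \<bar>a - b\<bar>"
    using iexp_approx1[of "a - b" 0] by simp
  finally show ?thesis .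
qed

lemma borel_measurable_cnj [measurable]: "cnj \<in> borel_measurable borel"
  by (intro borel_measurable_continuous_onI continuous_intros)

lemma integrable_dominated:
  fixes f :: "real \<Rightarrow> complex" and g :: "real \<Rightarrow> real"
  assumes "integrable lborel g" "f \<in> borel_measurable borel" "\<And>y. cmod (f y) \<le> g y"
  shows "integrable lborel f"
  using assms by (intro Bochner_Integration.integrable_bound[OF assms(1)])
    (auto intro: order_trans[OF _ abs_ge_self])

text \<open>No integrability of \<open>f\<close> is required: without it the Bochner integral is 0
  and the bound holds because \<open>g\<close> is nonnegative.\<close>

lemma integral_cmod_le:
  fixes f :: "real \<Rightarrow> complex" and g :: "real \<Rightarrow> real"
  assumes "integrable lborel g" "\<And>y. cmod (f y) \<le> g y"
  shows "cmod (LINT y|lborel. f y) \<le> (LINT y|lborel. g y)"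
proof (cases "integrable lborel f")
  case True
  then show ?thesis
    using assms by (intro order_trans[OF integral_norm_bound] integral_mono) auto
next
  case False
  have "0 \<le> (LINT y|lborel. g y)"
    using assms(2) norm_ge_zero order_trans by (intro integral_nonneg_AE AE_I2) blast
  with False show ?thesis by (simp add: not_integrable_integral_eq)
qed

text \<open>The deterministic side of the problem, with no process in it. The assumption
  \<open>real_F\<close> is the reality requirement in condition RC, and \<open>Mb\<close> serves as
  a Lipschitz constant of \<open>\<Psi>\<close>.\<close>

locale wavelet_kernel =
  fixes u uy :: "real \<Rightarrow> real \<Rightarrow> complex" and \<Phi> \<Psi> \<Phi>' \<Psi>' :: "real \<Rightarrow> complex"
    and u1 v w :: "real \<Rightarrow> real" and Mb T :: real
  assumes du: "\<And>t y. (u t has_vector_derivative uy t y) (at y)"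
    and d\<Phi>: "\<And>y. (\<Phi> has_vector_derivative \<Phi>' y) (at y)"
    and d\<Psi>: "\<And>y. (\<Psi> has_vector_derivative \<Psi>' y) (at y)"
    and Mb: "\<And>y. cmod (\<Psi>' y) \<le> Mb"
    and real_F: "\<And>t x. Im (LINT y|lborel. u t y * exp (\<i> * complex_of_real (x * y))) = 0"
    and u1: "\<And>t y. cmod (u t y) \<le> \<bar>t\<bar> * u1 y"
    and u1_y: "integrable lborel (\<lambda>y. u1 y * \<bar>y\<bar>)"
    and u1_int: "integrable lborel u1"
    and u1_\<Phi>: "integrable lborel (\<lambda>y. u1 y * cmod (\<Phi> y))"
    and v_nonneg: "\<And>y. v y \<ge> 0" and w_nonneg: "\<And>y. w y \<ge> 0"
    and v: "\<And>t1 t2 y. t1 \<in> {0..T} \<Longrightarrow> t2 \<in> {0..T} \<Longrightarrow>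
                cmod (uy t1 y - uy t2 y) \<le> \<bar>t2 - t1\<bar> * v y"
    and w: "\<And>t1 t2 y. t1 \<in> {0..T} \<Longrightarrow> t2 \<in> {0..T} \<Longrightarrow>
                cmod (u t1 y - u t2 y) \<le> \<bar>t2 - t1\<bar> * w y"
    and y_v: "integrable lborel (\<lambda>y. \<bar>y\<bar> * v y)"
    and v_\<Phi>: "integrable lborel (\<lambda>y. v y * cmod (\<Phi> y))"
    and w_\<Phi>': "integrable lborel (\<lambda>y. w y * cmod (\<Phi>' y))"
    and w_int: "integrable lborel w"
    and w_y: "integrable lborel (\<lambda>y. w y * \<bar>y\<bar>)"
    and w_\<Phi>: "integrable lborel (\<lambda>y. w y * cmod (\<Phi> y))"
begin

section \<open>Regularity and integrability of the kernel products\<close>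

lemma Mb_nonneg: "Mb \<ge> 0"
  using Mb[of 0] norm_ge_zero order_trans by blast

lemma u_meas [measurable]: "u t \<in> borel_measurable borel"
  by (intro borel_measurable_continuous_onI continuous_at_imp_continuous_on)
    (auto intro: has_vector_derivative_continuous du)

lemma \<Phi>_meas [measurable]: "\<Phi> \<in> borel_measurable borel"
  by (intro borel_measurable_continuous_onI continuous_at_imp_continuous_on)
    (auto intro: has_vector_derivative_continuous d\<Phi>)

lemma \<Psi>_meas [measurable]: "\<Psi> \<in> borel_measurable borel"
  by (intro borel_measurable_continuous_onI continuous_at_imp_continuous_on)
    (auto intro: has_vector_derivative_continuous d\<Psi>)

lemma deriv_meas [measurable]: "uy t \<in> borel_measurable borel"
  "\<Phi>' \<in> borel_measurable borel" "\<Psi>' \<in> borel_measurable borel"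
  by (rule borel_measurable_vector_derivative du d\<Phi> d\<Psi>)+

text \<open>The mean value inequality. Evaluated at \<open>y / 2 ^ j\<close> it supplies the decay
  in the level, at the price of a factor \<open>\<bar>y\<bar>\<close> under the integral.\<close>

lemma \<Psi>_lipschitz: "cmod (\<Psi> y - \<Psi> 0) \<le> Mb * \<bar>y\<bar>"
proof -
  have "norm (\<Psi> y - \<Psi> 0) \<le> Mb * norm (y - 0)"
  proof (rule differentiable_bound[of UNIV \<Psi> "\<lambda>z h. h *\<^sub>R \<Psi>' z"])
    show "onorm (\<lambda>h. h *\<^sub>R \<Psi>' z) \<le> Mb" for z
      using mult_left_mono[OF Mb[of z] abs_ge_zero] by (intro onorm_bound Mb_nonneg) (simp add: mult.commute)
  qed (use d\<Psi> in \<open>auto simp: has_vector_derivative_def\<close>)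
  then show ?thesis by simp
qed

lemma u_\<Phi>_int: "integrable lborel (\<lambda>y. u t y * cnj (\<Phi> y) * exp (\<i> * complex_of_real (y * k)))"
proof (rule integrable_dominated)
  show "integrable lborel (\<lambda>y. \<bar>t\<bar> * (u1 y * cmod (\<Phi> y)))"
    by (intro integrable_mult_right u1_\<Phi>)
  show "cmod (u t y * cnj (\<Phi> y) * exp (\<i> * complex_of_real (y * k))) \<le> \<bar>t\<bar> * (u1 y * cmod (\<Phi> y))" for y
    using mult_right_mono[OF u1[of t y], of "cmod (\<Phi> y)"] by (simp add: norm_mult mult_ac)
qed measurable

lemma u_exp_int: "integrable lborel (\<lambda>y. u t y * exp (\<i> * complex_of_real (y * k)))"
proof (rule integrable_dominated)
  show "integrable lborel (\<lambda>y. \<bar>t\<bar> * u1 y)"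
    by (intro integrable_mult_right u1_int)
qed (use u1 in \<open>auto simp: norm_mult\<close>)

lemma u_\<Psi>_bound: "cmod (u t y * cnj (\<Psi> (y / 2 ^ j) - \<Psi> 0)) \<le> \<bar>t\<bar> * Mb / 2 ^ j * (u1 y * \<bar>y\<bar>)"
proof -
  have "cmod (u t y * cnj (\<Psi> (y / 2 ^ j) - \<Psi> 0)) \<le> (\<bar>t\<bar> * u1 y) * (Mb * \<bar>y / 2 ^ j\<bar>)"
    unfolding norm_mult complex_mod_cnj
    by (intro mult_mono u1 \<Psi>_lipschitz order_trans[OF norm_ge_zero u1]) auto
  then show ?thesis by (simp add: mult_ac)
qed

lemma u_\<Psi>_int:
  "integrable lborel (\<lambda>y. u t y * cnj (\<Psi> (y / 2 ^ j) - \<Psi> 0) * exp (\<i> * complex_of_real (y * k)))"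
proof (rule integrable_dominated)
  show "integrable lborel (\<lambda>y. \<bar>t\<bar> * Mb / 2 ^ j * (u1 y * \<bar>y\<bar>))"
    by (intro integrable_mult_right u1_y)
qed (use u_\<Psi>_bound in \<open>auto simp: norm_mult\<close>)

text \<open>Up to normalisation the inverse Fourier transform of \<open>u t\<close>; it is the
  factor that multiplies the conjugate of \<open>\<Psi> 0\<close> in the wavelet
  coefficients.\<close>

definition F :: "real \<Rightarrow> real \<Rightarrow> complex" where
  "F t x = (LINT y|lborel. u t y * exp (\<i> * complex_of_real (y * x)))"

lemma Im_F: "Im (F t x) = 0"
  using real_F[of t x] by (simp add: F_def mult.commute)

text \<open>The part of \<open>coef_b\<close> left after splitting \<open>\<Psi> = \<Psi> 0 + (\<Psi> - \<Psi> 0)\<close>; it decays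
  in \<open>j\<close> although \<open>\<Psi> 0 = 0\<close> is not known.\<close>
definition R :: "nat \<Rightarrow> real \<Rightarrow> real \<Rightarrow> complex" where
  "R j t x = (LINT y|lborel. u t y * cnj (\<Psi> (y / 2 ^ j) - \<Psi> 0) * exp (\<i> * complex_of_real (y * x)))"

text \<open>Since \<open>F\<close> is real, the imaginary part of \<open>\<Psi> 0\<close> does not
  reach the real part of the coefficient. The term that does not decay with the level is thus the
  product \<open>Re (\<Psi> 0) * Re (F t x)\<close> alone.\<close>

lemma Re_coef_b:
  "Re (coef_b u \<Psi> j l t) = 2 powr (- real j / 2) / sqrt (2 * pi) *
     (Re (R j t (l / 2 ^ j)) + Re (\<Psi> 0) * Re (F t (l / 2 ^ j)))"
proof -
  let ?e = "\<lambda>y. exp (\<i> * complex_of_real (y * (l / 2 ^ j)))"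
  let ?p = "complex_of_real (2 powr (- real j / 2))"
  have "(\<lambda>y. u t y * ?p * exp (\<i> * complex_of_real (y * real_of_int l / 2 ^ j)) * cnj (\<Psi> (y / 2 ^ j)))
      = (\<lambda>y. ?p * (u t y * cnj (\<Psi> (y / 2 ^ j) - \<Psi> 0) * ?e y + cnj (\<Psi> 0) * (u t y * ?e y)))"
    by (auto simp: algebra_simps)
  then have "coef_b u \<Psi> j l t = complex_of_real (1 / sqrt (2 * pi)) *
      (?p * (R j t (l / 2 ^ j) + cnj (\<Psi> 0) * F t (l / 2 ^ j)))"
    unfolding coef_b_def R_def F_def
    by (simp only: integral_mult_right_zero integral_mult_right Bochner_Integration.integral_add
        u_\<Psi>_int u_exp_int integrable_mult_right simp_thms)
  then show ?thesis
    by (simp add: Im_F)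
qed

lemma Re_coef_a_diff:
  "Re (coef_a u \<Phi> k t) - Re (coef_a u \<Phi> k s) = 1 / sqrt (2 * pi) *
     Re (LINT y|lborel. (u t y - u s y) * cnj (\<Phi> y) * exp (\<i> * complex_of_real (y * k)))"
proof -
  have "(LINT y|lborel. (u t y - u s y) * cnj (\<Phi> y) * exp (\<i> * complex_of_real (y * k)))
     = (LINT y|lborel. u t y * cnj (\<Phi> y) * exp (\<i> * complex_of_real (y * k)))
     - (LINT y|lborel. u s y * cnj (\<Phi> y) * exp (\<i> * complex_of_real (y * k)))"
    using Bochner_Integration.integral_diff[OF u_\<Phi>_int[of t k] u_\<Phi>_int[of s k]]
    by (simp only: left_diff_distrib)
  then show ?thesis
    unfolding coef_a_def by (simp add: diff_divide_distrib)
qed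

lemma R_diff:
  "R j t x - R j s x =
     (LINT y|lborel. (u t y - u s y) * cnj (\<Psi> (y / 2 ^ j) - \<Psi> 0) * exp (\<i> * complex_of_real (y * x)))"
  unfolding R_def
  using Bochner_Integration.integral_diff[OF u_\<Psi>_int[of t j x] u_\<Psi>_int[of s j x]]
  by (simp only: left_diff_distrib)

definition "A1 = 1 / sqrt (2 * pi) *
  ((LINT y|lborel. v y * cmod (\<Phi> y)) + (LINT y|lborel. w y * cmod (\<Phi>' y)))"

definition "B0 = Mb / sqrt (2 * pi) * (LINT y|lborel. w y * \<bar>y\<bar>)"

definition "B1 = Mb / sqrt (2 * pi) * (LINT y|lborel. w y + \<bar>y\<bar> * v y)"

text \<open>Integration by parts applied to the difference of the kernels at two times; both
  summands of its derivative carry the factor \<open>\<bar>t - s\<bar>\<close>, through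
  \<open>w\<close> and \<open>v\<close>.\<close>

lemma coef_a_decay:
  assumes t: "t \<in> {0..T}" and s: "s \<in> {0..T}"
  shows "\<bar>real_of_int k\<bar> * \<bar>Re (coef_a u \<Phi> k t) - Re (coef_a u \<Phi> k s)\<bar> \<le> A1 * \<bar>t - s\<bar>"
proof -
  let ?h = "\<lambda>y. (u t y - u s y) * cnj (\<Phi> y)"
  let ?h' = "\<lambda>y. (u t y - u s y) * cnj (\<Phi>' y) + (uy t y - uy s y) * cnj (\<Phi> y)"
  let ?g = "\<lambda>y. \<bar>t - s\<bar> * (v y * cmod (\<Phi> y) + w y * cmod (\<Phi>' y))"
  have h: "cmod (?h y) \<le> \<bar>t - s\<bar> * (w y * cmod (\<Phi> y))" for y
    using mult_right_mono[OF w[OF t s, of y], of "cmod (\<Phi> y)"]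
    by (simp add: norm_mult mult_ac abs_minus_commute)
  have h': "cmod (?h' y) \<le> ?g y" for y
  proof -
    have "cmod (?h' y) \<le> cmod ((u t y - u s y) * cnj (\<Phi>' y)) + cmod ((uy t y - uy s y) * cnj (\<Phi> y))"
      by (rule norm_triangle_ineq)
    also have "\<dots> \<le> (\<bar>s - t\<bar> * w y) * cmod (\<Phi>' y) + (\<bar>s - t\<bar> * v y) * cmod (\<Phi> y)"
      unfolding norm_mult complex_mod_cnj by (intro add_mono mult_right_mono w v t s) auto
    finally show ?thesis by (simp add: algebra_simps abs_minus_commute)
  qed
  have g: "integrable lborel ?g"
    using v_\<Phi> w_\<Phi>' by auto
  have int_h: "integrable lborel ?h"
    by (rule integrable_dominated[OF _ _ h]) (use w_\<Phi> in auto)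
  have int_h': "integrable lborel ?h'"
    by (rule integrable_dominated[OF g _ h']) auto
  have "\<bar>real_of_int k\<bar> * cmod (LINT y|lborel. ?h y * exp (\<i> * complex_of_real (y * k)))
      \<le> (LINT y|lborel. cmod (?h' y))"
  proof (rule fourier_coefficient_decay[OF _ int_h int_h'])
    show "(?h has_vector_derivative ?h' y) (at y)" for y
      by (intro has_vector_derivative_mult has_vector_derivative_diff du
          has_vector_derivative_cnj d\<Phi>)
  qed
  also have "\<dots> \<le> (LINT y|lborel. ?g y)"
    using int_h' g h' by (intro integral_mono) auto
  also have "\<dots> = \<bar>t - s\<bar> * ((LINT y|lborel. v y * cmod (\<Phi> y)) + (LINT y|lborel. w y * cmod (\<Phi>' y)))"
    using v_\<Phi> w_\<Phi>' by simp
  finally have *: "\<bar>real_of_int k\<bar> * cmod (LINT y|lborel. ?h y * exp (\<i> * complex_of_real (y * k)))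
      \<le> \<bar>t - s\<bar> * ((LINT y|lborel. v y * cmod (\<Phi> y)) + (LINT y|lborel. w y * cmod (\<Phi>' y)))" .
  have "\<bar>real_of_int k\<bar> * \<bar>Re (coef_a u \<Phi> k t) - Re (coef_a u \<Phi> k s)\<bar>
      \<le> 1 / sqrt (2 * pi) * (\<bar>real_of_int k\<bar> * cmod (LINT y|lborel. ?h y * exp (\<i> * complex_of_real (y * k))))"
    unfolding Re_coef_a_diff abs_mult
    using abs_Re_le_cmod by (simp add: divide_right_mono mult_left_mono)
  also have "\<dots> \<le> A1 * \<bar>t - s\<bar>"
    unfolding A1_def using mult_left_mono[OF *, of "1 / sqrt (2 * pi)"] by (simp add: mult_ac)
  finally show ?thesis .
qed

text \<open>The decay estimate says nothing at \<open>k = 0\<close>. This bound covers every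
  \<open>k\<close> and is what makes the model continuous in time.\<close>

lemma coef_a_lipschitz:
  assumes t: "t \<in> {0..T}" and s: "s \<in> {0..T}"
  shows "\<bar>Re (coef_a u \<Phi> k t) - Re (coef_a u \<Phi> k s)\<bar>
    \<le> (1 / sqrt (2 * pi) * (LINT y|lborel. w y * cmod (\<Phi> y))) * \<bar>t - s\<bar>"
proof -
  let ?h = "\<lambda>y. (u t y - u s y) * cnj (\<Phi> y) * exp (\<i> * complex_of_real (y * k))"
  have h: "cmod (?h y) \<le> \<bar>t - s\<bar> * (w y * cmod (\<Phi> y))" for y
    using mult_right_mono[OF w[OF t s, of y], of "cmod (\<Phi> y)"]
    by (simp add: norm_mult mult_ac abs_minus_commute)
  have "cmod (LINT y|lborel. ?h y) \<le> (LINT y|lborel. \<bar>t - s\<bar> * (w y * cmod (\<Phi> y)))"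
    by (rule integral_cmod_le[OF _ h]) (use w_\<Phi> in auto)
  then have *: "\<bar>Re (LINT y|lborel. ?h y)\<bar> \<le> \<bar>t - s\<bar> * (LINT y|lborel. w y * cmod (\<Phi> y))"
    using abs_Re_le_cmod[of "LINT y|lborel. ?h y"] by simp
  show ?thesis
    unfolding Re_coef_a_diff abs_mult using mult_left_mono[OF *, of "1 / sqrt (2 * pi)"]
    by (simp add: mult_ac)
qed

text \<open>The frequency is \<open>l / 2 ^ j\<close> and the derivative of the integrand is also of
  order \<open>1 / 2 ^ j\<close>, so the powers of 2 cancel in the first bound. The second one
  estimates the integral directly by the Lipschitz property of \<open>\<Psi>\<close> and keeps its
  power.\<close>

lemma R_diff_decay:
  assumes t: "t \<in> {0..T}" and s: "s \<in> {0..T}"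
  shows "\<bar>real_of_int l\<bar> * cmod (R j t (l / 2 ^ j) - R j s (l / 2 ^ j))
      \<le> \<bar>t - s\<bar> * (Mb * (LINT y|lborel. w y + \<bar>y\<bar> * v y))"
    and "cmod (R j t (l / 2 ^ j) - R j s (l / 2 ^ j))
      \<le> \<bar>t - s\<bar> * (Mb * (LINT y|lborel. w y * \<bar>y\<bar>)) / 2 ^ j"
proof -
  let ?h = "\<lambda>y. (u t y - u s y) * cnj (\<Psi> (y / 2 ^ j) - \<Psi> 0)"
  let ?h' = "\<lambda>y. (u t y - u s y) * cnj ((1 / 2 ^ j) *\<^sub>R \<Psi>' (y / 2 ^ j))
     + (uy t y - uy s y) * cnj (\<Psi> (y / 2 ^ j) - \<Psi> 0)"
  let ?g = "\<lambda>y. \<bar>t - s\<bar> * Mb / 2 ^ j * (w y + \<bar>y\<bar> * v y)"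
  let ?e = "\<lambda>y. exp (\<i> * complex_of_real (y * (l / 2 ^ j)))"
  have h: "cmod (?h y) \<le> \<bar>t - s\<bar> * Mb / 2 ^ j * (w y * \<bar>y\<bar>)" for y
  proof -
    have "cmod (?h y) \<le> (\<bar>s - t\<bar> * w y) * (Mb * \<bar>y / 2 ^ j\<bar>)"
      unfolding norm_mult complex_mod_cnj
      by (intro mult_mono w t s \<Psi>_lipschitz) (auto simp: w_nonneg)
    then show ?thesis by (simp add: mult_ac abs_minus_commute)
  qed
  have h': "cmod (?h' y) \<le> ?g y" for y
  proof -
    have "cmod (?h' y) \<le> cmod ((u t y - u s y) * cnj ((1 / 2 ^ j) *\<^sub>R \<Psi>' (y / 2 ^ j)))
        + cmod ((uy t y - uy s y) * cnj (\<Psi> (y / 2 ^ j) - \<Psi> 0))"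
      by (rule norm_triangle_ineq)
    also have "\<dots> \<le> (\<bar>s - t\<bar> * w y) * (1 / 2 ^ j * Mb) + (\<bar>s - t\<bar> * v y) * (Mb * \<bar>y / 2 ^ j\<bar>)"
      unfolding norm_mult complex_mod_cnj norm_scaleR
      by (intro add_mono mult_mono w v t s \<Psi>_lipschitz Mb) (auto simp: w_nonneg v_nonneg)
    finally show ?thesis by (simp add: algebra_simps abs_minus_commute add_divide_distrib)
  qed
  have g: "integrable lborel ?g"
    using y_v w_int by (intro integrable_mult_right Bochner_Integration.integrable_add)
  have g0: "integrable lborel (\<lambda>y. \<bar>t - s\<bar> * Mb / 2 ^ j * (w y * \<bar>y\<bar>))"
    using w_y by (intro integrable_mult_right)
  have int_h: "integrable lborel ?h"
    by (rule integrable_dominated[OF g0 _ h]) auto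
  have int_h': "integrable lborel ?h'"
    by (rule integrable_dominated[OF g _ h']) auto
  have "\<bar>real_of_int l / 2 ^ j\<bar> * cmod (LINT y|lborel. ?h y * ?e y) \<le> (LINT y|lborel. cmod (?h' y))"
  proof (rule fourier_coefficient_decay[OF _ int_h int_h'])
    fix y
    have "((\<lambda>y. y / 2 ^ j) has_vector_derivative 1 / 2 ^ j) (at y)"
      unfolding has_real_derivative_iff_has_vector_derivative[symmetric]
      by (auto intro!: derivative_eq_intros)
    from vector_diff_chain_at[OF this d\<Psi>]
    have "((\<lambda>y. \<Psi> (y / 2 ^ j)) has_vector_derivative (1 / 2 ^ j) *\<^sub>R \<Psi>' (y / 2 ^ j)) (at y)"
      by (simp add: o_def)
    from has_vector_derivative_diff[OF this has_vector_derivative_const[of "\<Psi> 0"]]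
    have "((\<lambda>y. \<Psi> (y / 2 ^ j) - \<Psi> 0) has_vector_derivative (1 / 2 ^ j) *\<^sub>R \<Psi>' (y / 2 ^ j)) (at y)"
      by simp
    then show "(?h has_vector_derivative ?h' y) (at y)"
      by (intro has_vector_derivative_mult has_vector_derivative_diff du has_vector_derivative_cnj)
  qed
  also have "\<dots> \<le> (LINT y|lborel. ?g y)"
    using int_h' g h' by (intro integral_mono) auto
  finally have le: "\<bar>real_of_int l / 2 ^ j\<bar> * cmod (LINT y|lborel. ?h y * ?e y) \<le> (LINT y|lborel. ?g y)" .
  have cancel: "a \<le> b" if "a / 2 ^ j \<le> b / 2 ^ j" for a b :: real
    using that by (simp add: divide_le_cancel)
  note le
  also have "(LINT y|lborel. ?g y) = \<bar>t - s\<bar> * Mb / 2 ^ j * (LINT y|lborel. w y + \<bar>y\<bar> * v y)"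
    by (rule integral_mult_right_zero)
  finally have "\<bar>real_of_int l\<bar> / 2 ^ j * cmod (LINT y|lborel. ?h y * ?e y)
      \<le> \<bar>t - s\<bar> * Mb * (LINT y|lborel. w y + \<bar>y\<bar> * v y) / 2 ^ j"
    by (simp only: abs_divide power_abs abs_numeral times_divide_eq_left)
  then have "\<bar>real_of_int l\<bar> * cmod (LINT y|lborel. ?h y * ?e y)
      \<le> \<bar>t - s\<bar> * Mb * (LINT y|lborel. w y + \<bar>y\<bar> * v y)"
    unfolding times_divide_eq_left by (rule cancel)
  then show "\<bar>real_of_int l\<bar> * cmod (R j t (l / 2 ^ j) - R j s (l / 2 ^ j))
      \<le> \<bar>t - s\<bar> * (Mb * (LINT y|lborel. w y + \<bar>y\<bar> * v y))"
    unfolding R_diff mult.assoc .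
  have "cmod (LINT y|lborel. ?h y * ?e y) \<le> (LINT y|lborel. \<bar>t - s\<bar> * Mb / 2 ^ j * (w y * \<bar>y\<bar>))"
    by (rule integral_cmod_le[OF g0]) (use h in \<open>simp add: norm_mult\<close>)
  also have "\<dots> = \<bar>t - s\<bar> * Mb / 2 ^ j * (LINT y|lborel. w y * \<bar>y\<bar>)"
    by (rule integral_mult_right_zero)
  finally show "cmod (R j t (l / 2 ^ j) - R j s (l / 2 ^ j))
      \<le> \<bar>t - s\<bar> * (Mb * (LINT y|lborel. w y * \<bar>y\<bar>)) / 2 ^ j"
    unfolding R_diff by (simp only: times_divide_eq_left mult.assoc)
qed

lemma coef_b_diff:
  assumes "\<And>t x. Re (\<Psi> 0) * Re (F t x) = 0"
  shows "\<bar>Re (coef_b u \<Psi> j l t) - Re (coef_b u \<Psi> j l s)\<bar>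
    \<le> 2 powr (- real j / 2) / sqrt (2 * pi) * cmod (R j t (l / 2 ^ j) - R j s (l / 2 ^ j))"
proof -
  have "\<bar>Re (coef_b u \<Psi> j l t) - Re (coef_b u \<Psi> j l s)\<bar>
      = 2 powr (- real j / 2) / sqrt (2 * pi) * \<bar>Re (R j t (l / 2 ^ j) - R j s (l / 2 ^ j))\<bar>"
    unfolding Re_coef_b assms by (simp only: add_0_right minus_complex.sel abs_mult flip: right_diff_distrib) simp
  also have "\<dots> \<le> 2 powr (- real j / 2) / sqrt (2 * pi) * cmod (R j t (l / 2 ^ j) - R j s (l / 2 ^ j))"
    by (intro mult_left_mono abs_Re_le_cmod) auto
  finally show ?thesis .
qed

text \<open>The two bounds complement each other: the first is summable over nonzero translates, the
  second survives at \<open>l = 0\<close> and gains a factor \<open>1 / 2 ^ j\<close>.\<close>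

lemma coef_b_decay:
  assumes zero: "\<And>t x. Re (\<Psi> 0) * Re (F t x) = 0" and t: "t \<in> {0..T}" and s: "s \<in> {0..T}"
  shows "\<bar>real_of_int l\<bar> * \<bar>Re (coef_b u \<Psi> j l t) - Re (coef_b u \<Psi> j l s)\<bar>
      \<le> 2 powr (- real j / 2) * (B1 * \<bar>t - s\<bar>)"
    and "\<bar>Re (coef_b u \<Psi> j l t) - Re (coef_b u \<Psi> j l s)\<bar>
      \<le> 2 powr (- real j / 2) * (B0 * \<bar>t - s\<bar>) / 2 ^ j"
proof -
  let ?p = "2 powr (- real j / 2) / sqrt (2 * pi)"
  let ?R = "cmod (R j t (l / 2 ^ j) - R j s (l / 2 ^ j))"
  have "\<bar>real_of_int l\<bar> * \<bar>Re (coef_b u \<Psi> j l t) - Re (coef_b u \<Psi> j l s)\<bar>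
      \<le> \<bar>real_of_int l\<bar> * (?p * ?R)"
    by (intro mult_left_mono coef_b_diff zero) auto
  also have "\<dots> = ?p * (\<bar>real_of_int l\<bar> * ?R)" by (simp add: mult_ac)
  also have "\<dots> \<le> ?p * (\<bar>t - s\<bar> * (Mb * (LINT y|lborel. w y + \<bar>y\<bar> * v y)))"
    by (intro mult_left_mono R_diff_decay t s) auto
  finally show "\<bar>real_of_int l\<bar> * \<bar>Re (coef_b u \<Psi> j l t) - Re (coef_b u \<Psi> j l s)\<bar>
      \<le> 2 powr (- real j / 2) * (B1 * \<bar>t - s\<bar>)"
    by (simp add: B1_def mult_ac)
  have "\<bar>Re (coef_b u \<Psi> j l t) - Re (coef_b u \<Psi> j l s)\<bar> \<le> ?p * ?R"
    by (intro coef_b_diff zero)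
  also have "\<dots> \<le> ?p * (\<bar>t - s\<bar> * (Mb * (LINT y|lborel. w y * \<bar>y\<bar>)) / 2 ^ j)"
    by (intro mult_left_mono R_diff_decay t s) auto
  finally show "\<bar>Re (coef_b u \<Psi> j l t) - Re (coef_b u \<Psi> j l s)\<bar>
      \<le> 2 powr (- real j / 2) * (B0 * \<bar>t - s\<bar>) / 2 ^ j"
    by (simp add: B0_def mult_ac)
qed

section \<open>Ruling out a contribution of \<open>Re (\<Psi> 0)\<close>\<close>

lemma F_lipschitz: "cmod (F t x - F t x') \<le> \<bar>t\<bar> * (LINT y|lborel. u1 y * \<bar>y\<bar>) * \<bar>x - x'\<bar>"
proof -
  let ?f = "\<lambda>y. u t y * (exp (\<i> * complex_of_real (y * x)) - exp (\<i> * complex_of_real (y * x')))"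
  have "F t x - F t x' = (LINT y|lborel. ?f y)"
    unfolding F_def
    using Bochner_Integration.integral_diff[OF u_exp_int[of t x] u_exp_int[of t x']]
    by (simp only: right_diff_distrib)
  also have "cmod \<dots> \<le> (LINT y|lborel. \<bar>t\<bar> * \<bar>x - x'\<bar> * (u1 y * \<bar>y\<bar>))"
  proof (rule integral_cmod_le)
    fix y
    have "cmod (?f y) \<le> (\<bar>t\<bar> * u1 y) * \<bar>y * x - y * x'\<bar>"
      unfolding norm_mult
      by (intro mult_mono u1 cmod_exp_i_diff_le order_trans[OF norm_ge_zero u1]) auto
    also have "\<bar>y * x - y * x'\<bar> = \<bar>y\<bar> * \<bar>x - x'\<bar>"
      by (simp flip: right_diff_distrib abs_mult)
    finally show "cmod (?f y) \<le> \<bar>t\<bar> * \<bar>x - x'\<bar> * (u1 y * \<bar>y\<bar>)" by (simp add: mult_ac)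
  qed (use u1_y in auto)
  finally show ?thesis unfolding integral_mult_right_zero by (simp add: mult_ac)
qed

lemma R_bound: "cmod (R j t x) \<le> \<bar>t\<bar> * Mb * (LINT y|lborel. u1 y * \<bar>y\<bar>) / 2 ^ j"
proof -
  have "cmod (R j t x) \<le> (LINT y|lborel. \<bar>t\<bar> * Mb / 2 ^ j * (u1 y * \<bar>y\<bar>))"
    unfolding R_def
    by (rule integral_cmod_le) (use u1_y u_\<Psi>_bound in \<open>auto simp: norm_mult\<close>)
  then show ?thesis by simp
qed

text \<open>The real part of \<open>\<Psi> 0\<close> vanishes, at least where it matters: otherwise
  \<open>b\<^sub>j\<^sub>l\<close> is close to \<open>2\<^sup>-\<^sup>j\<^sup>/\<^sup>2 g (l / 2\<^sup>j)\<close> with \<open>g = Re (\<Psi> 0) F t / sqrt (2 \<pi>)\<close>, so that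
  \<open>\<Sum>\<^sub>l b\<^sub>j\<^sub>l\<^sup>2\<close> is a Riemann sum bounded away from \<open>0\<close> for all large \<open>j\<close>.\<close>
lemma Re_\<Psi>_0_times_F_eq_0:
  assumes bessel: "\<And>n::nat. (\<Sum>j<n. \<Sum>l\<in>{- (int n - 1)..int n - 1}. (Re (coef_b u \<Psi> j l t))\<^sup>2) \<le> K"
  shows "Re (\<Psi> 0) * Re (F t x) = 0"
proof (rule ccontr)
  assume nz: "Re (\<Psi> 0) * Re (F t x) \<noteq> 0"
  define g where "g x = Re (\<Psi> 0) * Re (F t x) / sqrt (2 * pi)" for x
  define c where "c = \<bar>g x\<bar>"
  have c: "c > 0" using nz by (simp add: c_def g_def)
  define I where "I = \<bar>t\<bar> * (LINT y|lborel. u1 y * \<bar>y\<bar>)"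
  \<comment> \<open>The sign comes from the Lipschitz estimate between 1 and 0, where
    \<open>I\<close> bounds a norm.\<close>
  have I: "I \<ge> 0"
    using R_bound[of 0 t 0] F_lipschitz[of t 1 0] norm_ge_zero[of "F t 1 - F t 0"]
    unfolding I_def by (simp only: diff_0_right abs_one mult_1_right) 
  \<comment> \<open>The added 1 keeps the Lipschitz constant positive, so that it may be divided
    by.\<close>
  define Lg where "Lg = \<bar>Re (\<Psi> 0)\<bar> * I / sqrt (2 * pi) + 1"
  have Lg: "Lg > 0" using I by (simp add: Lg_def add_nonneg_pos)
  have g_lip: "\<bar>g x - g x'\<bar> \<le> Lg * \<bar>x - x'\<bar>" for x'
  proof -
    have "\<bar>g x - g x'\<bar> = \<bar>Re (\<Psi> 0)\<bar> / sqrt (2 * pi) * \<bar>Re (F t x - F t x')\<bar>"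
      by (simp add: g_def abs_mult flip: diff_divide_distrib right_diff_distrib)
    also have "\<dots> \<le> \<bar>Re (\<Psi> 0)\<bar> / sqrt (2 * pi) * (I * \<bar>x - x'\<bar>)"
      using order_trans[OF abs_Re_le_cmod F_lipschitz[of t x x']] unfolding I_def
      by (intro mult_left_mono) auto
    also have "\<dots> \<le> Lg * \<bar>x - x'\<bar>"
      by (simp add: Lg_def algebra_simps)
    finally show ?thesis .
  qed
  \<comment> \<open>Within distance \<open>r\<close> of \<open>x\<close> the function
    \<open>g\<close> changes by at most \<open>c / 4\<close>, hence stays at least
    \<open>3 * c / 4\<close> in absolute value.\<close>
  define r where "r = c / (4 * Lg)"
  have r: "r > 0" using c Lg by (simp add: r_def)
  define E where "E = Mb * I / sqrt (2 * pi)"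
  have E: "E \<ge> 0" using I Mb_nonneg by (simp add: E_def)
  \<comment> \<open>One threshold for two purposes: from level \<open>J\<close> on the remainder
    \<open>E / 2 ^ j\<close> is at most \<open>c / 4\<close>, and the rescaled window satisfies
    \<open>2 ^ j * r \<ge> 1\<close>.\<close>
  obtain J :: nat where J: "2 ^ J > 4 * E / c + 1 / r"
    using real_arch_pow[of 2 "4 * E / c + 1 / r"] by auto
  have big: "2 ^ j \<ge> 4 * E / c + 1 / r" if "j \<ge> J" for j
  proof -
    have "(2::real) ^ J \<le> 2 ^ j" using that by (intro power_increasing) auto
    with J show ?thesis by linarith
  qed
  define L where "L j = {\<lceil>2 ^ j * (x - r)\<rceil>..\<lfloor>2 ^ j * (x + r)\<rfloor>}" for j :: nat
  have term_ge: "(Re (coef_b u \<Psi> j l t))\<^sup>2 \<ge> c\<^sup>2 / 4 / 2 ^ j" if j: "j \<ge> J" and l: "l \<in> L j" for j l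
  proof -
    have "2 ^ j * (x - r) \<le> l" "l \<le> 2 ^ j * (x + r)"
      using l by (auto simp: L_def ceiling_le_iff le_floor_iff)
    then have "x - r \<le> l / 2 ^ j" "l / 2 ^ j \<le> x + r" by (simp_all add: field_simps)
    then have "\<bar>x - l / 2 ^ j\<bar> \<le> r" by linarith
    then have "Lg * \<bar>x - l / 2 ^ j\<bar> \<le> c / 4"
      using mult_left_mono[of "\<bar>x - l / 2 ^ j\<bar>" r Lg] Lg by (simp add: r_def)
    with g_lip[of "l / 2 ^ j"] have g1: "\<bar>g (l / 2 ^ j)\<bar> \<ge> 3 * c / 4"
      unfolding c_def by linarith
    have "4 * E / c \<le> 2 ^ j" using big[OF j] r by (smt (verit) divide_pos_pos)
    then have E1: "E / 2 ^ j \<le> c / 4" using c by (simp add: field_simps)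
    have "\<bar>Re (R j t (l / 2 ^ j)) / sqrt (2 * pi)\<bar> \<le> E / 2 ^ j"
      using divide_right_mono[OF order_trans[OF abs_Re_le_cmod R_bound[of j t "l / 2 ^ j"]], of "sqrt (2 * pi)"]
      by (simp add: E_def I_def mult_ac)
    with g1 E1 have "\<bar>Re (R j t (l / 2 ^ j)) / sqrt (2 * pi) + g (l / 2 ^ j)\<bar> \<ge> c / 2"
      by linarith
    then have ge: "(Re (R j t (l / 2 ^ j)) / sqrt (2 * pi) + g (l / 2 ^ j))\<^sup>2 \<ge> (c / 2)\<^sup>2"
      using c by (metis abs_le_square_iff abs_of_pos half_gt_zero)
    have "Re (coef_b u \<Psi> j l t)
        = 2 powr (- real j / 2) * (Re (R j t (l / 2 ^ j)) / sqrt (2 * pi) + g (l / 2 ^ j))"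
      by (simp add: Re_coef_b g_def add_divide_distrib algebra_simps)
    then have eq: "(Re (coef_b u \<Psi> j l t))\<^sup>2
        = (1 / 2) ^ j * (Re (R j t (l / 2 ^ j)) / sqrt (2 * pi) + g (l / 2 ^ j))\<^sup>2"
      by (simp only: power_mult_distrib two_powr_half_squared)
    have "c\<^sup>2 / 4 / 2 ^ j = (1 / 2) ^ j * (c / 2)\<^sup>2"
      by (simp add: power_divide)
    also have "\<dots> \<le> (Re (coef_b u \<Psi> j l t))\<^sup>2"
      unfolding eq by (rule mult_left_mono[OF ge]) simp
    finally show ?thesis .
  qed
  \<comment> \<open>A window of length \<open>2 * 2 ^ j * r\<close> contains at least that many
    integers minus one, and the choice of \<open>J\<close> lets half of the length absorb the
    one.\<close>
  have card_ge: "real (card (L j)) \<ge> 2 ^ j * r" if j: "j \<ge> J" for j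
  proof -
    have "1 / r \<le> 2 ^ j" using big[OF j] c E by (smt (verit) divide_nonneg_pos)
    then have "1 \<le> 2 ^ j * r" using r by (simp add: field_simps)
    moreover have "real (card (L j)) \<ge> 2 ^ j * (x + r) - 2 ^ j * (x - r) - 1"
      unfolding L_def by (simp, linarith)
    ultimately show ?thesis by (simp add: algebra_simps)
  qed
  have block: "(\<Sum>l\<in>L j. (Re (coef_b u \<Psi> j l t))\<^sup>2) \<ge> r * c\<^sup>2 / 4" if j: "j \<ge> J" for j
  proof -
    have "r * c\<^sup>2 / 4 = (2 ^ j * r) * (c\<^sup>2 / 4 / 2 ^ j)" by simp
    also have "\<dots> \<le> real (card (L j)) * (c\<^sup>2 / 4 / 2 ^ j)"
      by (intro mult_right_mono card_ge j) auto
    also have "\<dots> \<le> (\<Sum>l\<in>L j. (Re (coef_b u \<Psi> j l t))\<^sup>2)"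
      using term_ge[OF j] by (intro sum_bounded_below) auto
    finally show ?thesis .
  qed
  \<comment> \<open>Every level from \<open>J\<close> on contributes at least
    \<open>r * c\<^sup>2 / 4\<close>, so \<open>m\<close> such levels exceed the supposed bound
    \<open>K\<close>.\<close>
  define m where "m = nat \<lceil>K / (r * c\<^sup>2 / 4)\<rceil> + 1"
  have m: "real m * (r * c\<^sup>2 / 4) > K"
  proof -
    have "real m > K / (r * c\<^sup>2 / 4)" unfolding m_def by linarith
    then show ?thesis using r c by (simp add: field_simps)
  qed
  \<comment> \<open>Large enough for the square truncation to contain the levels below
    \<open>J + m\<close> together with their whole windows of translates.\<close>
  define n where "n = nat \<lceil>2 ^ (J + m) * (\<bar>x\<bar> + r)\<rceil> + J + m + 2"
  have sub: "L j \<subseteq> {- (int n - 1)..int n - 1}" if "j < J + m" for j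
  proof -
    have p: "(2::real) ^ j \<le> 2 ^ (J + m)" using that by (intro power_increasing) auto
    have b: "2 ^ j * (\<bar>x\<bar> + r) \<le> 2 ^ (J + m) * (\<bar>x\<bar> + r)" using r by (intro mult_right_mono p) auto
    have n: "real n \<ge> 2 ^ (J + m) * (\<bar>x\<bar> + r) + 2" unfolding n_def by linarith
    have "2 ^ j * (x + r) \<le> 2 ^ j * (\<bar>x\<bar> + r)" "- (2 ^ j * (\<bar>x\<bar> + r)) \<le> 2 ^ j * (x - r)"
      using r by (simp_all flip: mult_minus_right)
    with b n have "2 ^ j * (x + r) \<le> real n - 1" "- (real n - 1) \<le> 2 ^ j * (x - r)"
      by linarith+
    then show ?thesis unfolding L_def by (auto; linarith)
  qed
  have "real m * (r * c\<^sup>2 / 4) = (\<Sum>j\<in>{J..<J + m}. r * c\<^sup>2 / 4)" by simp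
  also have "\<dots> \<le> (\<Sum>j\<in>{J..<J + m}. \<Sum>l\<in>{- (int n - 1)..int n - 1}. (Re (coef_b u \<Psi> j l t))\<^sup>2)"
  proof (rule sum_mono)
    fix j assume j: "j \<in> {J..<J + m}"
    have "r * c\<^sup>2 / 4 \<le> (\<Sum>l\<in>L j. (Re (coef_b u \<Psi> j l t))\<^sup>2)" using block j by simp
    also have "\<dots> \<le> (\<Sum>l\<in>{- (int n - 1)..int n - 1}. (Re (coef_b u \<Psi> j l t))\<^sup>2)"
      using j by (intro sum_mono2 sub) auto
    finally show "r * c\<^sup>2 / 4 \<le> (\<Sum>l\<in>{- (int n - 1)..int n - 1}. (Re (coef_b u \<Psi> j l t))\<^sup>2)" .
  qed
  also have "\<dots> \<le> (\<Sum>j<n. \<Sum>l\<in>{- (int n - 1)..int n - 1}. (Re (coef_b u \<Psi> j l t))\<^sup>2)"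
    by (intro sum_mono2) (auto simp: n_def sum_nonneg)
  also have "\<dots> \<le> K" by (rule bessel)
  finally show False using m by simp
qed

end

section \<open>Size of the Lipschitz constant\<close>

text \<open>On the half-line the root is at least \<open>sqrt (a + 1)\<close>, and
  \<open>1 / s\<^sup>2\<close> has integral \<open>1 / a\<close>.\<close>

lemma sqrt_over_square_tail_integral:
  fixes a :: real
  assumes a: "a > 0"
  shows "(LBINT s:{a..}. sqrt (s + 1) / s\<^sup>2) \<ge> sqrt (a + 1) / a"
proof -
  let ?f = "\<lambda>s. sqrt (s + 1) / s\<^sup>2"
  \<comment> \<open>Integrability must be checked first, since a divergent Lebesgue integral would
    have the default value 0. A multiple of \<open>1 / (s * sqrt s)\<close> dominates.\<close>
  have int: "set_integrable lborel {a..} ?f"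
  proof -
    have "(\<integral>\<^sup>+s. ennreal (1 / (s * sqrt s)) * indicator {a..} s \<partial>lborel) = ennreal (0 - (- 2 / sqrt a))"
    proof (rule nn_integral_FTC_atLeast)
      fix s :: real assume "a \<le> s"
      with a have s: "s > 0" by simp
      have "((\<lambda>s. - 2 / sqrt s) has_real_derivative 2 * (inverse (sqrt s) / 2) / (sqrt s)\<^sup>2) (at s)"
        using s by (auto intro!: derivative_eq_intros simp: power2_eq_square)
      then show "((\<lambda>s. - 2 / sqrt s) has_real_derivative 1 / (s * sqrt s)) (at s)"
        using s by (simp add: field_simps)
      show "0 \<le> 1 / (s * sqrt s)" using s by simp
    next
      show "((\<lambda>s. - 2 / sqrt s) \<longlongrightarrow> 0) at_top" by real_asymp
    qed simp
    also have "(\<integral>\<^sup>+s. ennreal (1 / (s * sqrt s)) * indicator {a..} s \<partial>lborel)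
        = (\<integral>\<^sup>+s. ennreal (1 / (s * sqrt s) * indicator {a..} s) \<partial>lborel)"
      by (intro nn_integral_cong) (auto split: split_indicator)
    finally have "integrable lborel (\<lambda>s. 1 / (s * sqrt s) * indicator {a..} s)"
      using a by (intro integrableI_nonneg) (auto split: split_indicator)
    then have "integrable lborel (\<lambda>s. sqrt (1 + 1 / a) * (1 / (s * sqrt s) * indicator {a..} s))"
      by (rule integrable_mult_right)
    then show ?thesis
      unfolding set_integrable_def
    proof (rule Bochner_Integration.integrable_bound)
      have "sqrt (s + 1) / s\<^sup>2 \<le> sqrt (1 + 1 / a) / (s * sqrt s)" if "a \<le> s" for s
      proof -
        have s: "s > 0" using a that by simp
        have "s + 1 \<le> s * (1 + 1 / a)" using a that by (simp add: field_simps)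
        then have "sqrt (s + 1) \<le> sqrt s * sqrt (1 + 1 / a)"
          by (metis real_sqrt_le_iff real_sqrt_mult)
        then have "sqrt (s + 1) / s\<^sup>2 \<le> sqrt s * sqrt (1 + 1 / a) / s\<^sup>2"
          by (intro divide_right_mono) auto
        also have "sqrt s * sqrt (1 + 1 / a) / s\<^sup>2 = sqrt (1 + 1 / a) / (s * sqrt s)"
        proof -
          have "sqrt s * (s * sqrt s) = s\<^sup>2"
            using s by (simp add: power2_eq_square mult.left_commute)
          then show ?thesis using s by (simp add: frac_eq_eq mult_ac)
        qed
        finally show ?thesis .
      qed
      then show "AE s in lborel. norm (indicator {a..} s *\<^sub>R (sqrt (s + 1) / s\<^sup>2))
          \<le> norm (sqrt (1 + 1 / a) * (1 / (s * sqrt s) * indicator {a..} s))"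
        using a by (intro AE_I2) (auto split: split_indicator simp: abs_mult)
    qed measurable
  qed
  have tail: "(\<integral>\<^sup>+s. ennreal (1 / s\<^sup>2) * indicator {a..} s \<partial>lborel) = ennreal (0 - (- 1 / a))"
  proof (rule nn_integral_FTC_atLeast)
    fix s :: real assume "a \<le> s"
    with a have s: "s > 0" by simp
    show "((\<lambda>s. - 1 / s) has_real_derivative 1 / s\<^sup>2) (at s)"
      using s by (auto intro!: derivative_eq_intros simp: power2_eq_square)
  next
    show "((\<lambda>s. - 1 / s) \<longlongrightarrow> (0::real)) at_top" by real_asymp
  qed simp_all
  have "ennreal (sqrt (a + 1) * (1 / a)) = ennreal (sqrt (a + 1)) * ennreal (1 / a)"
    using a by (intro ennreal_mult) auto
  also have "\<dots> = (\<integral>\<^sup>+s. ennreal (sqrt (a + 1)) * (ennreal (1 / s\<^sup>2) * indicator {a..} s) \<partial>lborel)"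
    using tail a by (subst nn_integral_cmult) auto
  also have "\<dots> \<le> (\<integral>\<^sup>+s. ennreal (indicator {a..} s *\<^sub>R ?f s) \<partial>lborel)"
    using a by (intro nn_integral_mono)
      (auto split: split_indicator simp: ennreal_mult'[symmetric] intro!: ennreal_leI divide_right_mono)
  also have "\<dots> = ennreal (LBINT s:{a..}. ?f s)"
    unfolding set_lebesgue_integral_def
    using int a by (intro nn_integral_eq_integral) (auto simp: set_integrable_def split: split_indicator)
  finally show ?thesis
    using a by (subst (asm) ennreal_le_iff)
      (auto simp: set_lebesgue_integral_def split: split_indicator intro!: integral_nonneg_AE)
qed

text \<open>The lower bound for the tail integral turns \<open>Q * T\<close> into explicit numbers:
  its square is at most 1/99 of the square of \<open>e / (1 + e ^ 3 / 8)\<close>. This fraction is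
  at most \<open>e\<close> and also at most 3/2; the second estimate is needed because
  \<open>e\<close> may be large.\<close>

lemma Q_bounds:
  fixes T \<theta> e A\<theta> Q :: real
  assumes T: "T > 0" and \<theta>: "0 < \<theta>" "\<theta> < 1" and e: "e > 0"
    and A\<theta>: "A\<theta> = (LBINT s:{1 / (2 * \<theta>)..}. sqrt (s + 1) / s\<^sup>2)"
    and Q: "Q = exp (1 / 2) * e * \<theta> * (1 - \<theta>) / (2 powr (9 / 4) * A\<theta> * T * (1 + e ^ 3 / 8))"
  shows "Q > 0" "96 * (Q * T)\<^sup>2 \<le> e\<^sup>2" "32 * (Q * T)\<^sup>2 \<le> 1"
proof -
  let ?a = "1 / (2 * \<theta>)"
  have a: "?a > 0" using \<theta> by simp
  have A: "A\<theta> \<ge> sqrt (?a + 1) / ?a"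
    unfolding A\<theta> by (rule sqrt_over_square_tail_integral[OF a])
  have "sqrt (?a + 1) / ?a > 0"
    by (intro divide_pos_pos real_sqrt_gt_zero add_pos_pos a zero_less_one)
  with A have A_pos: "A\<theta> > 0" by linarith
  have c: "1 + e ^ 3 / 8 > 0" using e by (simp add: add_pos_pos)
  show Q_pos: "Q > 0"
    unfolding Q using T \<theta> e A_pos c by (intro divide_pos_pos mult_pos_pos) auto
  have "(sqrt (?a + 1) / ?a)\<^sup>2 \<le> A\<theta>\<^sup>2"
    using a by (intro power_mono A) auto
  then have A2: "A\<theta>\<^sup>2 \<ge> 2 * \<theta> + 4 * \<theta>\<^sup>2"
  proof -
    have "(sqrt (?a + 1) / ?a)\<^sup>2 = (?a + 1) / ?a\<^sup>2"
      using a by (simp only: power_divide real_sqrt_pow2 add_nonneg_nonneg less_imp_le zero_le_one)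
    also have "\<dots> = 2 * \<theta> + 4 * \<theta>\<^sup>2"
      using \<theta> by (simp add: field_simps power2_eq_square)
    finally show ?thesis using \<open>(sqrt (?a + 1) / ?a)\<^sup>2 \<le> A\<theta>\<^sup>2\<close> by simp
  qed
  \<comment> \<open>The factorisation exhibits 4/27 as the maximum of the cubic on the unit
    interval, taken at 1/3.\<close>
  have "4 / 27 - \<theta> * (1 - \<theta>)\<^sup>2 = (\<theta> - 1 / 3)\<^sup>2 * (4 / 3 - \<theta>)"
    by (simp add: power2_eq_square field_simps)
  also have "\<dots> \<ge> 0" using \<theta> by simp
  finally have cub: "\<theta> * (1 - \<theta>)\<^sup>2 \<le> 4 / 27" by simp
  have "27 * (\<theta>\<^sup>2 * (1 - \<theta>)\<^sup>2) = 27 * \<theta> * (\<theta> * (1 - \<theta>)\<^sup>2)" by (simp add: power2_eq_square)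
  also have "\<dots> \<le> 27 * \<theta> * (4 / 27)" using \<theta> by (intro mult_left_mono cub) auto
  also have "\<dots> \<le> 2 * (2 * \<theta> + 4 * \<theta>\<^sup>2)" by simp
  also have "\<dots> \<le> 2 * A\<theta>\<^sup>2" using A2 by simp
  finally have th: "\<theta>\<^sup>2 * (1 - \<theta>)\<^sup>2 / A\<theta>\<^sup>2 \<le> 2 / 27" using A_pos by (simp add: field_simps)
  have p: "(2 powr (9 / 4))\<^sup>2 \<ge> (22::real)"
  proof -
    have "(2 powr (9 / 4))\<^sup>2 = (2::real) powr (4 + 1 / 2)"
      by (simp add: power2_eq_square flip: powr_add)
    then have "(2 powr (9 / 4))\<^sup>2 = 16 * sqrt (2::real)"
      by (subst (asm) powr_add) (simp add: powr_half_sqrt)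
    moreover have "sqrt 2 \<ge> (11 / 8 :: real)"
      by (rule real_le_rsqrt) (simp add: power2_eq_square)
    ultimately show ?thesis by simp
  qed
  have e1: "(exp (1 / 2))\<^sup>2 \<le> (3::real)"
    using exp_le by (simp flip: exp_double)
  let ?c = "e / (1 + e ^ 3 / 8)"
  have "(Q * T)\<^sup>2 = (exp (1 / 2))\<^sup>2 / (2 powr (9 / 4))\<^sup>2 * (\<theta>\<^sup>2 * (1 - \<theta>)\<^sup>2 / A\<theta>\<^sup>2) * ?c\<^sup>2"
    unfolding Q using T by (simp add: power_mult_distrib power_divide mult_ac)
  \<comment> \<open>The three estimates are \<open>exp 1 \<le> 3\<close>,
    \<open>16 * sqrt 2 \<ge> 22\<close> and \<open>th\<close>; their product is exactly
    1/99.\<close>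
  also have "\<dots> \<le> 3 / 22 * (2 / 27) * ?c\<^sup>2"
  proof (intro mult_right_mono mult_mono th)
    show "(exp (1 / 2))\<^sup>2 / (2 powr (9 / 4))\<^sup>2 \<le> (3 / 22 :: real)"
      using e1 p by (intro frac_le) auto
  qed auto
  finally have QT: "(Q * T)\<^sup>2 \<le> ?c\<^sup>2 / 99" by simp
  have "?c \<le> e / 1" using e by (intro divide_left_mono mult_pos_pos c zero_less_one) auto
  then have "?c\<^sup>2 \<le> e\<^sup>2" using e c by (intro power_mono) auto
  with QT have "(Q * T)\<^sup>2 \<le> e\<^sup>2 / 99"
    by (meson divide_right_mono order_trans zero_le_numeral)
  then have "96 * (Q * T)\<^sup>2 \<le> 96 * (e\<^sup>2 / 99)" by (rule mult_left_mono) simp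
  also have "\<dots> \<le> e\<^sup>2" by simp
  finally show "96 * (Q * T)\<^sup>2 \<le> e\<^sup>2" .
  \<comment> \<open>The double root at 4/3 is the minimum of the cubic for positive
    \<open>e\<close>, and its constant term 128/27 is below the 8 that the estimate by 3/2
    requires.\<close>
  have "0 \<le> (e - 4 / 3)\<^sup>2 * (e + 8 / 3)" using e by simp
  also have "\<dots> = e ^ 3 - 16 / 3 * e + 128 / 27"
    by (simp add: power2_eq_square power3_eq_cube field_simps)
  finally have "e \<le> 3 / 2 * (1 + e ^ 3 / 8)" by simp
  then have "?c \<le> 3 / 2" using c by (simp add: field_simps)
  then have "?c\<^sup>2 \<le> (3 / 2)\<^sup>2" using e c by (intro power_mono) auto
  with QT have "(Q * T)\<^sup>2 \<le> (3 / 2)\<^sup>2 / 99"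
    by (meson divide_right_mono order_trans zero_le_numeral)
  then have "32 * (Q * T)\<^sup>2 \<le> 32 * ((3 / 2)\<^sup>2 / 99)" by (rule mult_left_mono) simp
  also have "\<dots> \<le> 1" by (simp add: power2_eq_square)
  finally show "32 * (Q * T)\<^sup>2 \<le> 1" .
qed

section \<open>The error of the model\<close>

lemma integrable_mult_if_squares:
  fixes f g :: "'w \<Rightarrow> real"
  assumes [measurable]: "f \<in> borel_measurable M" "g \<in> borel_measurable M"
    and "integrable M (\<lambda>w. (f w)\<^sup>2)" "integrable M (\<lambda>w. (g w)\<^sup>2)"
  shows "integrable M (\<lambda>w. f w * g w)"
proof (rule Bochner_Integration.integrable_bound)
  show "integrable M (\<lambda>w. (f w)\<^sup>2 + (g w)\<^sup>2)" using assms by auto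
  have "\<bar>a * b\<bar> \<le> a\<^sup>2 + b\<^sup>2" for a b :: real
  proof -
    have "2 * (\<bar>a\<bar> * \<bar>b\<bar>) \<le> a\<^sup>2 + b\<^sup>2"
      using sum_squares_bound[of "\<bar>a\<bar>" "\<bar>b\<bar>"] by (simp add: mult.assoc)
    moreover have "0 \<le> \<bar>a\<bar> * \<bar>b\<bar>" by simp
    ultimately show ?thesis unfolding abs_mult by linarith
  qed
  then show "AE w in M. norm (f w * g w) \<le> norm ((f w)\<^sup>2 + (g w)\<^sup>2)" by simp
qed measurable

lemma square_diff_le: "((a::real) - b)\<^sup>2 \<le> 2 * a\<^sup>2 + 2 * b\<^sup>2"
  using zero_le_power2[of "a + b"] by (simp add: power2_diff power2_sum)

lemma integrable_square_diff:
  fixes f g :: "'w \<Rightarrow> real"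
  assumes [measurable]: "f \<in> borel_measurable M" "g \<in> borel_measurable M"
    and sq: "integrable M (\<lambda>w. (f w)\<^sup>2)" "integrable M (\<lambda>w. (g w)\<^sup>2)"
  shows "integrable M (\<lambda>w. (f w - g w)\<^sup>2)"
    and "(\<integral>w. (f w - g w)\<^sup>2 \<partial>M) \<le> 2 * (\<integral>w. (f w)\<^sup>2 \<partial>M) + 2 * (\<integral>w. (g w)\<^sup>2 \<partial>M)"
proof -
  show i: "integrable M (\<lambda>w. (f w - g w)\<^sup>2)"
    by (rule Bochner_Integration.integrable_bound[of M "\<lambda>w. 2 * (f w)\<^sup>2 + 2 * (g w)\<^sup>2"])
      (use sq square_diff_le in auto)
  have "(\<integral>w. (f w - g w)\<^sup>2 \<partial>M) \<le> (\<integral>w. 2 * (f w)\<^sup>2 + 2 * (g w)\<^sup>2 \<partial>M)"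
    using sq by (intro integral_mono i) (auto simp: square_diff_le)
  then show "(\<integral>w. (f w - g w)\<^sup>2 \<partial>M) \<le> 2 * (\<integral>w. (f w)\<^sup>2 \<partial>M) + 2 * (\<integral>w. (g w)\<^sup>2 \<partial>M)"
    using sq by simp
qed

lemma orthonormal_sum_square:
  fixes \<zeta> :: "'i \<Rightarrow> 'w \<Rightarrow> real"
  assumes [measurable]: "\<And>i. \<zeta> i \<in> borel_measurable M"
    and sq: "\<And>i. integrable M (\<lambda>w. (\<zeta> i w)\<^sup>2)"
    and on: "\<And>i j. (\<integral>w. \<zeta> i w * \<zeta> j w \<partial>M) = (if i = j then 1 else 0)"
    and I: "finite I"
  shows "integrable M (\<lambda>w. (\<Sum>i\<in>I. \<zeta> i w * c i)\<^sup>2)"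
    and "(\<integral>w. (\<Sum>i\<in>I. \<zeta> i w * c i)\<^sup>2 \<partial>M) = (\<Sum>i\<in>I. (c i)\<^sup>2)"
proof -
  have int: "integrable M (\<lambda>w. \<zeta> i w * \<zeta> j w)" for i j
    by (intro integrable_mult_if_squares sq) measurable
  have eq: "(\<Sum>i\<in>I. \<zeta> i w * c i)\<^sup>2 = (\<Sum>i\<in>I. \<Sum>j\<in>I. c i * c j * (\<zeta> i w * \<zeta> j w))" for w
    by (simp add: power2_eq_square sum_product mult_ac)
  show "integrable M (\<lambda>w. (\<Sum>i\<in>I. \<zeta> i w * c i)\<^sup>2)"
    unfolding eq by (intro Bochner_Integration.integrable_sum integrable_mult_right int)
  have "(\<integral>w. (\<Sum>i\<in>I. \<zeta> i w * c i)\<^sup>2 \<partial>M) = (\<Sum>i\<in>I. \<Sum>j\<in>I. c i * c j * (\<integral>w. \<zeta> i w * \<zeta> j w \<partial>M))"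
    unfolding eq
    by (simp only: Bochner_Integration.integral_sum Bochner_Integration.integrable_sum
        integrable_mult_right int integral_mult_right_zero)
  also have "\<dots> = (\<Sum>i\<in>I. (c i)\<^sup>2)"
    using I by (simp add: on power2_eq_square if_distrib[of "\<lambda>x. _ * x"] cong: if_cong)
  finally show "(\<integral>w. (\<Sum>i\<in>I. \<zeta> i w * c i)\<^sup>2 \<partial>M) = (\<Sum>i\<in>I. (c i)\<^sup>2)" .
qed

section \<open>The expansion (E) as a single orthonormal series\<close>

definition family :: "(int \<Rightarrow> 'w \<Rightarrow> real) \<Rightarrow> (nat \<Rightarrow> int \<Rightarrow> 'w \<Rightarrow> real) \<Rightarrow> int + nat \<times> int \<Rightarrow> 'w \<Rightarrow> real" where
  "family \<xi> \<eta> i = (case i of Inl k \<Rightarrow> \<xi> k | Inr (j, l) \<Rightarrow> \<eta> j l)"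

definition coef :: "(real \<Rightarrow> real \<Rightarrow> complex) \<Rightarrow> (real \<Rightarrow> complex) \<Rightarrow> (real \<Rightarrow> complex) \<Rightarrow>
    real \<Rightarrow> int + nat \<times> int \<Rightarrow> real" where
  "coef u \<Phi> \<Psi> t i = (case i of Inl k \<Rightarrow> Re (coef_a u \<Phi> k t) | Inr (j, l) \<Rightarrow> Re (coef_b u \<Psi> j l t))"

lemma model_X_eq:
  "model_X u \<Phi> \<Psi> \<xi> \<eta> N0 N Mj t \<omega>
    = (\<Sum>i\<in>model_index N0 N Mj. family \<xi> \<eta> i \<omega> * coef u \<Phi> \<Psi> t i)"
  by (simp add: model_X_def sum_model_index family_def coef_def)

lemma expansion_E_family:
  assumes "expansion_E M X u \<Phi> \<Psi> \<xi> \<eta>"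
  shows "family \<xi> \<eta> i \<in> borel_measurable M" "integrable M (\<lambda>w. (family \<xi> \<eta> i w)\<^sup>2)"
    "(\<integral>w. family \<xi> \<eta> i w * family \<xi> \<eta> j w \<partial>M) = (if i = j then 1 else 0)"
proof -
  show "family \<xi> \<eta> i \<in> borel_measurable M" "integrable M (\<lambda>w. (family \<xi> \<eta> i w)\<^sup>2)"
    using assms by (auto simp: expansion_E_def family_def split: sum.split prod.split)
  have "\<forall>k n l. (\<integral>w. \<eta> n l w * \<xi> k w \<partial>M) = 0"
    using assms unfolding expansion_E_def by (simp add: mult.commute)
  with assms show "(\<integral>w. family \<xi> \<eta> i w * family \<xi> \<eta> j w \<partial>M) = (if i = j then 1 else 0)"
    unfolding expansion_E_def family_def by (cases i; cases j) (auto split: prod.splits)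
qed

text \<open>The mean-square errors converge, hence are bounded, so the truncations are bounded in
  mean square; by orthonormality their second moments are sums of squared coefficients. Any finite
  bound suffices, which is why the crude factor 2 does no harm.\<close>

lemma expansion_E_bessel:
  assumes E: "expansion_E M X u \<Phi> \<Psi> \<xi> \<eta>"
    and X: "X t \<in> borel_measurable M" "integrable M (\<lambda>w. (X t w)\<^sup>2)"
  shows "\<exists>K. \<forall>n::nat. (\<Sum>j<n. \<Sum>l\<in>{- (int n - 1)..int n - 1}. (Re (coef_b u \<Psi> j l t))\<^sup>2) \<le> K"
proof -
  note fam = expansion_E_family[OF E]
  let ?X = "\<lambda>n w. model_X u \<Phi> \<Psi> \<xi> \<eta> n n (\<lambda>_. n) t w"
  let ?d = "\<lambda>n. \<integral>w. (X t w - ?X n w)\<^sup>2 \<partial>M"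
  have "Bseq ?d"
    using E by (intro convergent_imp_Bseq) (auto simp: expansion_E_def convergent_def)
  then obtain B where B: "\<And>n. norm (?d n) \<le> B" by (auto simp: Bseq_def)
  have meas: "?X n \<in> borel_measurable M" for n
    unfolding model_X_eq by (intro borel_measurable_sum borel_measurable_times fam) auto
  have sq: "integrable M (\<lambda>w. (?X n w)\<^sup>2)"
    "(\<integral>w. (?X n w)\<^sup>2 \<partial>M) = (\<Sum>i\<in>model_index n n (\<lambda>_. n). (coef u \<Phi> \<Psi> t i)\<^sup>2)" for n
    unfolding model_X_eq by (rule orthonormal_sum_square[OF fam], simp)+
  have "(\<Sum>j<n. \<Sum>l\<in>{- (int n - 1)..int n - 1}. (Re (coef_b u \<Psi> j l t))\<^sup>2)
      \<le> 2 * (\<integral>w. (X t w)\<^sup>2 \<partial>M) + 2 * B" for n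
  proof -
    have "(\<Sum>j<n. \<Sum>l\<in>{- (int n - 1)..int n - 1}. (Re (coef_b u \<Psi> j l t))\<^sup>2)
        \<le> (\<Sum>i\<in>model_index n n (\<lambda>_. n). (coef u \<Phi> \<Psi> t i)\<^sup>2)"
      by (simp add: sum_model_index coef_def sum_nonneg)
    also have "\<dots> = (\<integral>w. (X t w - (X t w - ?X n w))\<^sup>2 \<partial>M)" by (simp add: sq)
    also have "\<dots> \<le> 2 * (\<integral>w. (X t w)\<^sup>2 \<partial>M) + 2 * ?d n"
      by (intro integrable_square_diff X sq meas borel_measurable_diff)
    also have "?d n \<le> B" using B[of n] by simp
    finally show ?thesis by simp
  qed
  then show ?thesis by blast
qed

text \<open>The increment is the mean-square limit of finite sums over indices outside the model.
  Unit variance makes each variable sub-Gaussian with constant 1, so such a sum has parameter at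
  most \<open>q\<close> by the tail hypothesis.\<close>

lemma (in prob_space) model_error_increment:
  assumes E: "expansion_E M X u \<Phi> \<Psi> \<xi> \<eta>"
    and X: "\<And>t. X t \<in> borel_measurable M" "\<And>t. integrable M (\<lambda>w. (X t w)\<^sup>2)"
    and indep: "indep_vars (\<lambda>_. borel) (family \<xi> \<eta>) UNIV"
    and sg: "\<And>i. strictly_sub_gaussian M (family \<xi> \<eta> i)"
    and tail: "\<And>F. finite F \<Longrightarrow> F \<inter> model_index N0 N Mj = {} \<Longrightarrow>
                 (\<Sum>i\<in>F. (coef u \<Phi> \<Psi> t i - coef u \<Phi> \<Psi> s i)\<^sup>2) \<le> q\<^sup>2"
    and q: "q \<ge> 0"
  shows "subG_bound M (\<lambda>w. (X t w - model_X u \<Phi> \<Psi> \<xi> \<eta> N0 N Mj t w)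
                        - (X s w - model_X u \<Phi> \<Psi> \<xi> \<eta> N0 N Mj s w)) q"
proof -
  note fam = expansion_E_family[OF E]
  let ?I = "model_index N0 N Mj" and ?In = "\<lambda>n. model_index n n (\<lambda>_. n)"
  let ?h = "\<lambda>t w. model_X u \<Phi> \<Psi> \<xi> \<eta> N0 N Mj t w"
  let ?X = "\<lambda>n t w. model_X u \<Phi> \<Psi> \<xi> \<eta> n n (\<lambda>_. n) t w"
  let ?Y = "\<lambda>n w. (?X n t w - ?h t w) - (?X n s w - ?h s w)"
  let ?Z = "\<lambda>w. (X t w - ?h t w) - (X s w - ?h s w)"
  have sg1: "subG_bound M (family \<xi> \<eta> i) 1" for i
    using strictly_sub_gaussian_imp_subG_bound[OF sg[of i]] fam(3)[of i i]
    by (simp add: power2_eq_square)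
  have meas: "(\<lambda>w. model_X u \<Phi> \<Psi> \<xi> \<eta> a b c t w) \<in> borel_measurable M" for a b c t
    unfolding model_X_eq by (intro borel_measurable_sum borel_measurable_times fam) auto
  have sq: "integrable M (\<lambda>w. (model_X u \<Phi> \<Psi> \<xi> \<eta> a b c t w)\<^sup>2)" for a b c t
    unfolding model_X_eq by (rule orthonormal_sum_square(1)[OF fam]) simp
  have diff: "?Z w - ?Y n w = (X t w - ?X n t w) - (X s w - ?X n s w)" for n w by simp
  have dX: "(\<lambda>w. X t w - ?X n t w) \<in> borel_measurable M" "integrable M (\<lambda>w. (X t w - ?X n t w)\<^sup>2)" for n t
    by (intro borel_measurable_diff integrable_square_diff X meas sq)+
  \<comment> \<open>From here on the square truncation contains the model, so subtracting the model
    leaves a sum over a set difference.\<close>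
  define n0 where "n0 = N0 + N + (\<Sum>j<N. Mj j)"
  have sub: "?I \<subseteq> ?In n" if "n \<ge> n0" for n
  proof -
    have "Mj j \<le> n" if "j < N" for j
    proof -
      have "Mj j \<le> (\<Sum>j<N. Mj j)" using that by (intro member_le_sum) auto
      then show ?thesis using \<open>n \<ge> n0\<close> by (simp add: n0_def)
    qed
    then show ?thesis using that unfolding n0_def model_index_def by fastforce
  qed
  show ?thesis
  proof (rule subG_bound_L2_limit[where Y="?Y" and ?n0.0=n0])
    show "?Y n \<in> borel_measurable M" for n by (intro borel_measurable_diff meas)
    show "?Z \<in> borel_measurable M" by (intro borel_measurable_diff X meas)
    show "integrable M (\<lambda>w. (?Z w - ?Y n w)\<^sup>2)" for n
      unfolding diff by (intro integrable_square_diff dX)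
    show "(\<lambda>n. \<integral>w. (?Z w - ?Y n w)\<^sup>2 \<partial>M) \<longlonglongrightarrow> 0"
      unfolding diff
    proof (rule tendsto_sandwich[where f="\<lambda>_. 0"])
      show "\<forall>\<^sub>F n in sequentially. (\<integral>w. ((X t w - ?X n t w) - (X s w - ?X n s w))\<^sup>2 \<partial>M)
          \<le> 2 * (\<integral>w. (X t w - ?X n t w)\<^sup>2 \<partial>M) + 2 * (\<integral>w. (X s w - ?X n s w)\<^sup>2 \<partial>M)"
        by (intro always_eventually allI integrable_square_diff dX)
      have "(\<lambda>n. 2 * (\<integral>w. (X t w - ?X n t w)\<^sup>2 \<partial>M) + 2 * (\<integral>w. (X s w - ?X n s w)\<^sup>2 \<partial>M))
          \<longlonglongrightarrow> 2 * 0 + 2 * 0"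
        using E unfolding expansion_E_def by (intro tendsto_intros) auto
      then show "(\<lambda>n. 2 * (\<integral>w. (X t w - ?X n t w)\<^sup>2 \<partial>M) + 2 * (\<integral>w. (X s w - ?X n s w)\<^sup>2 \<partial>M))
          \<longlonglongrightarrow> 0" by simp
    qed auto
    show "subG_bound M (?Y n) q" if n: "n \<ge> n0" for n
    proof -
      let ?d = "\<lambda>i. coef u \<Phi> \<Psi> t i - coef u \<Phi> \<Psi> s i"
      have "?Y n = (\<lambda>w. \<Sum>i\<in>?In n - ?I. family \<xi> \<eta> i w * ?d i)"
        using sub[OF n]
        by (auto simp: model_X_eq sum_diff sum_subtractf right_diff_distrib)
      moreover have "subG_bound M (\<lambda>w. \<Sum>i\<in>?In n - ?I. family \<xi> \<eta> i w * ?d i)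
          (sqrt (\<Sum>i\<in>?In n - ?I. (?d i)\<^sup>2))"
        by (rule subG_bound_sum_indep[OF indep _ sg1]) simp
      moreover have "sqrt (\<Sum>i\<in>?In n - ?I. (?d i)\<^sup>2) \<le> q"
        using tail[of "?In n - ?I"] q by (intro real_le_lsqrt) (auto simp: sum_nonneg)
      ultimately show ?thesis using subG_bound_mono by simp
    qed
  qed
qed

text \<open>Solves the logarithmic thresholds for the power. The offset \<open>d\<close> becomes a
  factor: both \<open>8 powr 1\<close> and \<open>2 powr 3\<close> are 8, which turns the constants
  4 into 32.\<close>

lemma truncation_level:
  fixes B q c :: real and n :: nat
  assumes "b > 1" "q > 0" "c > 0" "real n > d + log b (c * B\<^sup>2 / q\<^sup>2)"
  shows "c * B\<^sup>2 * b powr d \<le> q\<^sup>2 * b ^ n"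
\<comment> \<open>For \<open>B = 0\<close> the logarithm has argument 0 and carries no information,
  but the claim is trivial.\<close>
proof (cases "B = 0")
  case True
  then show ?thesis using assms by simp
next
  case False
  then have "c * B\<^sup>2 / q\<^sup>2 > 0" using assms by simp
  moreover have "log b (c * B\<^sup>2 / q\<^sup>2) < real n - d" using assms by simp
  ultimately have "c * B\<^sup>2 / q\<^sup>2 < b powr (real n - d)"
    using assms by (simp add: log_less_iff)
  also have "\<dots> = b ^ n / b powr d"
    using assms by (simp add: powr_diff powr_realpow)
  finally show ?thesis using assms by (simp add: field_simps)
qed

text \<open>For negative \<open>z\<close> this is \<open>exp z + exp (- z) \<ge> 2\<close>, the
  inequality of arithmetic and geometric means.\<close>

lemma abs_exp_minus_1_le: "\<bar>exp z - 1\<bar> \<le> exp \<bar>z\<bar> - (1::real)"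
proof (cases "z \<ge> 0")
  case False
  have "2 \<le> exp z + exp (- z)"
    using arith_geo_mean_sqrt[of "exp z" "exp (- z)"] by (simp flip: exp_add)
  with False show ?thesis by simp
qed simp

text \<open>The exceptional event is a union over uncountably many times and need not be measurable,
  so it is covered by a measurable set of measure at most \<open>\<epsilon>\<close>.\<close>

theorem theorem3:
  fixes M :: "'w measure"
    and X :: "real \<Rightarrow> 'w \<Rightarrow> real"
    and u uy :: "real \<Rightarrow> real \<Rightarrow> complex"
    and \<phi> \<psi> \<Phi> \<Psi> \<Phi>' \<Psi>' :: "real \<Rightarrow> complex"
    and u1 u2 v w :: "real \<Rightarrow> real"
    and C Mb T \<theta> \<delta> \<epsilon> :: real
    and \<xi> :: "int \<Rightarrow> 'w \<Rightarrow> real" and \<eta> :: "nat \<Rightarrow> int \<Rightarrow> 'w \<Rightarrow> real"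
    and N0 N :: nat and Mj :: "nat \<Rightarrow> nat"
    and E2 F1 F2 A1 B0 B1 e A\<theta> \<tau>1 \<tau>2 \<tau>3 \<tau>s Q N0s Ns Ms N0ss Nss Mss :: real
    and Xh :: "real \<Rightarrow> 'w \<Rightarrow> real"
  assumes P: "prob_space M"
    and T: "T > 0" and \<theta>: "0 < \<theta>" "\<theta> < 1" and \<delta>: "\<delta> > 0" and \<epsilon>: "0 < \<epsilon>" "\<epsilon> < 1"
    \<comment> \<open>the process\<close>
    and sep: "separable_process M X"
    and msc: "ms_continuous M X"
    and ssg: "strictly_sub_gaussian_process M X"
    and RC: "condition_RC M X u"
    \<comment> \<open>scaling function, wavelet and their Fourier transforms\<close>
    and mra: "is_MRA_scaling \<phi>" and wav: "is_MRA_wavelet \<phi> \<psi>"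
    and F\<phi>: "is_fourier \<phi> \<Phi>" and F\<psi>: "is_fourier \<psi> \<Psi>"
    \<comment> \<open>expansion (E) with independent strictly sub-Gaussian coefficients\<close>
    and E: "expansion_E M X u \<Phi> \<Psi> \<xi> \<eta>"
    and indep: "prob_space.indep_vars M (\<lambda>_. borel)
                  (\<lambda>i. case i of Inl k \<Rightarrow> \<xi> k | Inr (j, l) \<Rightarrow> \<eta> j l) UNIV"
    and ssg\<xi>: "\<And>k. strictly_sub_gaussian M (\<xi> k)"
    and ssg\<eta>: "\<And>j l. strictly_sub_gaussian M (\<eta> j l)"
    \<comment> \<open>condition (a)\<close>
    and a_ac\<Phi>: "abs_cont_every_interval \<Phi>"
    and a_acu: "\<And>t. abs_cont_every_interval (u t)"
    and a_du: "\<And>t y. (u t has_vector_derivative uy t y) (at y)"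
    and a_d\<Phi>: "\<And>y. (\<Phi> has_vector_derivative \<Phi>' y) (at y)"
    and a_d\<Psi>: "\<And>y. (\<Psi> has_vector_derivative \<Psi>' y) (at y)"
    and a_C: "\<And>y. cmod (\<Psi>' y) \<le> C"
    and a_u1: "\<And>t y. cmod (u t y) \<le> \<bar>t\<bar> * u1 y"
    and a_u2: "\<And>t y. cmod (uy t y) \<le> \<bar>t\<bar> * u2 y"
    and a_u1nn: "\<And>y. u1 y \<ge> 0" and a_u2nn: "\<And>y. u2 y \<ge> 0"
    and a_i1: "integrable lborel (\<lambda>y. u1 y * \<bar>y\<bar>)"
    and a_i2: "integrable lborel u1"
    and a_i3: "integrable lborel (\<lambda>y. u1 y * cmod (\<Phi>' y))"
    and a_i4: "integrable lborel (\<lambda>y. u1 y * cmod (\<Phi> y))"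
    and a_i5: "integrable lborel (\<lambda>y. u2 y * \<bar>y\<bar>)"
    and a_i6: "integrable lborel (\<lambda>y. u2 y * cmod (\<Phi> y))"
    and a_lim\<psi>: "\<And>t j. t \<in> {0..T} \<Longrightarrow>
                   ((\<lambda>y. u t y * cnj (\<Psi> (y / 2 ^ j))) \<longlongrightarrow> 0) at_infinity"
    and a_lim\<phi>: "\<And>t. t \<in> {0..T} \<Longrightarrow> ((\<lambda>y. u t y * \<Phi> y) \<longlongrightarrow> 0) at_infinity"
    \<comment> \<open>condition (b), with \<open>S = cnj \<Psi>\<close>, \<open>S_\<phi> = cnj \<Phi>\<close>\<close>
    and b_M: "\<And>y. cmod (cnj (\<Psi>' y)) \<le> Mb"
    and b_vnn: "\<And>y. v y \<ge> 0" and b_wnn: "\<And>y. w y \<ge> 0"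
    and b_v: "\<And>t1 t2 y. t1 \<in> {0..T} \<Longrightarrow> t2 \<in> {0..T} \<Longrightarrow>
                cmod (uy t1 y - uy t2 y) \<le> \<bar>t2 - t1\<bar> * v y"
    and b_w: "\<And>t1 t2 y. t1 \<in> {0..T} \<Longrightarrow> t2 \<in> {0..T} \<Longrightarrow>
                cmod (u t1 y - u t2 y) \<le> \<bar>t2 - t1\<bar> * w y"
    and b_i1: "integrable lborel (\<lambda>y. \<bar>y\<bar> * v y)"
    and b_i2: "integrable lborel (\<lambda>y. v y * cmod (cnj (\<Phi> y)))"
    and b_i3: "integrable lborel (\<lambda>y. w y * cmod (cnj (\<Phi>' y)))"
    and b_i4: "integrable lborel w"
    and b_i5: "integrable lborel (\<lambda>y. w y * \<bar>y\<bar>)"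
    and b_i6: "integrable lborel (\<lambda>y. w y * cmod (cnj (\<Phi> y)))"
    \<comment> \<open>constants\<close>
    and E2_def: "E2 = (1 / sqrt (2 * pi)) *
             ((LINT y|lborel. u1 y * cmod (\<Phi>' y)) + (LINT y|lborel. u2 y * cmod (\<Phi> y)))"
    and F1_def: "F1 = (C / sqrt (2 * pi)) * (LINT y|lborel. u1 y * \<bar>y\<bar>)"
    and F2_def: "F2 = (C / sqrt (2 * pi)) * (LINT y|lborel. u1 y + \<bar>y\<bar> * u2 y)"
    and A1_def: "A1 = (1 / sqrt (2 * pi)) *
             ((LINT y|lborel. v y * cmod (cnj (\<Phi> y))) + (LINT y|lborel. w y * cmod (cnj (\<Phi>' y))))"
    and B0_def: "B0 = (Mb / sqrt (2 * pi)) * (LINT y|lborel. w y * \<bar>y\<bar>)"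
    and B1_def: "B1 = (Mb / sqrt (2 * pi)) * (LINT y|lborel. w y + \<bar>y\<bar> * v y)"
    and e_def: "e = \<delta> * sqrt \<epsilon>"
    and A\<theta>_def: "A\<theta> = (LBINT s:{1 / (2 * \<theta>)..}. sqrt (s + 1) / s\<^sup>2)"
    and \<tau>1_def: "\<tau>1 = exp (1 / 2) * e / (2 powr (7 / 4) * (64 + e\<^sup>2) powr (1 / 4))"
    and \<tau>2_def: "\<tau>2 = sqrt (32 * ln (1 + e\<^sup>2 / 60))"
    and \<tau>3_def: "\<tau>3 = sqrt (ln (1 + e ^ 3 / 8)) / sqrt 2"
    and \<tau>s_def: "\<tau>s = min \<tau>1 (min \<tau>2 \<tau>3)"
    and Q_def: "Q = exp (1 / 2) * e * \<theta> * (1 - \<theta>) / (2 powr (9 / 4) * A\<theta> * T * (1 + e ^ 3 / 8))"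
    and N0s_def: "N0s = 1 + 8 * A1\<^sup>2 / Q\<^sup>2"
    and Ns_def: "Ns = max (1 + log 8 (4 * B0\<^sup>2 / (7 * Q\<^sup>2))) (3 + log 2 (4 * B1\<^sup>2 / Q\<^sup>2))"
    and Ms_def: "Ms = 1 + 16 * B1\<^sup>2 / Q\<^sup>2"
    and N0ss_def: "N0ss = 6 / \<tau>s\<^sup>2 * E2\<^sup>2 * T\<^sup>2 + 1"
    and Nss_def: "Nss = max (1 + log 2 (72 * F2\<^sup>2 * T\<^sup>2 / (5 * \<tau>s\<^sup>2)))
                    (1 + log 8 (18 * F1\<^sup>2 * T\<^sup>2 / (7 * \<tau>s\<^sup>2)))"
    and Mss_def: "Mss = 1 + 12 / \<tau>s\<^sup>2 * F2\<^sup>2 * T\<^sup>2"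
    and Xh_def: "Xh = model_X u \<Phi> \<Psi> \<xi> \<eta> N0 N Mj"
    and N0: "N0 > 0" "real N0 > max N0s N0ss"
    and N: "N > 0" "real N > max Ns Nss"
    and Mj: "\<And>j. j < N \<Longrightarrow> Mj j > 0 \<and> real (Mj j) > max Ms Mss"
    and pos: "\<exists>t\<in>{0..T}. (\<integral>\<omega>. (X t \<omega> - Xh t \<omega>)\<^sup>2 \<partial>M) > 0"
  shows "\<exists>A\<in>sets M. {\<omega>\<in>space M. \<exists>t\<in>{0..T}. \<bar>exp (X t \<omega>) / exp (Xh t \<omega>) - 1\<bar> > \<delta>} \<subseteq> A
                  \<and> measure M A \<le> \<epsilon>"
proof -
  interpret prob_space M by (rule P)
  note RC' = RC[unfolded condition_RC_def]
  have X_meas: "X t \<in> borel_measurable M" and X_sq: "integrable M (\<lambda>w. (X t w)\<^sup>2)" for t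
    using RC' by (auto simp: standing_setting_def)
  interpret K: wavelet_kernel u uy \<Phi> \<Psi> \<Phi>' \<Psi>' u1 v w Mb T
  proof
    show "Im (LINT y|lborel. u t y * exp (\<i> * complex_of_real (x * y))) = 0" for t x
      using RC' by blast
  qed (use a_du a_d\<Phi> a_d\<Psi> b_M a_u1 a_i1 a_i2 a_i4 b_vnn b_wnn b_v b_w b_i1 b_i2 b_i3 b_i4 b_i5 b_i6
       in simp_all)
  have A1: "K.A1 = A1" and B0: "K.B0 = B0" and B1: "K.B1 = B1"
    by (simp_all add: K.A1_def K.B0_def K.B1_def A1_def B0_def B1_def)
  have zero: "Re (\<Psi> 0) * Re (K.F t x) = 0" for t x
  proof -
    obtain K where "\<And>n::nat. (\<Sum>j<n. \<Sum>l\<in>{- (int n - 1)..int n - 1}. (Re (coef_b u \<Psi> j l t))\<^sup>2) \<le> K"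
      using expansion_E_bessel[OF E X_meas X_sq, of t] by blast
    then show ?thesis by (rule K.Re_\<Psi>_0_times_F_eq_0)
  qed
  have e_pos: "e > 0" using \<delta> \<epsilon> by (simp add: e_def)
  note Q = Q_bounds[OF T \<theta> e_pos A\<theta>_def Q_def]
  have tail: "(\<Sum>i\<in>F. (coef u \<Phi> \<Psi> t i - coef u \<Phi> \<Psi> s i)\<^sup>2) \<le> (Q * \<bar>t - s\<bar>)\<^sup>2"
    if t: "t \<in> {0..T}" and s: "s \<in> {0..T}" and F: "finite F" "F \<inter> model_index N0 N Mj = {}" for s t F
  proof -
    let ?da = "\<lambda>k. Re (coef_a u \<Phi> k t) - Re (coef_a u \<Phi> k s)"
    let ?db = "\<lambda>j l. Re (coef_b u \<Psi> j l t) - Re (coef_b u \<Psi> j l s)"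
    \<comment> \<open>The thresholds involve no times; multiplying by the square of
      \<open>\<bar>t - s\<bar>\<close> turns them into conditions on increments, also when the two
      times coincide.\<close>
    have scale: "c * (B * \<bar>t - s\<bar>)\<^sup>2 \<le> d * (Q * \<bar>t - s\<bar>)\<^sup>2 * x" if "c * B\<^sup>2 \<le> d * Q\<^sup>2 * x" for c d B x
      using mult_right_mono[OF that, of "\<bar>t - s\<bar>\<^sup>2"] by (simp add: power_mult_distrib mult_ac)
    have N0_1: "real N0 > 1 + 8 * A1\<^sup>2 / Q\<^sup>2" using N0(2) by (simp add: N0s_def)
    have "8 * A1\<^sup>2 / Q\<^sup>2 \<ge> 0" by simp
    with N0_1 have N0_2: "N0 \<ge> 2" by linarith
    have Mj_1: "Mj j \<ge> 2" "16 * B1\<^sup>2 \<le> Q\<^sup>2 * (real (Mj j) - 1)" if "j < N" for j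
    proof -
      have m: "real (Mj j) > 1 + 16 * B1\<^sup>2 / Q\<^sup>2" using Mj[OF that] by (simp add: Ms_def)
      have "16 * B1\<^sup>2 / Q\<^sup>2 \<ge> 0" by simp
      with m show "Mj j \<ge> 2" by linarith
      from m show "16 * B1\<^sup>2 \<le> Q\<^sup>2 * (real (Mj j) - 1)" using Q(1) by (simp add: field_simps)
    qed
    have Ns: "real N > 1 + log 8 (4 / 7 * B0\<^sup>2 / Q\<^sup>2)" "real N > 3 + log 2 (4 * B1\<^sup>2 / Q\<^sup>2)"
      using N(2) by (simp_all add: Ns_def)
    have N_1: "32 * B0\<^sup>2 \<le> 7 * Q\<^sup>2 * 8 ^ N"
      using truncation_level[OF _ Q(1) _ Ns(1)] by simp
    have N_2: "32 * B1\<^sup>2 \<le> Q\<^sup>2 * 2 ^ N"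
      using truncation_level[OF _ Q(1) _ Ns(2)] by simp
    have "(\<Sum>i\<in>F. (case i of Inl k \<Rightarrow> ?da k | Inr (j, l) \<Rightarrow> ?db j l)\<^sup>2) \<le> (Q * \<bar>t - s\<bar>)\<^sup>2"
    proof (rule tail_squares_le[where \<alpha>="A1 * \<bar>t - s\<bar>" and ?\<beta>0.0="B0 * \<bar>t - s\<bar>" and ?\<beta>1.0="B1 * \<bar>t - s\<bar>"])
      show "\<bar>real_of_int k\<bar> * \<bar>?da k\<bar> \<le> A1 * \<bar>t - s\<bar>" for k
        using K.coef_a_decay[OF t s] unfolding A1 .
      show "\<bar>real_of_int l\<bar> * \<bar>?db j l\<bar> \<le> 2 powr (- real j / 2) * (B1 * \<bar>t - s\<bar>)" for j l
        using K.coef_b_decay(1)[OF zero t s] unfolding B1 .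
      show "\<bar>?db j l\<bar> \<le> 2 powr (- real j / 2) * (B0 * \<bar>t - s\<bar>) / 2 ^ j" for j l
        using K.coef_b_decay(2)[OF zero t s] unfolding B0 .
      show "8 * (A1 * \<bar>t - s\<bar>)\<^sup>2 \<le> (Q * \<bar>t - s\<bar>)\<^sup>2 * (real N0 - 1)"
        using scale[of 8 A1 1 "real N0 - 1"] N0_1 Q(1) by (simp add: field_simps)
      show "Mj j \<ge> 2 \<and> 16 * (B1 * \<bar>t - s\<bar>)\<^sup>2 \<le> (Q * \<bar>t - s\<bar>)\<^sup>2 * (real (Mj j) - 1)" if "j < N" for j
        using scale[of 16 B1 1 "real (Mj j) - 1"] Mj_1[OF that] by simp
      show "32 * (B0 * \<bar>t - s\<bar>)\<^sup>2 \<le> 7 * (Q * \<bar>t - s\<bar>)\<^sup>2 * 8 ^ N" by (rule scale[OF N_1])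
      show "32 * (B1 * \<bar>t - s\<bar>)\<^sup>2 \<le> (Q * \<bar>t - s\<bar>)\<^sup>2 * 2 ^ N"
        using scale[of 32 B1 1 "2 ^ N"] N_2 by simp
    qed (use N0_2 F in auto)
    also have "(\<lambda>i. (case i of Inl k \<Rightarrow> ?da k | Inr (j, l) \<Rightarrow> ?db j l)\<^sup>2)
        = (\<lambda>i. (coef u \<Phi> \<Psi> t i - coef u \<Phi> \<Psi> s i)\<^sup>2)"
      by (auto simp: coef_def split: sum.split prod.split)
    finally show ?thesis .
  qed
  define Z where "Z t \<omega> = X t \<omega> - Xh t \<omega>" for t \<omega>
  have sgf: "strictly_sub_gaussian M (family \<xi> \<eta> i)" for i
    using ssg\<xi> ssg\<eta> by (auto simp: family_def split: sum.split prod.split)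
  have indep': "indep_vars (\<lambda>_. borel) (family \<xi> \<eta>) UNIV"
    using indep by (simp add: family_def[abs_def])
  have sgZ: "subG_bound M (\<lambda>\<omega>. Z t \<omega> - Z s \<omega>) (Q * \<bar>t - s\<bar>)"
    if s: "s \<in> {0..T}" and t: "t \<in> {0..T}" for s t
    unfolding Z_def Xh_def
    by (rule model_error_increment[OF E X_meas X_sq indep' sgf])
      (use tail[OF t s] Q(1) in auto)
  have Xh_meas: "Xh t \<in> borel_measurable M" for t
    unfolding Xh_def model_X_eq[abs_def]
    by (intro borel_measurable_sum borel_measurable_times expansion_E_family(1)[OF E]) auto
  have Z_meas: "Z t \<in> borel_measurable M" for t
    unfolding Z_def[abs_def] by (intro borel_measurable_diff X_meas Xh_meas)
  \<comment> \<open>At time 0 the model vanishes everywhere, but the process only almost surely,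
    through its variance; the null set \<open>N2\<close> collects the difference.\<close>
  have u0: "u 0 y = 0" for y using a_u1[of 0 y] by simp
  have Xh0: "Xh 0 \<omega> = 0" for \<omega>
    by (simp add: Xh_def model_X_def coef_a_def coef_b_def u0)
  have "complex_of_real (\<integral>\<omega>. X 0 \<omega> * X 0 \<omega> \<partial>M) = (LINT y|lborel. u 0 y * cnj (u 0 y))"
    using RC' unfolding standing_setting_def by blast
  then have "(\<integral>\<omega>. (X 0 \<omega>)\<^sup>2 \<partial>M) = 0" by (simp add: u0 power2_eq_square)
  then have "AE \<omega> in M. (X 0 \<omega>)\<^sup>2 = 0"
    using integral_nonneg_eq_0_iff_AE[OF X_sq] by simp
  then obtain N2 where N2: "N2 \<in> null_sets M" "\<And>\<omega>. \<omega> \<in> space M - N2 \<Longrightarrow> Z 0 \<omega> = 0"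
    by (auto simp: eventually_ae_filter Z_def Xh0)
  obtain D N1 where D: "countable D" and N1: "N1 \<in> null_sets M"
    and dense: "\<And>\<omega> t. \<omega> \<in> space M - N1 \<Longrightarrow> \<exists>s::nat \<Rightarrow> real. (\<forall>n. s n \<in> D) \<and> s \<longlonglongrightarrow> t \<and>
          (\<lambda>n. X (s n) \<omega>) \<longlonglongrightarrow> X t \<omega>"
    using sep unfolding separable_process_def by blast
  \<comment> \<open>The approximating sequences from separability may reach 0 or \<open>T\<close>
    from outside the interval, so both endpoints are put into the countable set and only interior
    points are treated as limits.\<close>
  define D' where "D' = (D \<inter> {0..T}) \<union> {0, T}"
  have D': "countable D'" "D' \<subseteq> {0..T}" using D T by (auto simp: D'_def)
  obtain A where A: "A \<in> sets M" "measure M A \<le> 96 * (Q * T)\<^sup>2 / \<delta>\<^sup>2"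
    and good: "\<And>\<omega> s. \<omega> \<in> space M - A \<Longrightarrow> s \<in> D' \<Longrightarrow> exp \<bar>Z s \<omega> - Z 0 \<omega>\<bar> - 1 \<le> \<delta>"
    using chaining[OF P T less_imp_le[OF Q(1)] \<delta> Z_meas sgZ Q(3) D'] by blast
  have lip: "\<exists>L. \<forall>s\<in>{0..T}. \<forall>t\<in>{0..T}. \<bar>coef u \<Phi> \<Psi> t i - coef u \<Phi> \<Psi> s i\<bar> \<le> L * \<bar>t - s\<bar>" for i
  proof (cases i)
    case (Inl k)
    have "\<bar>coef u \<Phi> \<Psi> t i - coef u \<Phi> \<Psi> s i\<bar>
        \<le> (1 / sqrt (2 * pi) * (LINT y|lborel. w y * cmod (\<Phi> y))) * \<bar>t - s\<bar>"
      if "s \<in> {0..T}" "t \<in> {0..T}" for s t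
      using K.coef_a_lipschitz[OF that(2,1), of k] by (simp only: coef_def Inl sum.case)
    then show ?thesis by blast
  next
    case (Inr p)
    obtain j l where p: "p = (j, l)" by (cases p)
    have "\<bar>coef u \<Phi> \<Psi> t i - coef u \<Phi> \<Psi> s i\<bar> \<le> (2 powr (- real j / 2) * B0 / 2 ^ j) * \<bar>t - s\<bar>"
      if "s \<in> {0..T}" "t \<in> {0..T}" for s t
      using K.coef_b_decay(2)[OF zero that(2,1), of j l] unfolding B0
      by (simp add: coef_def Inr p mult_ac)
    then show ?thesis by blast
  qed
  have coef_cont: "continuous_on {0..T} (\<lambda>t. coef u \<Phi> \<Psi> t i)" for i
  proof -
    obtain L where L: "\<And>s t. s \<in> {0..T} \<Longrightarrow> t \<in> {0..T} \<Longrightarrow>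
        \<bar>coef u \<Phi> \<Psi> t i - coef u \<Phi> \<Psi> s i\<bar> \<le> L * \<bar>t - s\<bar>" using lip by blast
    have "(\<bar>L\<bar>)-lipschitz_on {0..T} (\<lambda>t. coef u \<Phi> \<Psi> t i)"
    proof (rule lipschitz_onI)
      fix x y assume "x \<in> {0..T}" "y \<in> {0..T}"
      from L[OF this(2,1)] show "dist (coef u \<Phi> \<Psi> x i) (coef u \<Phi> \<Psi> y i) \<le> \<bar>L\<bar> * dist x y"
        unfolding dist_real_def by (rule order_trans) (intro mult_right_mono abs_ge_self abs_ge_zero)
    qed simp
    then show ?thesis by (rule lipschitz_on_continuous_on)
  qed
  \<comment> \<open>Separability concerns \<open>X\<close> only; continuity of the model is what
    lets the error converge along the same sequences.\<close>
  have Xh_cont: "continuous_on {0..T} (\<lambda>t. Xh t \<omega>)" for \<omega>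
    unfolding Xh_def model_X_eq by (intro continuous_intros coef_cont)
  have bound: "exp \<bar>Z t \<omega>\<bar> - 1 \<le> \<delta>"
    if \<omega>: "\<omega> \<in> space M - (A \<union> N1 \<union> N2)" and t: "t \<in> {0..T}" for t \<omega>
  proof -
    have D'_bound: "exp \<bar>Z s \<omega>\<bar> - 1 \<le> \<delta>" if "s \<in> D'" for s
      using good[of \<omega> s] N2(2)[of \<omega>] \<omega> that by simp
    show ?thesis
    proof (cases "t \<in> {0, T}")
      case True
      then show ?thesis by (intro D'_bound) (auto simp: D'_def)
    next
      case False
      with t have t': "t \<in> {0<..<T}" by auto
      obtain s where s: "\<And>n. s n \<in> D" "s \<longlonglongrightarrow> t" and Xs: "(\<lambda>n. X (s n) \<omega>) \<longlonglongrightarrow> X t \<omega>"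
        using dense[of \<omega> t] \<omega> by auto
      have ev: "\<forall>\<^sub>F n in sequentially. s n \<in> {0<..<T}"
        using s(2) t' by (intro topological_tendstoD) auto
      have "isCont (\<lambda>t. Xh t \<omega>) t"
        using Xh_cont t' by (intro continuous_on_interior[of "{0..T}"]) auto
      then have "(\<lambda>n. Xh (s n) \<omega>) \<longlonglongrightarrow> Xh t \<omega>"
        using s(2) by (rule isCont_tendsto_compose)
      with Xs have "(\<lambda>n. exp \<bar>Z (s n) \<omega>\<bar> - 1) \<longlonglongrightarrow> exp \<bar>Z t \<omega>\<bar> - 1"
        unfolding Z_def by (intro tendsto_intros)
      moreover have "\<forall>\<^sub>F n in sequentially. exp \<bar>Z (s n) \<omega>\<bar> - 1 \<le> \<delta>"
        using ev by eventually_elim (use s(1) in \<open>auto intro!: D'_bound simp: D'_def\<close>)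
      ultimately show ?thesis
        by (rule tendsto_upperbound) simp
    qed
  qed
  show ?thesis
  proof (intro bexI[of _ "A \<union> N1 \<union> N2"] conjI subsetI)
    show "A \<union> N1 \<union> N2 \<in> sets M" using A(1) N1 N2(1) by auto
    have "measure M (A \<union> N1 \<union> N2) = measure M A"
      using measure_Un_null_set[OF A(1) null_sets.Un[OF N1 N2(1)]] by (simp add: Un_assoc)
    also have "\<dots> \<le> 96 * (Q * T)\<^sup>2 / \<delta>\<^sup>2" by (rule A(2))
    \<comment> \<open>The choice \<open>e = \<delta> * sqrt \<epsilon>\<close> makes the Markov
      bound equal to \<open>\<epsilon>\<close>.\<close>
    also have "\<dots> \<le> e\<^sup>2 / \<delta>\<^sup>2" by (intro divide_right_mono Q(2)) simp
    also have "\<dots> = \<epsilon>" using \<delta> \<epsilon> by (simp add: e_def power_mult_distrib)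
    finally show "measure M (A \<union> N1 \<union> N2) \<le> \<epsilon>" .
    fix \<omega> assume "\<omega> \<in> {\<omega>\<in>space M. \<exists>t\<in>{0..T}. \<bar>exp (X t \<omega>) / exp (Xh t \<omega>) - 1\<bar> > \<delta>}"
    then obtain t where t: "\<omega> \<in> space M" "t \<in> {0..T}" "\<bar>exp (Z t \<omega>) - 1\<bar> > \<delta>"
      by (auto simp: Z_def exp_diff)
    with abs_exp_minus_1_le[of "Z t \<omega>"] bound[of \<omega> t] show "\<omega> \<in> A \<union> N1 \<union> N2"
      by fastforce
  qed
qed

end
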